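(* Let $\mathcal M_1 = (M,T_1,p_1)$ and $\mathcal M_2 = (M,T_2,p_2)$ be non-degenerate commuting $\Lambda$-Markov systems with constant transition probabilities and disjoint images. Suppose $\mu$ is a Borel probability measure on $M$ that is stationary for both systems, and $A\subset M$ is a measurable set with $\mu(A)>0$. Then for each positive integer $r$ and all $u,v\in\mathbb{Z}_{>0}^2$ there exists a positive integer $n$ such that there exists an $(nu,nv)$-arithmetic product tree of order $r$ in $A$. Moreover, there is a subset $A'\subset A$ with $\mu(A')>0$ such that every $a\in A'$ is the root of an $(nu,nv)$-arithmetic product tree of order $r$ in $A$.
   Context: $\Lambda$ is a finite set. A $\Lambda$-Markov system $(M,T,p)$ consists of a compact metric space $M$ and continuous maps $T_\lambda:M\to M$, $p_\lambda:M\to[0,1]$ ($\lambda\in\Lambda$) with $\sum_\lambda p_\lambda(x)=1$. Markov operator: $(Pf)(x)=\sum_\lambda p_\lambda(x)f(T_\lambda x)$; $\mu$ is stationary if $\int Pf\,d\mu = \int f\,d\mu$ for all $f\in C(M)$. Constant transition probabilities: each $p_\lambda$ is constant. Non-degenerate: no $p_\lambda$ is identically $0$ on $M$. Disjoint images: $T_\lambda(M)\cap T_{\lambda'}(M)=\emptyset$ for $\lambda\ne\lambda'$. Two systems commute if $(T_1)_\lambda(T_2)_{\lambda'} = (T_2)_{\lambda'}(T_1)_\lambda$ for all $\lambda,\lambda'$. A path from $x$ to $x'$ in $(M,T,p)$ is a sequence $x_0=x,\ldots,x_n=x'$ such that for each $i<n$ there is $\lambda_i$ with $x_{i+1}=T_{\lambda_i}x_i$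 and $p_{\lambda_i}(x_i)>0$; its length is $n$ and (if $n>0$) its initial direction is $\lambda_0$. $\widetilde\Gamma$ is the free monoid on the letters $\{X_\lambda:\lambda\in\Lambda\}\sqcup\{Y_\lambda:\lambda\in\Lambda\}$ and $B_r(\widetilde\Gamma)$ is the set of its words of length at most $r$. For $u=(u_1,u_2),v=(v_1,v_2)\in\mathbb{Z}_{\ge0}^2$, a $(u,v)$-arithmetic product tree of order $r$ in $A$ is a map $\phi:B_r(\widetilde\Gamma)\to A$ such that for all $\gamma\in B_{r-1}(\widetilde\Gamma)$ and $\lambda\in\Lambda$: (1) there is a path in $\mathcal M_1$ of length $u_1$ with initial direction $\lambda$ from $\phi(\gamma)$ to some point $x$, followed by a path in $\mathcal M_2$ of length $u_2$ from $x$ to $\phi(\gamma X_\lambda)$; (2) there is a path in $\mathcal M_2$ of length $v_2$ with initial direction $\lambda$ from $\phi(\gamma)$ to some point $x$, followed by a path in $\mathcal M_1$ of length $v_1$ from $x$ to $\phi(\gamma Y_\lambda)$. Its root is $\phi(\emptyset)$. *)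

theory Defs
  imports "HOL-Probability.Probability"
begin

text \<open>
  The compact metric space is a compact subset \<open>M\<close> of a metric space, with the restricted metric,
  and the finite index set is a type of class \<open>finite\<close>. The values of \<open>T l\<close> and \<open>p l\<close> outside \<open>M\<close>
  are irrelevant.
\<close>

definition markov_system ::
  "'m::metric_space set \<Rightarrow> ('l::finite \<Rightarrow> 'm \<Rightarrow> 'm) \<Rightarrow> ('l \<Rightarrow> 'm \<Rightarrow> real) \<Rightarrow> bool" where
  "markov_system M T p \<longleftrightarrow>
     compact M \<and>
     (\<forall>l. continuous_on M (T l) \<and> T l \<in> M \<rightarrow> M) \<and>
     (\<forall>l. continuous_on M (p l) \<and> p l \<in> M \<rightarrow> {0..1}) \<and>
     (\<forall>x\<in>M. (\<Sum>l\<in>UNIV. p l x) = 1)"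

definition markov_operator ::
  "('l::finite \<Rightarrow> 'm \<Rightarrow> 'm) \<Rightarrow> ('l \<Rightarrow> 'm \<Rightarrow> real) \<Rightarrow> ('m \<Rightarrow> real) \<Rightarrow> 'm \<Rightarrow> real" where
  "markov_operator T p f x = (\<Sum>l\<in>UNIV. p l x * f (T l x))"

definition borel_probability_on :: "'m::metric_space set \<Rightarrow> 'm measure \<Rightarrow> bool" where
  "borel_probability_on M \<mu> \<longleftrightarrow> prob_space \<mu> \<and> space \<mu> = M \<and> sets \<mu> = sets (restrict_space borel M)"

definition stationary ::
  "'m::metric_space set \<Rightarrow> ('l::finite \<Rightarrow> 'm \<Rightarrow> 'm) \<Rightarrow> ('l \<Rightarrow> 'm \<Rightarrow> real) \<Rightarrow> 'm measure \<Rightarrow> bool" where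
  "stationary M T p \<mu> \<longleftrightarrow>
     (\<forall>f. continuous_on M f \<longrightarrow> (\<integral>x. markov_operator T p f x \<partial>\<mu>) = (\<integral>x. f x \<partial>\<mu>))"

definition constant_probabilities :: "'m set \<Rightarrow> ('l \<Rightarrow> 'm \<Rightarrow> real) \<Rightarrow> bool" where
  "constant_probabilities M p \<longleftrightarrow> (\<forall>l. \<exists>c. \<forall>x\<in>M. p l x = c)"

definition nondegenerate :: "'m set \<Rightarrow> ('l \<Rightarrow> 'm \<Rightarrow> real) \<Rightarrow> bool" where
  "nondegenerate M p \<longleftrightarrow> (\<forall>l. \<not> (\<forall>x\<in>M. p l x = 0))"

definition disjoint_images :: "'m set \<Rightarrow> ('l \<Rightarrow> 'm \<Rightarrow> 'm) \<Rightarrow> bool" where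
  "disjoint_images M T \<longleftrightarrow> (\<forall>l l'. l \<noteq> l' \<longrightarrow> T l ` M \<inter> T l' ` M = {})"

definition commuting_systems :: "'m set \<Rightarrow> ('l \<Rightarrow> 'm \<Rightarrow> 'm) \<Rightarrow> ('l \<Rightarrow> 'm \<Rightarrow> 'm) \<Rightarrow> bool" where
  "commuting_systems M T1 T2 \<longleftrightarrow> (\<forall>l l'. \<forall>x\<in>M. T1 l (T2 l' x) = T2 l' (T1 l x))"

text \<open>A path of length \<open>n\<close> consists of the values \<open>xs 0, \<dots>, xs n\<close> only.\<close>

definition markov_path ::
  "'m set \<Rightarrow> ('l \<Rightarrow> 'm \<Rightarrow> 'm) \<Rightarrow> ('l \<Rightarrow> 'm \<Rightarrow> real) \<Rightarrow> nat \<Rightarrow> (nat \<Rightarrow> 'm) \<Rightarrow> 'm \<Rightarrow> 'm \<Rightarrow> bool" where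
  "markov_path M T p n xs x x' \<longleftrightarrow>
     (\<forall>i\<le>n. xs i \<in> M) \<and> xs 0 = x \<and> xs n = x' \<and>
     (\<forall>i<n. \<exists>l. xs (Suc i) = T l (xs i) \<and> p l (xs i) > 0)"

definition initial_direction ::
  "('l \<Rightarrow> 'm \<Rightarrow> 'm) \<Rightarrow> ('l \<Rightarrow> 'm \<Rightarrow> real) \<Rightarrow> nat \<Rightarrow> (nat \<Rightarrow> 'm) \<Rightarrow> 'l \<Rightarrow> bool" where
  "initial_direction T p n xs l \<longleftrightarrow> n > 0 \<and> xs 1 = T l (xs 0) \<and> p l (xs 0) > 0"

text \<open>
  The free monoid on the letters is the type of lists, with the empty word \<open>[]\<close> and
  right multiplication by a letter \<open>w @ [a]\<close>.
\<close>

datatype 'l letter = LX 'l | LY 'l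

definition word_ball :: "nat \<Rightarrow> 'l letter list set" where
  "word_ball r = {w. length w \<le> r}"

text \<open>
  Only the values of \<open>\<phi>\<close> on \<open>word_ball r\<close> matter. The ball of radius \<open>r - 1\<close> is written as
  \<open>length w < r\<close>, so that it is empty for \<open>r = 0\<close>.
\<close>

definition product_tree ::
  "'m set \<Rightarrow> ('l \<Rightarrow> 'm \<Rightarrow> 'm) \<Rightarrow> ('l \<Rightarrow> 'm \<Rightarrow> real) \<Rightarrow> ('l \<Rightarrow> 'm \<Rightarrow> 'm) \<Rightarrow> ('l \<Rightarrow> 'm \<Rightarrow> real) \<Rightarrow>
   nat \<times> nat \<Rightarrow> nat \<times> nat \<Rightarrow> nat \<Rightarrow> 'm set \<Rightarrow> ('l letter list \<Rightarrow> 'm) \<Rightarrow> bool" where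
  "product_tree M T1 p1 T2 p2 u v r A \<phi> \<longleftrightarrow>
     \<phi> \<in> word_ball r \<rightarrow> A \<and>
     (\<forall>w l. length w < r \<longrightarrow>
        (\<exists>x xs ys. markov_path M T1 p1 (fst u) xs (\<phi> w) x \<and> initial_direction T1 p1 (fst u) xs l \<and>
                   markov_path M T2 p2 (snd u) ys x (\<phi> (w @ [LX l]))) \<and>
        (\<exists>x xs ys. markov_path M T2 p2 (snd v) xs (\<phi> w) x \<and> initial_direction T2 p2 (snd v) xs l \<and>
                   markov_path M T1 p1 (fst v) ys x (\<phi> (w @ [LY l]))))"

definition tree_root :: "('l letter list \<Rightarrow> 'm) \<Rightarrow> 'm" where
  "tree_root \<phi> = \<phi> []"

end

theory Submission
  imports Defs
begin

text \<open>
  Let \<open>P\<^sub>1\<close>, \<open>P\<^sub>2\<close> be the two commuting Markov operators, \<open>P\<^sup>z = P\<^sub>1\<^sup>a P\<^sub>2\<^sup>b\<close> for \<open>z = (a, b)\<close>, and \<open>f\<close>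
  the indicator of \<open>A\<close>. The norms of \<open>P\<^sup>z f\<close> in \<open>L\<^sup>2\<close> decrease in \<open>z\<close>, so for large \<open>z\<close> they are almost constant;
  then \<open>P\<^sup>z f\<close> at the end of a random path is, up to a small variance, determined by the starting
  point of the path, whatever its first direction. Trees with root \<open>x\<close> therefore exist for most \<open>x \<in> A\<close>
  at which \<open>P\<^sup>z f\<close> is bounded below for all \<open>z = n (i u + j v)\<close> with \<open>0 < i + j \<le> r\<close>.

  That such \<open>x\<close> form a set of measure bounded below, for suitable \<open>n\<close>, is a two-dimensional multiple
  recurrence statement. It follows from the density Hales--Jewett theorem: every word over the finite
  alphabet of all \<open>i u + j v\<close> is sent to a multiple of the sum of its letters, and lines become patterns.

  Density Hales--Jewett is proved by induction on the alphabet, by density increment for the uniform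
  measure. A line-free set of nearly maximal density correlates with an intersection of insensitive
  sets, and such an intersection is almost a disjoint union of large subspaces, on each of which a
  line-free set has no more than the critical density.
\<close>

section \<open>Words and combinatorial subspaces\<close>

text \<open>The induction on the alphabet meets one obstacle twice: words over \<open>k\<close>
  letters have vanishing share among words over \<open>k + 1\<close> letters, so the hypothesis for
  \<open>k\<close> says nothing about a set that is dense for the larger alphabet.
  \<open>insertion\<close> gets around it: a bounded number of letters put into a long random word
  is hidden by the natural fluctuation of letter counts. The pointers in line words have the same
  origin. They turn a random word into a random line, and restricting the inserted letters to
  \<open>k\<close> constants and one pointer makes that line uniform in the inserted coordinates.

  On the Markov side, a combinatorial line gives a pattern shifted by an unknown amount
  \<open>z\<close>, while a tree has to start in \<open>A\<close> itself. Stationarity and small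
  variance remove the shift: integrating \<open>P\<close> to the power \<open>z\<close> of an
  indicator returns the measure of the set.

  The order of the constants is essential. The lower bound for the recurrence set is fixed before
  the tolerance of the energies, so the tolerance can be chosen to keep every exceptional set below
  half of that bound.\<close>

definition words :: "nat set \<Rightarrow> nat \<Rightarrow> nat list set" where
  "words R n = {w. length w = n \<and> set w \<subseteq> R}"

text \<open>In a subspace \<open>Inl a\<close> is a fixed letter and \<open>Inr i\<close> the \<open>i\<close>-th wildcard.\<close>

definition fill :: "(nat + nat) list \<Rightarrow> nat list \<Rightarrow> nat list" where
  "fill S y = map (case_sum id ((!) y)) S"

text \<open>The parameter \<open>k\<close> bounds the fixed letters only. A member may therefore be
  filled with words over a larger alphabet, which the insensitive sets exploit. Since every wildcard
  occurs, filling is injective.\<close>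

definition subspaces :: "nat \<Rightarrow> nat \<Rightarrow> nat \<Rightarrow> (nat + nat) list set" where
  "subspaces k m n = {S. length S = n \<and> set S \<subseteq> Inl ` {..<k} \<union> Inr ` {..<m} \<and> Inr ` {..<m} \<subseteq> set S}"

text \<open>With \<open>k\<close> as an extra top letter this has two readings: it evaluates at
  \<open>i\<close> the line whose active coordinates are marked by \<open>k\<close>, and it picks a
  representative of a word up to exchanging \<open>i\<close> and \<open>k\<close>.\<close>

definition replace :: "nat \<Rightarrow> nat \<Rightarrow> nat list \<Rightarrow> nat list" where
  "replace k i w = map (\<lambda>a. if a = k then i else a) w"

lemma words_0 [simp]: "words R 0 = {[]}"
  by (auto simp: words_def)

lemma finite_words [simp]: "finite R \<Longrightarrow> finite (words R n)"
  unfolding words_def using finite_lists_length_eq[of R n] by (simp add: conj_commute)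

lemma card_words [simp]: "finite R \<Longrightarrow> card (words R n) = card R ^ n"
  unfolding words_def using card_lists_length_eq[of R n] by (simp add: conj_commute)

lemma words_nth: "w \<in> words R n \<Longrightarrow> i < n \<Longrightarrow> w ! i \<in> R"
  unfolding words_def using nth_mem by blast

lemma words_mono: "R \<subseteq> R' \<Longrightarrow> words R n \<subseteq> words R' n"
  by (auto simp: words_def)

lemma sum_words_append:
  fixes f :: "nat list \<Rightarrow> real"
  shows "(\<Sum>w\<in>words R (m + n). f w) = (\<Sum>u\<in>words R m. \<Sum>v\<in>words R n. f (u @ v))"
proof -
  have "(\<Sum>w\<in>words R (m + n). f w) = (\<Sum>(u, v)\<in>words R m \<times> words R n. f (u @ v))"
    by (rule sum.reindex_bij_witness[of _ "\<lambda>(u, v). u @ v" "\<lambda>w. (take m w, drop m w)"])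
       (auto simp: words_def dest: in_set_takeD in_set_dropD)
  then show ?thesis by (simp add: sum.cartesian_product)
qed

lemma sum_words_1:
  fixes f :: "nat list \<Rightarrow> real"
  shows "(\<Sum>w\<in>words R (Suc 0). f w) = (\<Sum>a\<in>R. f [a])"
  by (rule sum.reindex_bij_witness[of _ "\<lambda>a. [a]" hd]) (auto simp: words_def length_Suc_conv)

lemma sum_words_Suc:
  fixes f :: "nat list \<Rightarrow> real"
  shows "(\<Sum>w\<in>words R (Suc n). f w) = (\<Sum>a\<in>R. \<Sum>v\<in>words R n. f (a # v))"
  using sum_words_append[of f R "Suc 0" n] sum_words_1[of "\<lambda>u. \<Sum>v\<in>words R n. f (u @ v)" R] by simp

lemma finite_subspaces [simp]: "finite (subspaces k m n)"
proof (rule finite_subset)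
  show "subspaces k m n \<subseteq> {S. set S \<subseteq> Inl ` {..<k} \<union> Inr ` {..<m} \<and> length S = n}"
    by (auto simp: subspaces_def)
qed (auto intro!: finite_lists_length_eq)

lemma subspaces_mono: "k \<le> k' \<Longrightarrow> subspaces k m n \<subseteq> subspaces k' m n"
  unfolding subspaces_def using image_mono[of "{..<k}" "{..<k'}" Inl] by auto

lemma subspaces_entryE:
  assumes "S \<in> subspaces k m n" "c \<in> set S"
  obtains a where "c = Inl a" "a < k" | i where "c = Inr i" "i < m"
proof -
  have "c \<in> Inl ` {..<k} \<union> Inr ` {..<m}" using assms by (auto simp: subspaces_def)
  then show ?thesis using that by auto
qed

lemma fill_in_words:
  assumes "S \<in> subspaces k m n" "y \<in> words R m" "{..<k} \<subseteq> R"
  shows "fill S y \<in> words R n"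
proof -
  have "case_sum id ((!) y) c \<in> R" if "c \<in> set S" for c
    using assms(1) that
  proof (cases rule: subspaces_entryE)
    case (1 a)
    then show ?thesis using assms(3) by auto
  next
    case (2 i)
    then have "y ! i \<in> set y" using assms(2) by (auto simp: words_def)
    then show ?thesis using 2 assms(2) by (auto simp: words_def)
  qed
  then show ?thesis using assms by (auto simp: fill_def words_def subspaces_def)
qed

lemma inj_on_fill:
  assumes "S \<in> subspaces k m n"
  shows "inj_on (fill S) (words R m)"
proof (rule inj_onI)
  fix y y' assume *: "y \<in> words R m" "y' \<in> words R m" "fill S y = fill S y'"
  have "y ! i = y' ! i" if "i < m" for i
  proof -
    have "Inr i \<in> set S" using assms that by (auto simp: subspaces_def)
    then show ?thesis using *(3) by (auto simp: fill_def)
  qed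
  then show "y = y'" using * by (auto simp: words_def intro: nth_equalityI)
qed

definition subspace_comp :: "(nat + nat) list \<Rightarrow> (nat + nat) list \<Rightarrow> (nat + nat) list" where
  "subspace_comp S T = map (case_sum Inl ((!) T)) S"

lemma subspace_comp_in:
  assumes "S \<in> subspaces k m n" "T \<in> subspaces k p m"
  shows "subspace_comp S T \<in> subspaces k p n"
proof -
  have S: "set S \<subseteq> Inl ` {..<k} \<union> Inr ` {..<m}" "Inr ` {..<m} \<subseteq> set S" "length S = n"
    and T: "set T \<subseteq> Inl ` {..<k} \<union> Inr ` {..<p}" "Inr ` {..<p} \<subseteq> set T" "length T = m"
    using assms by (auto simp: subspaces_def)
  have "case_sum Inl ((!) T) c \<in> Inl ` {..<k} \<union> Inr ` {..<p}" if "c \<in> set S" for c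
  proof -
    have "c \<in> Inl ` {..<k} \<union> Inr ` {..<m}" using that S by blast
    moreover have "T ! i \<in> set T" if "i < m" for i using that T by simp
    ultimately show ?thesis using T(1) by (auto split: sum.splits)
  qed
  moreover have "Inr i \<in> set (subspace_comp S T)" if "i < p" for i
  proof -
    have "Inr i \<in> set T" using T that by auto
    then obtain j where j: "j < m" "T ! j = Inr i" using T(3) by (auto simp: in_set_conv_nth)
    then have "Inr j \<in> set S" using S by auto
    then show ?thesis using j unfolding subspace_comp_def by force
  qed
  ultimately show ?thesis using S(3) by (auto simp: subspaces_def subspace_comp_def)
qed

lemma fill_subspace_comp:
  assumes "S \<in> subspaces k m n" "T \<in> subspaces k' p m"
  shows "fill (subspace_comp S T) y = fill S (fill T y)"
proof -
  have "case_sum id ((!) y) (case_sum Inl ((!) T) c) = case_sum id ((!) (fill T y)) c" if "c \<in> set S" for c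
    using that assms by (auto simp: subspaces_def fill_def split: sum.splits)
  then show ?thesis
    unfolding subspace_comp_def fill_def[of "map _ _"] fill_def[of S] by simp
qed

lemma subspace_append_word:
  assumes "S \<in> subspaces k m n" "x \<in> words {..<k} p"
  shows "S @ map Inl x \<in> subspaces k m (n + p)" and "map Inl x @ S \<in> subspaces k m (p + n)"
  using assms by (auto simp: subspaces_def words_def)

lemma fill_append [simp]: "fill (S @ T) y = fill S y @ fill T y"
  by (simp add: fill_def)

lemma fill_map_Inl [simp]: "fill (map Inl x) y = x"
  by (simp add: fill_def comp_def)

text \<open>Renaming the wildcard of \<open>T\<close> to \<open>m\<close> keeps it apart from those
  of \<open>S\<close>. Dimensions grow by one block of letters at a time in this way.\<close>

lemma subspace_product:
  assumes S: "S \<in> subspaces k m n" and T: "T \<in> subspaces k (Suc 0) p"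
  defines "T' \<equiv> map (map_sum id (\<lambda>_. m)) T"
  shows "S @ T' \<in> subspaces k (Suc m) (n + p)"
    and "length y = m \<Longrightarrow> fill (S @ T') (y @ [a]) = fill S y @ fill T [a]"
proof -
  have "Inr 0 \<in> set T" using T by (auto simp: subspaces_def)
  then have "Inr m \<in> set T'" unfolding T'_def by force
  moreover have "set T' \<subseteq> Inl ` {..<k} \<union> Inr ` {..<Suc m}"
    unfolding T'_def using T by (auto elim!: subspaces_entryE)
  moreover have "set S \<subseteq> Inl ` {..<k} \<union> Inr ` {..<Suc m}"
    using S by (auto elim!: subspaces_entryE)
  moreover have "Inr ` {..<m} \<subseteq> set S" "length S = n" "length T' = p"
    using S T by (auto simp: subspaces_def T'_def)
  ultimately show "S @ T' \<in> subspaces k (Suc m) (n + p)"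
    by (auto simp: subspaces_def lessThan_Suc)
  assume y: "length y = m"
  have "case_sum id ((!) (y @ [a])) c = case_sum id ((!) y) c" if "c \<in> set S" for c
    using S that by (cases rule: subspaces_entryE) (auto simp: nth_append y)
  moreover have "case_sum id ((!) (y @ [a])) (map_sum id (\<lambda>_. m) c) = case_sum id ((!) [a]) c" if "c \<in> set T" for c
    using T that by (cases rule: subspaces_entryE) (auto simp: nth_append y)
  ultimately show "fill (S @ T') (y @ [a]) = fill S y @ fill T [a]"
    by (simp add: fill_def T'_def)
qed

section \<open>Replacing the top letter\<close>

lemma replace_in_words: "w \<in> words {..<Suc k} n \<Longrightarrow> i < k \<Longrightarrow> replace k i w \<in> words {..<k} n"
  by (fastforce simp: words_def replace_def)

lemma replace_append [simp]: "replace k i (u @ v) = replace k i u @ replace k i v"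
  by (simp add: replace_def)

lemma replace_idem: "i \<noteq> k \<Longrightarrow> replace k i (replace k i w) = replace k i w"
  by (simp add: replace_def)

lemma replace_fill:
  assumes "S \<in> subspaces k m n" "length y = m"
  shows "replace k i (fill S y) = fill S (replace k i y)"
proof -
  have "(if case_sum id ((!) y) c = k then i else case_sum id ((!) y) c) =
     case_sum id ((!) (replace k i y)) c" if "c \<in> set S" for c
    using that assms by (auto simp: subspaces_def replace_def split: sum.splits)
  then show ?thesis by (simp add: fill_def replace_def[of k i "map _ S"])
qed

text \<open>Here \<open>S\<close> may contain \<open>k\<close> as a fixed letter, so replacing does
  not commute with filling as in \<open>replace_fill\<close>; the two sides agree only after the
  outer replacement.\<close>

lemma replace_fill_insensitive:
  assumes "S \<in> subspaces (Suc k) m n" "y \<in> words {..<Suc k} m" "i < k"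
  shows "replace k i (fill S (replace k i y)) = replace k i (fill S y)"
proof -
  have "(\<lambda>a. if a = k then i else a) (case_sum id ((!) (replace k i y)) c) =
     (\<lambda>a. if a = k then i else a) (case_sum id ((!) y) c)" if "c \<in> set S" for c
    using that assms by (auto simp: subspaces_def replace_def words_def split: sum.splits)
  then show ?thesis unfolding fill_def replace_def[of k i "map _ S"] by simp
qed

section \<open>Inserting letters into a random word\<close>

lemma sum_sum_list_eq_0:
  fixes g :: "nat \<Rightarrow> real"
  assumes "finite R" "(\<Sum>a\<in>R. g a) = 0"
  shows "(\<Sum>x\<in>words R h. \<Sum>a\<leftarrow>x. g a) = 0"
proof (induction h)
  case (Suc h)
  then show ?case using assms
    by (simp add: sum_words_Suc sum.distrib sum_distrib_left[symmetric])
qed simp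

text \<open>The letters of a uniform word are independent and \<open>g\<close> is centred, so the
  cross terms vanish and the variances add up.\<close>

lemma sum_sum_list_squared_le:
  fixes g :: "nat \<Rightarrow> real" and B :: real
  assumes "finite R" "(\<Sum>a\<in>R. g a) = 0" "\<And>a. a \<in> R \<Longrightarrow> \<bar>g a\<bar> \<le> B"
  shows "(\<Sum>x\<in>words R h. (\<Sum>a\<leftarrow>x. g a)\<^sup>2) \<le> h * B\<^sup>2 * card R ^ h"
proof (induction h)
  case (Suc h)
  let ?s = "\<lambda>x. \<Sum>a\<leftarrow>x. g a"
  have "(\<Sum>x\<in>words R (Suc h). (?s x)\<^sup>2) = (\<Sum>a\<in>R. \<Sum>x\<in>words R h. (g a)\<^sup>2 + 2 * g a * ?s x + (?s x)\<^sup>2)"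
    by (simp add: sum_words_Suc power2_sum algebra_simps)
  also have "\<dots> = (\<Sum>a\<in>R. card R ^ h * (g a)\<^sup>2 + (\<Sum>x\<in>words R h. (?s x)\<^sup>2))"
    using assms by (simp add: sum.distrib sum_distrib_left[symmetric] sum_sum_list_eq_0)
  also have "\<dots> \<le> (\<Sum>a\<in>R. card R ^ h * B\<^sup>2 + h * B\<^sup>2 * card R ^ h)"
  proof (intro sum_mono add_mono mult_left_mono Suc)
    show "(g a)\<^sup>2 \<le> B\<^sup>2" if "a \<in> R" for a
      using power_mono[OF assms(3)[OF that], of 2] by simp
  qed simp
  also have "\<dots> = Suc h * B\<^sup>2 * card R ^ Suc h"
    by (simp add: algebra_simps)
  finally show ?case .
qed simp

text \<open>The map sending \<open>(x, c)\<close> to \<open>(x[j := c], x ! j)\<close> swaps the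
  letter at \<open>j\<close> with the free letter. It is a bijection whose inverse has the same
  formula.\<close>

lemma sum_words_update:
  fixes F :: "nat list \<Rightarrow> real"
  assumes "finite L" "R \<subseteq> L" "j < h"
  shows "(\<Sum>x\<in>words L h. \<Sum>c\<in>R. F (x[j := c])) = card L * (\<Sum>x\<in>words L h. of_bool (x ! j \<in> R) * F x)"
proof -
  have fR: "finite R" using assms finite_subset by auto
  have "(\<Sum>x\<in>words L h. \<Sum>c\<in>R. F (x[j := c])) = (\<Sum>(x, c)\<in>words L h \<times> R. F (x[j := c]))"
    by (simp add: sum.cartesian_product)
  also have "\<dots> = (\<Sum>(x, c)\<in>{x \<in> words L h. x ! j \<in> R} \<times> L. F x)"
  proof (rule sum.reindex_bij_witness[of _ "\<lambda>(x, c). (x[j := c], x ! j)" "\<lambda>(x, c). (x[j := c], x ! j)"])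
    have upd: "set (x[j := c]) \<subseteq> L" if "set x \<subseteq> L" "c \<in> L" for x c
      using set_update_subset_insert[of x j c] that by blast
    have nth: "x ! j \<in> L" if "set x \<subseteq> L" "length x = h" for x
      using nth_mem[of j x] that assms(3) by blast
    show "(case a of (x, c) \<Rightarrow> (x[j := c], x ! j)) \<in> {x \<in> words L h. x ! j \<in> R} \<times> L"
      if "a \<in> words L h \<times> R" for a
      using that upd nth assms(2,3) by (auto simp: words_def simp del: set_update_memI)
    show "(case a of (x, c) \<Rightarrow> (x[j := c], x ! j)) \<in> words L h \<times> R"
      if "a \<in> {x \<in> words L h. x ! j \<in> R} \<times> L" for a
      using that upd by (auto simp: words_def)
  qed (use assms in \<open>auto simp: words_def\<close>)
  also have "\<dots> = card L * (\<Sum>x\<in>{x \<in> words L h. x ! j \<in> R}. F x)"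
    by (simp add: sum.cartesian_product[symmetric] sum_distrib_left)
  also have "(\<Sum>x\<in>{x \<in> words L h. x ! j \<in> R}. F x) = (\<Sum>x\<in>words L h. of_bool (x ! j \<in> R) * F x)"
    using assms by (intro sum.mono_neutral_cong_left) auto
  finally show ?thesis .
qed

text \<open>Overwriting a random position of a random word by a random letter of \<open>R\<close>
  reweights each word by its number of letters from \<open>R\<close>, divided by the expected
  number. For large \<open>h\<close> this ratio is concentrated at 1, so the mean of
  \<open>F\<close> drops by at most \<epsilon>, and some choice of word and position is at least as
  good as the average.\<close>

lemma insertion_one:
  assumes "0 < \<epsilon>"
  shows "\<exists>h. \<forall>R F. R \<subseteq> {..<l} \<longrightarrow> R \<noteq> {} \<longrightarrow> (\<forall>x\<in>words {..<l} h. 0 \<le> F x \<and> F x \<le> 1) \<longrightarrow>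
    (\<exists>S\<in>subspaces l (Suc 0) h. card R * ((\<Sum>x\<in>words {..<l} h. F x) / real l ^ h - \<epsilon>) \<le> (\<Sum>c\<in>R. F (fill S [c])))"
proof -
  \<comment> \<open>This makes \<open>l\<^sup>2 < h * \<epsilon>\<^sup>2\<close>: the variance of
    the letter count, at most \<open>h * l\<^sup>2\<close>, is below the square of the allowed error
    \<open>h * \<epsilon>\<close>.\<close>
  define h where "h = nat \<lceil>l\<^sup>2 / \<epsilon>\<^sup>2\<rceil> + 1"
  have h: "h > l\<^sup>2 / \<epsilon>\<^sup>2" "h > 0" unfolding h_def by linarith+
  have "\<exists>S\<in>subspaces l (Suc 0) h. card R * ((\<Sum>x\<in>words {..<l} h. F x) / real l ^ h - \<epsilon>) \<le> (\<Sum>c\<in>R. F (fill S [c]))"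
    if R: "R \<subseteq> {..<l}" "R \<noteq> {}" and F: "\<forall>x\<in>words {..<l} h. 0 \<le> F x \<and> F x \<le> 1" for R and F :: "nat list \<Rightarrow> real"
  proof -
    have fR: "finite R" using R finite_subset by auto
    define q where "q = card R"
    have q: "q > 0" using R fR by (simp add: q_def card_gt_0_iff)
    have ql: "q \<le> l" using card_mono[OF _ R(1)] by (simp add: q_def)
    have l: "l > 0" using q ql by simp
    \<comment> \<open>Centred and scaled so that the sum of \<open>g\<close> over a word is
      \<open>h\<close> minus the normalised number of its letters from \<open>R\<close>.\<close>
    define g :: "nat \<Rightarrow> real" where "g a = 1 - l / q * of_bool (a \<in> R)" for a
    have g0: "(\<Sum>a<l. g a) = 0"
    proof -
      have "(\<Sum>a<l. of_bool (a \<in> R)) = real q"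
        using R(1) by (simp add: of_bool_def sum.If_cases q_def Int_absorb1)
      then show ?thesis using q by (simp add: g_def sum_subtractf sum_distrib_left[symmetric] sum_divide_distrib[symmetric])
    qed
    have "\<bar>g a\<bar> \<le> l" for a
    proof -
      have "l / q \<le> l" "l / q \<ge> 1" using q ql l by (auto simp: field_simps)
      then show ?thesis using l by (auto simp: g_def of_bool_def)
    qed
    then have var: "(\<Sum>x\<in>words {..<l} h. (\<Sum>a\<leftarrow>x. g a)\<^sup>2) \<le> h * (real l)\<^sup>2 * l ^ h"
      using sum_sum_list_squared_le[of "{..<l}" g "real l" h] g0 by simp
    show ?thesis
    proof (rule ccontr)
      define b :: "nat list \<Rightarrow> nat \<Rightarrow> real" where "b x j = of_bool (x ! j \<in> R)" for x j
      define E where "E = (\<Sum>x\<in>words {..<l} h. F x)"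
      assume "\<not> (\<exists>S\<in>subspaces l (Suc 0) h. card R * ((\<Sum>x\<in>words {..<l} h. F x) / real l ^ h - \<epsilon>) \<le> (\<Sum>c\<in>R. F (fill S [c])))"
      then have less: "(\<Sum>c\<in>R. F (fill S [c])) < q * (E / real l ^ h - \<epsilon>)" if "S \<in> subspaces l (Suc 0) h" for S
        using that by (force simp: q_def E_def)
      have upd: "(\<Sum>c\<in>R. F (x[j := c])) < q * (E / real l ^ h - \<epsilon>)" if "j < h" "x \<in> words {..<l} h" for x j
      proof -
        \<comment> \<open>Lines with a single active coordinate suffice: the word \<open>x\<close>
          with a wildcard at position \<open>j\<close>.\<close>
        let ?S = "(map Inl x)[j := Inr 0]"
        have "?S \<in> subspaces l (Suc 0) h"
          using that subsetD[OF set_update_subset_insert[of "map Inl x" j "Inr 0"]]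
          by (fastforce simp: subspaces_def words_def set_update_memI lessThan_Suc)
        moreover have "fill ?S [c] = x[j := c]" for c
          by (simp add: fill_def map_update comp_def)
        ultimately show ?thesis using less[of ?S] by simp
      qed
      have j: "(\<Sum>x\<in>words {..<l} h. b x j * F x) * l < q * (E / real l ^ h - \<epsilon>) * l ^ h" if "j < h" for j
      proof -
        have "(\<Sum>x\<in>words {..<l} h. \<Sum>c\<in>R. F (x[j := c])) < (\<Sum>x\<in>words {..<l} h. q * (E / real l ^ h - \<epsilon>))"
        proof (intro sum_strict_mono)
          have "replicate h 0 \<in> words {..<l} h" using l by (auto simp: words_def)
          then show "words {..<l} h \<noteq> {}" by blast
        qed (use upd[OF that] in auto)
        then show ?thesis
          using sum_words_update[OF _ R(1) that, of F] by (simp add: b_def[symmetric] algebra_simps)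
      qed
      have "(\<Sum>x\<in>words {..<l} h. F x * (\<Sum>j<h. b x j)) * l
          = (\<Sum>j<h. (\<Sum>x\<in>words {..<l} h. b x j * F x) * l)"
        unfolding sum_distrib_left sum_distrib_right by (subst sum.swap) (simp add: mult_ac)
      also have "\<dots> < (\<Sum>j<h. q * (E / real l ^ h - \<epsilon>) * l ^ h)"
        using j h(2) by (intro sum_strict_mono) auto
      also have "\<dots> = q * (h * (E - \<epsilon> * l ^ h))"
        using l by (simp add: field_simps)
      finally have 1: "(\<Sum>x\<in>words {..<l} h. F x * (\<Sum>j<h. b x j)) * l / q < h * (E - \<epsilon> * l ^ h)"
        using q by (simp add: field_simps)
      have g_sum: "(\<Sum>a\<leftarrow>x. g a) = h - l / q * (\<Sum>j<h. b x j)" if "x \<in> words {..<l} h" for x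
      proof -
        have "(\<Sum>a\<leftarrow>x. g a) = (\<Sum>j<h. g (x ! j))"
          using that by (simp add: words_def sum_list_sum_nth atLeast0LessThan)
        then show ?thesis by (simp add: g_def b_def[symmetric] sum_subtractf sum_distrib_left)
      qed
      have "(\<Sum>x\<in>words {..<l} h. F x * (\<Sum>a\<leftarrow>x. g a)) = 
         h * E - l / q * (\<Sum>x\<in>words {..<l} h. F x * (\<Sum>j<h. b x j))"
        by (simp add: g_sum E_def algebra_simps sum_subtractf sum_distrib_left sum_divide_distrib)
      then have "h * \<epsilon> * l ^ h < (\<Sum>x\<in>words {..<l} h. F x * (\<Sum>a\<leftarrow>x. g a))"
        using 1 by (simp add: algebra_simps)
      also have "\<dots> \<le> (\<Sum>x\<in>words {..<l} h. (\<Sum>a\<leftarrow>x. g a)\<^sup>2 / (2 * \<epsilon> * h) + \<epsilon> * h / 2)"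
      proof (intro sum_mono)
        fix x assume "x \<in> words {..<l} h"
        define s where "s = (\<Sum>a\<leftarrow>x. g a)"
        have "F x * s \<le> F x * \<bar>s\<bar>" using F \<open>x \<in> _\<close> by (intro mult_left_mono) auto
        also have "\<dots> \<le> 1 * \<bar>s\<bar>" using F \<open>x \<in> _\<close> by (intro mult_right_mono) auto
        also have "\<dots> = \<bar>s\<bar>" by simp
        \<comment> \<open>The weights of this arithmetic-geometric inequality make both terms
          contribute half of the error in the mean.\<close>
        also have "\<bar>s\<bar> \<le> s\<^sup>2 / (2 * \<epsilon> * h) + \<epsilon> * h / 2"
        proof -
          have "0 \<le> (\<bar>s\<bar> - \<epsilon> * h)\<^sup>2" by simp
          then have "2 * \<epsilon> * h * \<bar>s\<bar> \<le> s\<^sup>2 + (\<epsilon> * h)\<^sup>2" by (simp add: power2_diff algebra_simps)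
          then show ?thesis using assms(1) h(2) by (simp add: field_simps power2_eq_square)
        qed
        finally show "F x * (\<Sum>a\<leftarrow>x. g a) \<le> (\<Sum>a\<leftarrow>x. g a)\<^sup>2 / (2 * \<epsilon> * h) + \<epsilon> * h / 2"
          by (simp add: s_def)
      qed
      also have "\<dots> = (\<Sum>x\<in>words {..<l} h. (\<Sum>a\<leftarrow>x. g a)\<^sup>2) / (2 * \<epsilon> * h) + \<epsilon> * h / 2 * l ^ h"
        by (simp add: sum.distrib sum_divide_distrib)
      also have "\<dots> \<le> h * (real l)\<^sup>2 * l ^ h / (2 * \<epsilon> * h) + \<epsilon> * h / 2 * l ^ h"
        using var assms(1) h(2) by (intro add_right_mono divide_right_mono) auto
      also have "\<dots> = ((real l)\<^sup>2 / (2 * \<epsilon>) + \<epsilon> * h / 2) * l ^ h"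
        using h(2) by (simp add: algebra_simps)
      finally have "h * \<epsilon> < (real l)\<^sup>2 / (2 * \<epsilon>) + \<epsilon> * h / 2" using l by simp
      moreover have "(real l)\<^sup>2 < h * \<epsilon>\<^sup>2" using h(1) assms(1) by (simp add: field_simps)
      ultimately have "h * \<epsilon> < h * \<epsilon>\<^sup>2 / (2 * \<epsilon>) + \<epsilon> * h / 2"
        using assms(1) divide_strict_right_mono[of "(real l)\<^sup>2" "h * \<epsilon>\<^sup>2" "2 * \<epsilon>"] by linarith
      also have "h * \<epsilon>\<^sup>2 / (2 * \<epsilon>) = h * \<epsilon> / 2"
        using assms(1) by (simp add: power2_eq_square)
      finally show False by (simp add: mult.commute)
    qed
  qed
  then show ?thesis by (intro exI[of _ h] allI impI)
qed

text \<open>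
  Inserting \<open>M\<close> prescribed letters at few random positions hardly changes the distribution of a
  uniformly random word.
\<close>

lemma insertion:
  assumes "0 < \<epsilon>"
  shows "\<exists>m. \<forall>R F. R \<subseteq> {..<l} \<longrightarrow> R \<noteq> {} \<longrightarrow> (\<forall>x\<in>words {..<l} m. 0 \<le> F x \<and> F x \<le> 1) \<longrightarrow>
    (\<exists>S\<in>subspaces l M m. real (card R) ^ M * ((\<Sum>x\<in>words {..<l} m. F x) / real l ^ m - \<epsilon>) \<le> (\<Sum>c\<in>words R M. F (fill S c)))"
  using assms
proof (induction M arbitrary: \<epsilon>)
  case 0
  have "[] \<in> subspaces l 0 0" by (simp add: subspaces_def)
  then show ?case using 0 by (intro exI[of _ 0]) (auto simp: fill_def intro!: bexI[of _ "[]"])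
next
  case (Suc M)
  obtain m where m: "\<And>R F. R \<subseteq> {..<l} \<Longrightarrow> R \<noteq> {} \<Longrightarrow> \<forall>x\<in>words {..<l} m. 0 \<le> F x \<and> F x \<le> 1 \<Longrightarrow>
    \<exists>S\<in>subspaces l M m. real (card R) ^ M * ((\<Sum>x\<in>words {..<l} m. F x) / real l ^ m - \<epsilon> / 2) \<le> (\<Sum>c\<in>words R M. F (fill S c))"
    using Suc.IH[of "\<epsilon> / 2"] Suc.prems by (metis half_gt_zero)
  obtain h where h: "\<And>R F. R \<subseteq> {..<l} \<Longrightarrow> R \<noteq> {} \<Longrightarrow> \<forall>x\<in>words {..<l} h. 0 \<le> F x \<and> F x \<le> 1 \<Longrightarrow>
    \<exists>S\<in>subspaces l (Suc 0) h. real (card R) * ((\<Sum>x\<in>words {..<l} h. F x) / real l ^ h - \<epsilon> / 2) \<le> (\<Sum>c\<in>R. F (fill S [c]))"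
    using insertion_one[of "\<epsilon> / 2", of l] Suc.prems by (metis half_gt_zero)
  show ?case
  proof (intro exI[of _ "m + h"] allI impI)
    fix R and F :: "nat list \<Rightarrow> real"
    assume R: "R \<subseteq> {..<l}" "R \<noteq> {}"
    have fR: "finite R" using R finite_subset by auto
    define q where "q = card R"
    have q: "q > 0" using R fR by (simp add: q_def card_gt_0_iff)
    have l: "l > 0" using R by (cases l) auto
    assume F: "\<forall>x\<in>words {..<l} (m + h). 0 \<le> F x \<and> F x \<le> 1"
    have F': "0 \<le> F (u @ v)" "F (u @ v) \<le> 1" if "u \<in> words {..<l} m" "v \<in> words {..<l} h" for u v
      using F that by (auto simp: words_def)
    \<comment> \<open>Averaging out one block reduces to the other. \<open>F1\<close> has the same
      mean as \<open>F\<close> and yields \<open>S\<close>; \<open>F2\<close> then averages over the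
      fillings of \<open>S\<close> and yields the last wildcard. Each costs
      \<open>\<epsilon> / 2\<close>.\<close>
    define F1 where "F1 u = (\<Sum>v\<in>words {..<l} h. F (u @ v)) / real l ^ h" for u
    have "\<forall>x\<in>words {..<l} m. 0 \<le> F1 x \<and> F1 x \<le> 1"
    proof
      fix u assume u: "u \<in> words {..<l} m"
      have "(\<Sum>v\<in>words {..<l} h. F (u @ v)) \<le> (\<Sum>v\<in>words {..<l} h. 1)"
        using F' u by (intro sum_mono) auto
      then show "0 \<le> F1 u \<and> F1 u \<le> 1"
        using F' u l unfolding F1_def by (auto intro!: divide_nonneg_nonneg sum_nonneg simp: divide_le_eq)
    qed
    from m[OF R this, folded q_def] obtain S where S: "S \<in> subspaces l M m"
      "real q ^ M * ((\<Sum>x\<in>words {..<l} m. F1 x) / real l ^ m - \<epsilon> / 2) \<le> (\<Sum>c\<in>words R M. F1 (fill S c))"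
      by blast
    define F2 where "F2 v = (\<Sum>c\<in>words R M. F (fill S c @ v)) / real q ^ M" for v
    have Sc: "fill S c \<in> words {..<l} m" if "c \<in> words R M" for c
      using fill_in_words[OF S(1), of c "{..<l}"] that R(1) by (auto simp: words_def)
    have "\<forall>x\<in>words {..<l} h. 0 \<le> F2 x \<and> F2 x \<le> 1"
    proof
      fix v assume v: "v \<in> words {..<l} h"
      have "(\<Sum>c\<in>words R M. F (fill S c @ v)) \<le> (\<Sum>c\<in>words R M. 1)"
        using F' v Sc by (intro sum_mono) auto
      then show "0 \<le> F2 v \<and> F2 v \<le> 1"
        using F' v Sc q fR unfolding F2_def
        by (auto intro!: divide_nonneg_nonneg sum_nonneg simp: divide_le_eq q_def)
    qed
    from h[OF R this, folded q_def] obtain T where T: "T \<in> subspaces l (Suc 0) h"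
      "q * ((\<Sum>x\<in>words {..<l} h. F2 x) / real l ^ h - \<epsilon> / 2) \<le> (\<Sum>c\<in>R. F2 (fill T [c]))"
      by blast
    define U where "U = S @ map (map_sum id (\<lambda>_. M)) T"
    have U: "U \<in> subspaces l (Suc M) (m + h)"
      unfolding U_def by (rule subspace_product[OF S(1) T(1)])
    have "(\<Sum>c\<in>words R (Suc M). F (fill U c)) = (\<Sum>c\<in>words R M. \<Sum>a\<in>R. F (fill U (c @ [a])))"
      using sum_words_append[of "\<lambda>c. F (fill U c)" R M "Suc 0"] by (simp add: sum_words_1)
    also have "\<dots> = (\<Sum>c\<in>words R M. \<Sum>a\<in>R. F (fill S c @ fill T [a]))"
      unfolding U_def by (intro sum.cong refl arg_cong[of _ _ F] subspace_product(2)[OF S(1) T(1)]) (auto simp: words_def)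
    also have "\<dots> = real q ^ M * (\<Sum>a\<in>R. F2 (fill T [a]))"
      using q by (subst sum.swap) (simp add: F2_def sum_divide_distrib[symmetric])
    finally have eq: "(\<Sum>c\<in>words R (Suc M). F (fill U c)) = real q ^ M * (\<Sum>a\<in>R. F2 (fill T [a]))" .
    define e where "e = (\<Sum>x\<in>words {..<l} (m + h). F x) / real l ^ (m + h)"
    have e1: "(\<Sum>x\<in>words {..<l} m. F1 x) / real l ^ m = e"
      using l by (simp add: e_def F1_def sum_words_append sum_divide_distrib power_add mult_ac)
    have "(\<Sum>x\<in>words {..<l} h. F2 x) / real l ^ h = (\<Sum>c\<in>words R M. F1 (fill S c)) / real q ^ M"
      unfolding F1_def F2_def by (simp add: sum_divide_distrib[symmetric] mult_ac) (simp add: sum.swap[of _ "words {..<l} h"])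
    also have "\<dots> \<ge> e - \<epsilon> / 2" using S(2) q unfolding e1 by (simp add: field_simps)
    finally have "q * (e - \<epsilon>) \<le> q * ((\<Sum>x\<in>words {..<l} h. F2 x) / real l ^ h - \<epsilon> / 2)"
      by (intro mult_left_mono) auto
    also note T(2)
    finally have "real q ^ M * (q * (e - \<epsilon>)) \<le> (\<Sum>c\<in>words R (Suc M). F (fill U c))"
      unfolding eq by (intro mult_left_mono) auto
    then show "\<exists>S\<in>subspaces l (Suc M) (m + h). real (card R) ^ Suc M * ((\<Sum>x\<in>words {..<l} (m + h). F x) / real l ^ (m + h) - \<epsilon>)
        \<le> (\<Sum>c\<in>words R (Suc M). F (fill S c))"
      using U by (auto intro!: bexI[of _ U] simp: e_def q_def mult_ac)
  qed
qed

section \<open>The density Hales--Jewett theorem\<close>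

text \<open>One good length for each density is enough. The passage to all larger lengths is done by
  slicing, in \<open>critical_density\<close>.\<close>

definition density_HJ :: "nat \<Rightarrow> bool" where
  "density_HJ k \<longleftrightarrow> (\<forall>\<delta>>0. \<exists>n. \<forall>A\<subseteq>words {..<k} n. \<delta> * real k ^ n \<le> real (card A) \<longrightarrow>
     (\<exists>S\<in>subspaces k (Suc 0) n. \<forall>i<k. fill S [i] \<in> A))"

text \<open>A reverse Markov inequality: points below the threshold contribute at most
  \<open>b\<close> to the mean, the others at most 1 each.\<close>

lemma card_ge_threshold:
  fixes f :: "'a \<Rightarrow> real" and b c :: real
  assumes "finite X" "\<And>x. x \<in> X \<Longrightarrow> f x \<le> 1" "0 \<le> b" "(b + c) * card X \<le> (\<Sum>x\<in>X. f x)"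
  shows "c * card X \<le> card {x \<in> X. b \<le> f x}"
proof -
  have "(\<Sum>x\<in>X. f x) \<le> (\<Sum>x\<in>X. of_bool (b \<le> f x) + b)"
  proof (intro sum_mono)
    show "f x \<le> of_bool (b \<le> f x) + b" if "x \<in> X" for x
      using assms(2)[OF that] assms(3) by (auto simp: of_bool_def)
  qed
  also have "\<dots> = card {x \<in> X. b \<le> f x} + b * card X"
    using assms(1) by (simp add: sum.distrib Int_def)
  finally show ?thesis using assms(4) by (simp add: algebra_simps)
qed

lemma popular_value:
  assumes "finite X" "finite Y" "\<And>x. x \<in> X \<Longrightarrow> \<exists>y\<in>Y. P x y" "X \<noteq> {}"
  shows "\<exists>y\<in>Y. card X \<le> card Y * card {x \<in> X. P x y}"
proof (rule ccontr)
  assume *: "\<not> ?thesis"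
  have "Y \<noteq> {}" using assms by auto
  have "card X \<le> card (\<Union>y\<in>Y. {x \<in> X. P x y})"
    using assms by (intro card_mono) auto
  also have "\<dots> \<le> (\<Sum>y\<in>Y. card {x \<in> X. P x y})"
    by (rule card_UN_le[OF assms(2)])
  finally have "card Y * card X \<le> (\<Sum>y\<in>Y. card Y * card {x \<in> X. P x y})"
    by (simp add: sum_distrib_left[symmetric])
  also have "\<dots> < (\<Sum>y\<in>Y. card X)"
    using * \<open>Y \<noteq> {}\<close> by (intro sum_strict_mono assms) (auto simp: not_le)
  finally show False by simp
qed

lemma card_words_eq_sum:
  assumes "finite R"
  shows "real (card {w \<in> words R n. P w}) = (\<Sum>w\<in>words R n. of_bool (P w))"
  using assms by (simp add: Int_def)

lemma card_words_append:
  assumes "finite R"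
  shows "real (card {w \<in> words R (m + n). P w}) = (\<Sum>v\<in>words R n. card {u \<in> words R m. P (u @ v)})"
  using assms by (simp only: card_words_eq_sum sum_words_append of_nat_sum) (rule sum.swap)

text \<open>The last wildcard comes from a second block. For many suffixes the fibre is dense and
  contains an \<open>m\<close>-dimensional subspace; as there are finitely many subspaces, a single
  \<open>S\<close> serves a dense set of suffixes, and a line in that set completes
  \<open>S\<close>.\<close>

theorem density_HJ_multidim:
  assumes "density_HJ k" "0 < k" "0 < \<delta>"
  shows "\<exists>n. \<forall>A\<subseteq>words {..<k} n. \<delta> * real k ^ n \<le> real (card A) \<longrightarrow>
     (\<exists>S\<in>subspaces k m n. \<forall>y\<in>words {..<k} m. fill S y \<in> A)"
  using assms(3)
proof (induction m arbitrary: \<delta>)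
  case 0
  have "fill [] [] \<in> A" if "A \<subseteq> words {..<k} 0" "\<delta> \<le> card A" for A
    using that 0 by (cases "A = {}") (auto simp: fill_def)
  moreover have "[] \<in> subspaces k 0 0" by (simp add: subspaces_def)
  ultimately show ?case by (intro exI[of _ 0]) auto
next
  case (Suc m)
  obtain n1 where n1: "\<And>A. A \<subseteq> words {..<k} n1 \<Longrightarrow> \<delta> / 2 * real k ^ n1 \<le> real (card A) \<Longrightarrow>
     \<exists>S\<in>subspaces k m n1. \<forall>y\<in>words {..<k} m. fill S y \<in> A"
    using Suc.IH[of "\<delta> / 2"] Suc.prems by auto
  define T where "T = Suc (card (subspaces k m n1))"
  have "\<delta> / (2 * T) > 0" using Suc.prems by (simp add: T_def)
  then obtain n2 where n2: "\<And>A. A \<subseteq> words {..<k} n2 \<Longrightarrow> \<delta> / (2 * T) * real k ^ n2 \<le> real (card A) \<Longrightarrow>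
     \<exists>S\<in>subspaces k (Suc 0) n2. \<forall>i<k. fill S [i] \<in> A"
    using assms(1) unfolding density_HJ_def by metis
  have "\<exists>S\<in>subspaces k (Suc m) (n1 + n2). \<forall>y\<in>words {..<k} (Suc m). fill S y \<in> A"
    if A: "A \<subseteq> words {..<k} (n1 + n2)" "\<delta> * real k ^ (n1 + n2) \<le> real (card A)" for A
  proof -
    define f where "f x = card {u \<in> words {..<k} n1. u @ x \<in> A} / real k ^ n1" for x
    define X where "X = {x \<in> words {..<k} n2. \<delta> / 2 \<le> f x}"
    have "card {u \<in> words {..<k} n1. u @ x \<in> A} \<le> k ^ n1" for x
      using card_mono[of "words {..<k} n1" "{u \<in> words {..<k} n1. u @ x \<in> A}"] by auto
    then have f1: "f x \<le> 1" for x
      using assms(2) by (simp add: f_def divide_le_eq flip: of_nat_power)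
    have "real (card A) = card {w \<in> words {..<k} (n1 + n2). w \<in> A}"
      using A by (auto intro!: arg_cong[of _ _ card])
    also have "\<dots> = real k ^ n1 * (\<Sum>x\<in>words {..<k} n2. f x)"
      using assms(2) by (simp add: card_words_append f_def sum_divide_distrib[symmetric])
    finally have "(\<delta> / 2 + \<delta> / 2) * card (words {..<k} n2) \<le> (\<Sum>x\<in>words {..<k} n2. f x)"
      using A(2) assms(2) by (simp add: power_add)
    then have X: "\<delta> / 2 * real k ^ n2 \<le> card X"
      using card_ge_threshold[of "words {..<k} n2" f "\<delta> / 2" "\<delta> / 2"] f1 Suc.prems by (simp add: X_def)
    then have "X \<noteq> {}"
      using Suc.prems assms(2) by (metis card.empty divide_pos_pos less_le_not_le mult_pos_pos of_nat_0 of_nat_0_less_iff zero_less_numeral zero_less_power)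
    have "\<exists>S\<in>subspaces k m n1. \<forall>y\<in>words {..<k} m. fill S y @ x \<in> A" if "x \<in> X" for x
      using n1[of "{u \<in> words {..<k} n1. u @ x \<in> A}"] that assms(2) by (auto simp: X_def f_def field_simps)
    moreover have "finite X" by (simp add: X_def)
    ultimately obtain S where S: "S \<in> subspaces k m n1"
      "card X \<le> card (subspaces k m n1) * card {x \<in> X. \<forall>y\<in>words {..<k} m. fill S y @ x \<in> A}"
      using popular_value[of X "subspaces k m n1" "\<lambda>x S. \<forall>y\<in>words {..<k} m. fill S y @ x \<in> A"] \<open>X \<noteq> {}\<close>
      by auto
    define Z where "Z = {x \<in> X. \<forall>y\<in>words {..<k} m. fill S y @ x \<in> A}"
    have "card X \<le> T * card Z" using S(2) by (simp add: T_def Z_def)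
    then have "real (card X) \<le> T * card Z" by (metis of_nat_le_iff of_nat_mult)
    then have "\<delta> / (2 * T) * real k ^ n2 \<le> card Z"
      using X by (simp add: field_simps T_def)
    then obtain L where L: "L \<in> subspaces k (Suc 0) n2" "\<forall>i<k. fill L [i] \<in> Z"
      using n2[of Z] by (auto simp: Z_def X_def)
    have "fill (S @ map (map_sum id (\<lambda>_. m)) L) y \<in> A" if y: "y \<in> words {..<k} (Suc m)" for y
    proof -
      obtain c a where ca: "y = c @ [a]" "length c = m"
        using y by (cases y rule: rev_cases) (auto simp: words_def)
      then have "c \<in> words {..<k} m" "a < k" using y by (auto simp: words_def)
      then show ?thesis
        using subspace_product(2)[OF S(1) L(1) ca(2)] L(2) by (auto simp: ca Z_def)
    qed
    then show ?thesis using subspace_product(1)[OF S(1) L(1)] by blast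
  qed
  then show ?case by (intro exI[of _ "n1 + n2"]) auto
qed

section \<open>Insensitive sets\<close>

text \<open>Membership does not distinguish the letters \<open>i\<close> and \<open>k\<close>: it is
  enough to compare a word with the representative that avoids \<open>k\<close>.\<close>

definition insensitive :: "nat \<Rightarrow> nat \<Rightarrow> nat \<Rightarrow> nat list set \<Rightarrow> bool" where
  "insensitive k i n D \<longleftrightarrow> (\<forall>w\<in>words {..<Suc k} n. w \<in> D \<longleftrightarrow> replace k i w \<in> D)"

lemma replace_in_words_Suc: "w \<in> words {..<Suc k} n \<Longrightarrow> i < k \<Longrightarrow> replace k i w \<in> words {..<Suc k} n"
  using replace_in_words[of w k n i] by (auto simp: words_def)

lemma insensitive_slice:
  assumes "insensitive k i (m + n) D" "i < k"
  shows "v \<in> words {..<Suc k} n \<Longrightarrow> insensitive k i m {u. u @ v \<in> D}"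
    and "u \<in> words {..<Suc k} m \<Longrightarrow> insensitive k i n {v. u @ v \<in> D}"
proof -
  have *: "u @ v \<in> D \<longleftrightarrow> replace k i u @ replace k i v \<in> D"
    if "u \<in> words {..<Suc k} m" "v \<in> words {..<Suc k} n" for u v
    using assms that unfolding insensitive_def by (auto simp: words_def)
  show "insensitive k i m {u. u @ v \<in> D}" if v: "v \<in> words {..<Suc k} n"
    unfolding insensitive_def using *[OF _ v] *[OF replace_in_words_Suc v] assms(2)
    by (auto simp: replace_idem)
  show "insensitive k i n {v. u @ v \<in> D}" if u: "u \<in> words {..<Suc k} m"
    unfolding insensitive_def using *[OF u] *[OF u replace_in_words_Suc] assms(2)
    by (auto simp: replace_idem)
qed

lemma insensitive_subspace:
  assumes "insensitive k i n D" "i < k" "S \<in> subspaces (Suc k) m n"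
  shows "insensitive k i m {y. fill S y \<in> D}"
  unfolding insensitive_def
proof (intro ballI, simp only: mem_Collect_eq)
  fix y assume y: "y \<in> words {..<Suc k} m"
  have "fill S y \<in> D \<longleftrightarrow> replace k i (fill S y) \<in> D"
    using assms(1) fill_in_words[OF assms(3) y] by (simp add: insensitive_def)
  also have "\<dots> \<longleftrightarrow> replace k i (fill S (replace k i y)) \<in> D"
    using replace_fill_insensitive[OF assms(3) y assms(2)] by simp
  also have "\<dots> \<longleftrightarrow> fill S (replace k i y) \<in> D"
    using assms(1) fill_in_words[OF assms(3) replace_in_words_Suc[OF y assms(2)]] by (simp add: insensitive_def)
  finally show "fill S y \<in> D \<longleftrightarrow> fill S (replace k i y) \<in> D" .
qed

text \<open>\<open>insertion\<close> with the letters below \<open>k\<close> provides a large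
  subspace \<open>V\<close> on which \<open>D\<close> is dense among the fillings over
  \<open>k\<close> letters, so the hypothesis for \<open>k\<close> applies there. Insensitivity then
  carries the subspace that is found over to \<open>k + 1\<close> letters.\<close>

lemma dense_insensitive_contains_subspace:
  assumes HJ: "density_HJ k" "0 < k" and i: "i < k" and "0 < \<delta>"
  shows "\<exists>l. \<forall>D. insensitive k i l D \<longrightarrow> \<delta> * real (Suc k) ^ l \<le> card {w \<in> words {..<Suc k} l. w \<in> D} \<longrightarrow>
    (\<exists>S\<in>subspaces k m l. \<forall>y\<in>words {..<Suc k} m. fill S y \<in> D)"
proof -
  obtain M where M: "\<And>A. A \<subseteq> words {..<k} M \<Longrightarrow> \<delta> / 2 * real k ^ M \<le> real (card A) \<Longrightarrow>
     \<exists>S\<in>subspaces k m M. \<forall>y\<in>words {..<k} m. fill S y \<in> A"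
    using density_HJ_multidim[OF HJ, of "\<delta> / 2" m] assms(4) by auto
  obtain l where l: "\<And>F. \<forall>w\<in>words {..<Suc k} l. 0 \<le> F w \<and> F w \<le> 1 \<Longrightarrow>
    \<exists>S\<in>subspaces (Suc k) M l. real k ^ M * ((\<Sum>w\<in>words {..<Suc k} l. F w) / real (Suc k) ^ l - \<delta> / 2)
      \<le> (\<Sum>c\<in>words {..<k} M. F (fill S c))"
  proof -
    obtain l where "\<forall>R F. R \<subseteq> {..<Suc k} \<longrightarrow> R \<noteq> {} \<longrightarrow> (\<forall>w\<in>words {..<Suc k} l. 0 \<le> F w \<and> F w \<le> 1) \<longrightarrow>
      (\<exists>S\<in>subspaces (Suc k) M l. real (card R) ^ M * ((\<Sum>w\<in>words {..<Suc k} l. F w) / real (Suc k) ^ l - \<delta> / 2)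
        \<le> (\<Sum>c\<in>words R M. F (fill S c)))"
      using insertion[of "\<delta> / 2" "Suc k" M] assms(4) by auto
    from this[THEN spec[of _ "{..<k}"]] show ?thesis
      using assms(2) by (intro that[of l]) auto
  qed
  show ?thesis
  proof (intro exI[of _ l] allI impI)
    fix D assume D: "insensitive k i l D" and "\<delta> * real (Suc k) ^ l \<le> card {w \<in> words {..<Suc k} l. w \<in> D}"
    then have "\<delta> \<le> (\<Sum>w\<in>words {..<Suc k} l. of_bool (w \<in> D)) / real (Suc k) ^ l"
      unfolding card_words_eq_sum[OF finite_lessThan] by (simp only: pos_le_divide_eq zero_less_power of_nat_0_less_iff zero_less_Suc)
    then have "real k ^ M * (\<delta> / 2) \<le> real k ^ M * ((\<Sum>w\<in>words {..<Suc k} l. of_bool (w \<in> D)) / real (Suc k) ^ l - \<delta> / 2)"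
      by (intro mult_left_mono) (linarith, simp)
    moreover obtain V where V: "V \<in> subspaces (Suc k) M l"
      "real k ^ M * ((\<Sum>w\<in>words {..<Suc k} l. of_bool (w \<in> D)) / real (Suc k) ^ l - \<delta> / 2)
      \<le> (\<Sum>c\<in>words {..<k} M. of_bool (fill V c \<in> D))"
      using l[of "\<lambda>w. of_bool (w \<in> D)"] by auto
    ultimately have "\<delta> / 2 * real k ^ M \<le> card {c \<in> words {..<k} M. fill V c \<in> D}"
      unfolding card_words_eq_sum[OF finite_lessThan] by (simp only: mult.commute)
    then obtain W where W: "W \<in> subspaces k m M" "\<And>y. y \<in> words {..<k} m \<Longrightarrow> fill V (fill W y) \<in> D"
      using M[of "{c \<in> words {..<k} M. fill V c \<in> D}"] by auto
    \<comment> \<open>\<open>V\<close> may have \<open>k\<close> as a fixed letter. Turning it into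
      \<open>i\<close> stays within \<open>D\<close> by insensitivity and makes replacement commute
      with filling.\<close>
    define V' where "V' = map (map_sum (\<lambda>a. if a = k then i else a) id) V"
    have V': "V' \<in> subspaces k M l"
    proof -
      have "map_sum (\<lambda>a. if a = k then i else a) id c \<in> Inl ` {..<k} \<union> Inr ` {..<M}" if "c \<in> set V" for c
        using V(1) that by (cases rule: subspaces_entryE) (use i in auto)
      moreover have "Inr j \<in> set V'" if "j < M" for j
      proof -
        have "Inr j \<in> set V" using V(1) that by (auto simp: subspaces_def)
        then show ?thesis unfolding V'_def by force
      qed
      ultimately show ?thesis using V(1) by (auto simp: subspaces_def V'_def)
    qed
    have fV': "fill V' c = replace k i (fill V c)" if c: "c \<in> words {..<k} M" for c
    proof -
      have "case_sum id ((!) c) (map_sum (\<lambda>a. if a = k then i else a) id e) =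
         (\<lambda>a. if a = k then i else a) (case_sum id ((!) c) e)" if "e \<in> set V" for e
        using V(1) that
      proof (cases rule: subspaces_entryE)
        case (2 j)
        then have "c ! j < k" using words_nth[OF c] by auto
        then show ?thesis using 2 by simp
      qed auto
      then show ?thesis by (simp add: fill_def V'_def replace_def)
    qed
    have S: "subspace_comp V' W \<in> subspaces k m l" by (rule subspace_comp_in[OF V' W(1)])
    have "fill (subspace_comp V' W) y \<in> D" if y: "y \<in> words {..<Suc k} m" for y
    proof -
      let ?y = "replace k i y"
      have y': "?y \<in> words {..<k} m" using replace_in_words[OF y i] .
      have Wy: "fill W ?y \<in> words {..<k} M" using fill_in_words[OF W(1) y'] by simp
      then have "fill V (fill W ?y) \<in> words {..<Suc k} l"
        using fill_in_words[OF V(1), of "fill W ?y" "{..<Suc k}"] words_mono[of "{..<k}" "{..<Suc k}" M] by auto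
      then have "replace k i (fill V (fill W ?y)) \<in> D"
        using D W(2)[OF y'] by (simp add: insensitive_def)
      then have "replace k i (fill (subspace_comp V' W) y) \<in> D"
        using fV'[OF Wy] replace_fill[OF S, of y i] y fill_subspace_comp[OF V' W(1), of ?y] by (simp add: words_def)
      then show ?thesis
        using D fill_in_words[OF S y] by (auto simp: insensitive_def)
    qed
    then show "\<exists>S\<in>subspaces k m l. \<forall>y\<in>words {..<Suc k} m. fill S y \<in> D" using S by blast
  qed
qed

text \<open>A bound for the mean of \<open>f\<close> on every \<open>m\<close>-dimensional subspace.
  A weight \<open>f\<close> in place of a set lets indicators of further insensitive sets be
  absorbed into it.\<close>

definition subspace_sums_le :: "nat \<Rightarrow> nat \<Rightarrow> nat \<Rightarrow> (nat list \<Rightarrow> real) \<Rightarrow> real \<Rightarrow> bool" where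
  "subspace_sums_le k m n f b \<longleftrightarrow> (\<forall>S\<in>subspaces k m n. (\<Sum>y\<in>words {..<k} m. f (fill S y)) \<le> b * real k ^ m)"

text \<open>Each round uses up \<open>l\<close> letters and cuts a product of one subspace with a
  set of suffixes out of \<open>D\<close>. On the removed part the mean of \<open>f\<close> is at
  most \<open>b\<close>; the rest shrinks by the factor \<open>1 - c\<close>. The fibres of the rest
  are again insensitive, so the next round works inside each of them. The errors \<open>e\<close> do
  not add up over the rounds, since those of the fibres are averaged.\<close>

lemma insensitive_sum_le_iterate:
  assumes HJ: "density_HJ k" "0 < k" and i: "i < k" and e: "0 < e" "e \<le> 1"
  shows "\<exists>l. \<exists>c>0. c \<le> 1 \<and> (\<forall>j D f b. insensitive k i (j * l + m) D \<longrightarrow>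
     (\<forall>w\<in>words {..<Suc k} (j * l + m). f w \<le> 1) \<longrightarrow> 0 \<le> b \<longrightarrow>
     subspace_sums_le (Suc k) m (j * l + m) f b \<longrightarrow>
     (\<Sum>w\<in>words {..<Suc k} (j * l + m). of_bool (w \<in> D) * f w) \<le>
       (b + (1 - c) ^ j) * (\<Sum>w\<in>words {..<Suc k} (j * l + m). of_bool (w \<in> D)) + e * real (Suc k) ^ (j * l + m))"
proof -
  obtain l where l: "\<And>D. insensitive k i l D \<Longrightarrow> e / 2 * real (Suc k) ^ l \<le> card {w \<in> words {..<Suc k} l. w \<in> D} \<Longrightarrow>
    \<exists>S\<in>subspaces k m l. \<forall>y\<in>words {..<Suc k} m. fill S y \<in> D"
    using dense_insensitive_contains_subspace[OF HJ i, of "e / 2" m] e by auto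
  define K where "K = real (Suc k)"
  have K: "K \<ge> 1" by (simp add: K_def)
  define W where "W n = words {..<Suc k} n" for n
  have fW [simp]: "finite (W n)" for n by (simp add: W_def)
  have cW: "real (card (W n)) = K ^ n" for n by (simp add: W_def K_def)
  define T where "T = real (Suc (card (subspaces k m l)))"
  have T: "T \<ge> 1" by (simp add: T_def)
  \<comment> \<open>At least a proportion \<open>e / 2\<close> of the suffixes have a dense fibre, a
    share \<open>1 / T\<close> of them has a common subspace, and \<open>D\<close> has at most
    \<open>K ^ (l + n)\<close> elements.\<close>
  define c where "c = e / (2 * T * K ^ l)"
  have TK: "1 \<le> T * K ^ l" using T K by (metis mult_mono one_le_power mult_1 zero_le_one order_trans)
  have c: "0 < c" "c \<le> 1" using e T K TK by (auto simp: c_def divide_le_eq)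
  have "(\<Sum>w\<in>W (j * l + m). of_bool (w \<in> D) * f w) \<le>
       (b + (1 - c) ^ j) * (\<Sum>w\<in>W (j * l + m). of_bool (w \<in> D)) + e * K ^ (j * l + m)"
    if "insensitive k i (j * l + m) D" "\<And>w. w \<in> W (j * l + m) \<Longrightarrow> f w \<le> 1" "0 \<le> b"
      "\<And>S. S \<in> subspaces (Suc k) m (j * l + m) \<Longrightarrow> (\<Sum>y\<in>W m. f (fill S y)) \<le> b * K ^ m" for j D f b
    using that
  proof (induction j arbitrary: D f)
    case 0
    have "(\<Sum>w\<in>W m. of_bool (w \<in> D) * f w) \<le> (\<Sum>w\<in>W m. of_bool (w \<in> D))"
      using 0 by (intro sum_mono) (auto simp: of_bool_def)
    also have "\<dots> \<le> (b + 1) * (\<Sum>w\<in>W m. of_bool (w \<in> D))"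
      using \<open>0 \<le> b\<close> by (intro mult_right_mono[of 1 "b + 1", simplified]) (auto intro: sum_nonneg)
    finally show ?case using e K by (simp add: add_increasing2)
  next
    case (Suc j)
    define n where "n = j * l + m"
    have N: "Suc j * l + m = l + n" by (simp add: n_def)
    note prems = Suc.prems[unfolded N]
    define d where "d = (\<Sum>w\<in>W (l + n). of_bool (w \<in> D) :: real)"
    have d0: "0 \<le> d" unfolding d_def by (intro sum_nonneg) auto
    have p0: "0 \<le> (1 - c) ^ n'" for n' using c by simp
    have d1: "d \<le> K ^ (l + n)"
      using sum_mono[of "W (l + n)" "\<lambda>w. of_bool (w \<in> D)" "\<lambda>_. 1 :: real"] by (simp add: d_def cW)
    \<comment> \<open>A set \<open>D\<close> that is already small is covered by the error term.
      Otherwise there is something to cut out.\<close>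
    show ?case
    proof (cases "d \<le> e * K ^ (l + n)")
      case True
      have "(\<Sum>w\<in>W (l + n). of_bool (w \<in> D) * f w) \<le> d"
        unfolding d_def using prems(2) by (intro sum_mono) (auto simp: of_bool_def)
      also have "\<dots> \<le> (b + (1 - c) ^ Suc j) * d + e * K ^ (l + n)"
        using True d0 \<open>0 \<le> b\<close> p0[of "Suc j"] by (simp add: add_increasing)
      finally show ?thesis unfolding N d_def .
    next
      case False
      define F where "F x = card {u \<in> W l. u @ x \<in> D} / K ^ l" for x
      define X where "X = {x \<in> W n. e / 2 \<le> F x}"
      have "real (card {u \<in> W l. u @ x \<in> D}) \<le> K ^ l" for x
        using card_mono[of "W l" "{u \<in> W l. u @ x \<in> D}"] cW[of l] by auto
      then have F1: "F x \<le> 1" for x using K by (simp add: F_def)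
      have "d = card {w \<in> W (l + n). w \<in> D}" by (simp add: d_def Int_def)
      also have "\<dots> = (\<Sum>x\<in>W n. K ^ l * F x)"
        using K unfolding W_def by (subst card_words_append) (auto simp: F_def W_def)
      finally have "d = K ^ l * (\<Sum>x\<in>W n. F x)"
        by (simp only: sum_distrib_left)
      moreover have "e * K ^ (l + n) = K ^ l * (e * K ^ n)" by (simp add: power_add)
      ultimately have "K ^ l * (e * K ^ n) \<le> K ^ l * (\<Sum>x\<in>W n. F x)"
        using False by linarith
      then have "(e / 2 + e / 2) * card (W n) \<le> (\<Sum>x\<in>W n. F x)"
        using K by (simp add: cW)
      then have X: "e / 2 * K ^ n \<le> card X"
        using card_ge_threshold[of "W n" F "e / 2" "e / 2"] F1 e by (simp add: X_def cW)
      then have "0 < real (card X)" using e K by (smt (verit) divide_pos_pos mult_pos_pos zero_less_power)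
      then have "X \<noteq> {}" by auto
      have "\<exists>S\<in>subspaces k m l. \<forall>y\<in>W m. fill S y @ x \<in> D" if "x \<in> X" for x
      proof -
        have "insensitive k i l {u. u @ x \<in> D}"
          using insensitive_slice(1)[OF prems(1) i] that by (simp add: X_def W_def)
        moreover have "e / 2 * real (Suc k) ^ l \<le> card {w \<in> words {..<Suc k} l. w \<in> {u. u @ x \<in> D}}"
          using that K by (simp add: X_def F_def W_def K_def field_simps)
        ultimately show ?thesis using l[of "{u. u @ x \<in> D}"] by (auto simp: W_def)
      qed
      moreover have "finite X" by (simp add: X_def)
      ultimately obtain S where S: "S \<in> subspaces k m l"
        "card X \<le> card (subspaces k m l) * card {x \<in> X. \<forall>y\<in>W m. fill S y @ x \<in> D}"
        using popular_value[of X "subspaces k m l" "\<lambda>x S. \<forall>y\<in>W m. fill S y @ x \<in> D"] \<open>X \<noteq> {}\<close> by auto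
      define Z where "Z = {x \<in> W n. \<forall>y\<in>W m. fill S y @ x \<in> D}"
      define B where "B = fill S ` W m"
      have S': "S \<in> subspaces (Suc k) m l" using S(1) subspaces_mono[of k "Suc k"] by auto
      have B: "B \<subseteq> W l" "finite B"
        using fill_in_words[OF S'] by (auto simp: B_def W_def)
      have "card {x \<in> X. \<forall>y\<in>W m. fill S y @ x \<in> D} \<le> card Z"
        by (intro card_mono) (auto simp: Z_def X_def)
      then have "card (subspaces k m l) * card {x \<in> X. \<forall>y\<in>W m. fill S y @ x \<in> D} \<le> Suc (card (subspaces k m l)) * card Z"
        by (intro mult_mono) auto
      then have "real (card X) \<le> T * card Z"
        unfolding T_def of_nat_mult[symmetric] of_nat_le_iff using S(2) by linarith
      then have Z: "c * d \<le> card Z"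
      proof -
        have "c * d \<le> c * K ^ (l + n)" using d1 c by (intro mult_left_mono) auto
        also have "\<dots> = (e / 2 * K ^ n) / T" using K T by (simp add: c_def power_add field_simps)
        also have "\<dots> \<le> card X / T" using X T by (intro divide_right_mono) auto
        also have "\<dots> \<le> card Z" using \<open>real (card X) \<le> T * card Z\<close> T by (simp add: field_simps)
        finally show ?thesis .
      qed
      \<comment> \<open>The fibre over the prefix \<open>u\<close> of what remains after removing
        \<open>B\<close> times \<open>Z\<close>. All words with prefix in \<open>B\<close> and
        suffix in \<open>Z\<close> lie in \<open>D\<close>, hence the exact splitting below.\<close>
      define D' where "D' u = {x. u @ x \<in> D \<and> \<not> (u \<in> B \<and> x \<in> Z)}" for u
      have split: "(\<Sum>w\<in>W (l + n). of_bool (w \<in> D) * g w) =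
          (\<Sum>u\<in>W l. \<Sum>x\<in>W n. of_bool (x \<in> D' u) * g (u @ x)) + (\<Sum>x\<in>Z. \<Sum>y\<in>W m. g (fill S y @ x))" for g :: "nat list \<Rightarrow> real"
      proof -
        have "(\<Sum>w\<in>W (l + n). of_bool (w \<in> D) * g w) = (\<Sum>u\<in>W l. \<Sum>x\<in>W n. of_bool (u @ x \<in> D) * g (u @ x))"
          unfolding W_def by (rule sum_words_append)
        also have "\<dots> = (\<Sum>u\<in>W l. \<Sum>x\<in>W n. of_bool (x \<in> D' u) * g (u @ x) + of_bool (u \<in> B \<and> x \<in> Z) * g (u @ x))"
          by (intro sum.cong refl) (auto simp: D'_def Z_def B_def of_bool_def)
        also have "\<dots> = (\<Sum>u\<in>W l. \<Sum>x\<in>W n. of_bool (x \<in> D' u) * g (u @ x)) +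
            (\<Sum>u\<in>W l. \<Sum>x\<in>W n. of_bool (u \<in> B \<and> x \<in> Z) * g (u @ x))"
          by (simp only: sum.distrib)
        also have "(\<Sum>u\<in>W l. \<Sum>x\<in>W n. of_bool (u \<in> B \<and> x \<in> Z) * g (u @ x)) = (\<Sum>u\<in>W l. if u \<in> B then (\<Sum>x\<in>W n. if x \<in> Z then g (u @ x) else 0) else 0)"
          by (intro sum.cong refl) (auto simp del: sum_of_bool_mult_eq sum_mult_of_bool_eq intro!: sum.cong)
        also have "\<dots> = (\<Sum>u\<in>B. \<Sum>x\<in>W n. if x \<in> Z then g (u @ x) else 0)"
          using B by (subst sum.If_cases) (auto simp: Int_absorb1)
        also have "\<dots> = (\<Sum>u\<in>B. \<Sum>x\<in>Z. g (u @ x))"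
        proof -
          have "W n \<inter> Z = Z" by (auto simp: Z_def)
          then show ?thesis by (subst sum.If_cases) auto
        qed
        also have "\<dots> = (\<Sum>y\<in>W m. \<Sum>x\<in>Z. g (fill S y @ x))"
          unfolding B_def using inj_on_fill[OF S', of "{..<Suc k}"] by (subst sum.reindex) (auto simp: W_def)
        also have "\<dots> = (\<Sum>x\<in>Z. \<Sum>y\<in>W m. g (fill S y @ x))"
          by (rule sum.swap)
        finally show ?thesis .
      qed
      define d' where "d' = (\<Sum>u\<in>W l. \<Sum>x\<in>W n. of_bool (x \<in> D' u) :: real)"
      have dd': "d = d' + card Z * K ^ m"
        using split[of "\<lambda>_. 1"] by (simp add: d_def d'_def cW)
      have d': "0 \<le> d'" "d' \<le> (1 - c) * d"
      proof -
        show "0 \<le> d'" unfolding d'_def by (intro sum_nonneg) auto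
        have "real (card Z) * 1 \<le> card Z * K ^ m" using K by (intro mult_left_mono) auto
        then show "d' \<le> (1 - c) * d" using dd' Z by (simp add: algebra_simps)
      qed
      have IH: "(\<Sum>x\<in>W n. of_bool (x \<in> D' u) * f (u @ x)) \<le>
         (b + (1 - c) ^ j) * (\<Sum>x\<in>W n. of_bool (x \<in> D' u)) + e * K ^ n" if u: "u \<in> W l" for u
      proof (rule Suc.IH[of "D' u" "\<lambda>x. f (u @ x)", folded n_def])
        have D: "u @ x \<in> D \<longleftrightarrow> u @ replace k i x \<in> D" if "u \<in> W l" "x \<in> W n" for u x
          using insensitive_slice(2)[OF prems(1) i] that by (auto simp: W_def insensitive_def)
        \<comment> \<open>\<open>Z\<close> is an intersection of fibres of \<open>D\<close> over
          fixed prefixes, so it inherits insensitivity in the suffix. This is what allows the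
          removal to be iterated.\<close>
        have "x \<in> Z \<longleftrightarrow> replace k i x \<in> Z" if "x \<in> W n" for x
          using that D[of "fill S _" x] B replace_in_words_Suc[of x k n i] i
          by (auto simp: Z_def B_def W_def)
        then show "insensitive k i n (D' u)"
          using D u by (auto simp: insensitive_def D'_def W_def)
        show "f (u @ x) \<le> 1" if "x \<in> W n" for x
          using prems(2)[of "u @ x"] u that by (auto simp: W_def words_def)
        show "(\<Sum>y\<in>W m. f (u @ fill V y)) \<le> b * K ^ m" if "V \<in> subspaces (Suc k) m n" for V
          using prems(4)[of "map Inl u @ V"] subspace_append_word(2)[OF that, of u l] u by (simp add: W_def)
      qed fact
      have "(\<Sum>x\<in>Z. \<Sum>y\<in>W m. f (fill S y @ x)) \<le> (\<Sum>x\<in>Z. b * K ^ m)"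
      proof (intro sum_mono)
        fix x assume "x \<in> Z"
        then show "(\<Sum>y\<in>W m. f (fill S y @ x)) \<le> b * K ^ m"
          using prems(4)[of "S @ map Inl x"] subspace_append_word(1)[OF S', of x n] by (simp add: W_def Z_def)
      qed
      moreover have "(\<Sum>u\<in>W l. \<Sum>x\<in>W n. of_bool (x \<in> D' u) * f (u @ x)) \<le>
        (\<Sum>u\<in>W l. (b + (1 - c) ^ j) * (\<Sum>x\<in>W n. of_bool (x \<in> D' u)) + e * K ^ n)"
        by (intro sum_mono IH)
      ultimately have "(\<Sum>w\<in>W (l + n). of_bool (w \<in> D) * f w) \<le>
          (b + (1 - c) ^ j) * d' + e * K ^ (l + n) + b * (card Z * K ^ m)"
        unfolding split[of f] by (simp add: sum.distrib sum_distrib_left[symmetric] d'_def cW power_add mult_ac)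
      also have "\<dots> = b * d + (1 - c) ^ j * d' + e * K ^ (l + n)"
        by (simp add: dd' algebra_simps)
      also have "\<dots> \<le> b * d + (1 - c) ^ j * ((1 - c) * d) + e * K ^ (l + n)"
        using mult_left_mono[OF d'(2) p0[of j]] by simp
      also have "\<dots> = (b + (1 - c) ^ Suc j) * d + e * K ^ (l + n)"
        by (simp add: algebra_simps)
      finally show ?thesis unfolding N d_def .
    qed
  qed
  then show ?thesis using c unfolding W_def K_def subspace_sums_le_def by blast
qed

lemma insensitive_sum_le:
  assumes HJ: "density_HJ k" "0 < k" and i: "i < k" and \<epsilon>: "0 < \<epsilon>"
  shows "\<exists>n\<ge>m. \<forall>D f b. insensitive k i n D \<longrightarrow> (\<forall>w\<in>words {..<Suc k} n. f w \<le> 1) \<longrightarrow> 0 \<le> b \<longrightarrow>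
     subspace_sums_le (Suc k) m n f b \<longrightarrow>
     (\<Sum>w\<in>words {..<Suc k} n. of_bool (w \<in> D) * f w) \<le> (b + \<epsilon>) * real (Suc k) ^ n"
proof -
  define e where "e = min (\<epsilon> / 2) 1"
  have e: "0 < e" "e \<le> 1" "e \<le> \<epsilon> / 2" using \<epsilon> by (auto simp: e_def)
  obtain l c where c: "0 < c" "c \<le> 1" and *: "\<forall>j D f b. insensitive k i (j * l + m) D \<longrightarrow>
     (\<forall>w\<in>words {..<Suc k} (j * l + m). f w \<le> 1) \<longrightarrow> 0 \<le> b \<longrightarrow>
     subspace_sums_le (Suc k) m (j * l + m) f b \<longrightarrow>
     (\<Sum>w\<in>words {..<Suc k} (j * l + m). of_bool (w \<in> D) * f w) \<le>
       (b + (1 - c) ^ j) * (\<Sum>w\<in>words {..<Suc k} (j * l + m). of_bool (w \<in> D)) + e * real (Suc k) ^ (j * l + m)"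
    using insensitive_sum_le_iterate[OF HJ i e(1,2), of m] by (elim exE conjE)
  obtain j where j: "(1 - c) ^ j < \<epsilon> / 2"
    using real_arch_pow_inv[of "\<epsilon> / 2" "1 - c"] c \<epsilon> by auto
  show ?thesis
  proof (intro exI[of _ "j * l + m"] conjI allI impI)
    fix D f and b :: real
    define n where "n = j * l + m"
    assume "insensitive k i (j * l + m) D" "\<forall>w\<in>words {..<Suc k} (j * l + m). f w \<le> 1" and b: "0 \<le> b"
      and "subspace_sums_le (Suc k) m (j * l + m) f b"
    with * 
    have "(\<Sum>w\<in>words {..<Suc k} n. of_bool (w \<in> D) * f w) \<le>
       (b + (1 - c) ^ j) * (\<Sum>w\<in>words {..<Suc k} n. of_bool (w \<in> D)) + e * real (Suc k) ^ n"
      by (simp only: n_def)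
    also have "\<dots> \<le> (b + \<epsilon> / 2) * (\<Sum>w\<in>words {..<Suc k} n. 1) + \<epsilon> / 2 * real (Suc k) ^ n"
      using j b e(3) c(2) \<epsilon> by (intro add_mono mult_mono sum_mono) (auto intro!: sum_nonneg)
    also have "\<dots> = (b + \<epsilon>) * real (Suc k) ^ n"
      by (simp add: algebra_simps)
    finally show "(\<Sum>w\<in>words {..<Suc k} (j * l + m). of_bool (w \<in> D) * f w) \<le> (b + \<epsilon>) * real (Suc k) ^ (j * l + m)"
      by (simp only: n_def)
  qed simp
qed

definition insensitive_bound :: "nat \<Rightarrow> nat \<Rightarrow> nat \<Rightarrow> nat \<Rightarrow> real \<Rightarrow> bool" where
  "insensitive_bound k r m n \<epsilon> \<longleftrightarrow> (\<forall>D f b. (\<forall>i<r. insensitive k i n (D i)) \<longrightarrow>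
     (\<forall>w\<in>words {..<Suc k} n. f w \<le> 1) \<longrightarrow> 0 \<le> b \<longrightarrow> subspace_sums_le (Suc k) m n f b \<longrightarrow>
     (\<Sum>w\<in>words {..<Suc k} n. of_bool (\<forall>i<r. w \<in> D i) * f w) \<le> (b + \<epsilon>) * real (Suc k) ^ n)"

text \<open>Only the last set is decomposed, into subspaces of the dimension \<open>n1\<close>
  required by the induction hypothesis. On each of them the other sets remain insensitive, so the
  hypothesis bounds the mean of their indicator times \<open>f\<close>.\<close>

lemma insensitive_Inter_sum_le:
  assumes HJ: "density_HJ k" "0 < k" and "r \<le> k" and \<epsilon>: "0 < \<epsilon>"
  shows "\<exists>n\<ge>m. insensitive_bound k r m n \<epsilon>"
  using assms(3,4)
proof (induction r arbitrary: \<epsilon>)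
  case 0
  \<comment> \<open>With no sets at all, the whole cube of dimension \<open>m\<close> is the one
    subspace needed.\<close>
  let ?S = "map Inr [0..<m]"
  have S: "?S \<in> subspaces (Suc k) m m" by (auto simp: subspaces_def)
  have "fill ?S y = y" if "y \<in> words {..<Suc k} m" for y
    using that by (auto simp: fill_def words_def intro: nth_equalityI)
  then have "(\<Sum>w\<in>words {..<Suc k} m. f w) = (\<Sum>w\<in>words {..<Suc k} m. f (fill ?S w))" for f :: "nat list \<Rightarrow> real"
    by simp
  then show ?case
    using 0 S by (intro exI[of _ m])
      (auto simp: insensitive_bound_def subspace_sums_le_def distrib_right intro!: add_increasing2)
next
  case (Suc r)
  have r: "r \<le> k" "r < k" "0 < \<epsilon> / 2" using Suc.prems by auto
  obtain n1 where n1: "n1 \<ge> m" "insensitive_bound k r m n1 (\<epsilon> / 2)"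
    using Suc.IH[OF r(1,3)] by (elim exE conjE)
  obtain n where n: "n \<ge> n1" "\<forall>D f b. insensitive k r n D \<longrightarrow> (\<forall>w\<in>words {..<Suc k} n. f w \<le> 1) \<longrightarrow> 0 \<le> b \<longrightarrow>
     subspace_sums_le (Suc k) n1 n f b \<longrightarrow>
     (\<Sum>w\<in>words {..<Suc k} n. of_bool (w \<in> D) * f w) \<le> (b + \<epsilon> / 2) * real (Suc k) ^ n"
    using insensitive_sum_le[OF HJ r(2,3), of n1] by (elim exE conjE)
  have "(\<Sum>w\<in>words {..<Suc k} n. of_bool (\<forall>i<Suc r. w \<in> D i) * f w) \<le> (b + \<epsilon>) * real (Suc k) ^ n"
    if D: "\<forall>i<Suc r. insensitive k i n (D i)" and f: "\<forall>w\<in>words {..<Suc k} n. f w \<le> 1" and b: "0 \<le> b"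
      and S: "subspace_sums_le (Suc k) m n f b" for D f b
  proof -
    define g where "g w = of_bool (\<forall>i<r. w \<in> D i) * f w" for w
    have "(\<Sum>w\<in>words {..<Suc k} n. of_bool (\<forall>i<Suc r. w \<in> D i) * f w) = (\<Sum>w\<in>words {..<Suc k} n. of_bool (w \<in> D r) * g w)"
      by (intro sum.cong refl) (auto simp: g_def less_Suc_eq)
    also have "\<dots> \<le> (b + \<epsilon> / 2 + \<epsilon> / 2) * real (Suc k) ^ n"
    proof (rule n(2)[THEN spec, THEN spec, THEN spec, THEN mp, THEN mp, THEN mp, THEN mp])
      show "insensitive k r n (D r)" using D by simp
      show "\<forall>w\<in>words {..<Suc k} n. g w \<le> 1" using f by (auto simp: g_def of_bool_def)
      show "0 \<le> b + \<epsilon> / 2" using b Suc.prems by simp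
      show "subspace_sums_le (Suc k) n1 n g (b + \<epsilon> / 2)"
        unfolding subspace_sums_le_def
      proof
        fix V assume V: "V \<in> subspaces (Suc k) n1 n"
        have "(\<Sum>y\<in>words {..<Suc k} n1. of_bool (\<forall>i<r. y \<in> {y. fill V y \<in> D i}) * f (fill V y)) \<le> (b + \<epsilon> / 2) * real (Suc k) ^ n1"
        proof (rule n1(2)[unfolded insensitive_bound_def, THEN spec, THEN spec, THEN spec, THEN mp, THEN mp, THEN mp, THEN mp])
          show "\<forall>i<r. insensitive k i n1 {y. fill V y \<in> D i}"
            using D Suc.prems(1) by (auto intro!: insensitive_subspace[OF _ _ V])
          show "\<forall>w\<in>words {..<Suc k} n1. f (fill V w) \<le> 1"
            using f fill_in_words[OF V] by blast
          show "subspace_sums_le (Suc k) m n1 (\<lambda>y. f (fill V y)) b"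
            unfolding subspace_sums_le_def
          proof
            fix T assume T: "T \<in> subspaces (Suc k) m n1"
            show "(\<Sum>y\<in>words {..<Suc k} m. f (fill V (fill T y))) \<le> b * real (Suc k) ^ m"
              using S subspace_comp_in[OF V T] by (simp add: subspace_sums_le_def fill_subspace_comp[OF V T, symmetric])
          qed
        qed fact
        then show "(\<Sum>y\<in>words {..<Suc k} n1. g (fill V y)) \<le> (b + \<epsilon> / 2) * real (Suc k) ^ n1"
          by (simp add: g_def)
      qed
    qed
    finally show ?thesis by (simp only: add.assoc field_sum_of_halves)
  qed
  then have "insensitive_bound k (Suc r) m n \<epsilon>" unfolding insensitive_bound_def by blast
  then show ?case using n(1) n1(1) by (intro exI[of _ n]) auto
qed

section \<open>Line-free sets and the critical density\<close>

definition line_free :: "nat \<Rightarrow> nat \<Rightarrow> nat list set \<Rightarrow> bool" where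
  "line_free k n A \<longleftrightarrow> A \<subseteq> words {..<k} n \<and> (\<forall>S\<in>subspaces k (Suc 0) n. \<exists>i<k. fill S [i] \<notin> A)"

lemma line_free_subspace:
  assumes "line_free k n A" "S \<in> subspaces k m n"
  shows "line_free k m {y \<in> words {..<k} m. fill S y \<in> A}"
  unfolding line_free_def
proof (intro conjI ballI)
  fix T assume T: "T \<in> subspaces k (Suc 0) m"
  obtain i where "i < k" "fill (subspace_comp S T) [i] \<notin> A"
    using assms(1) subspace_comp_in[OF assms(2) T] by (auto simp: line_free_def)
  then show "\<exists>i<k. fill T [i] \<notin> {y \<in> words {..<k} m. fill S y \<in> A}"
    by (auto simp: fill_subspace_comp[OF assms(2) T])
qed auto

lemma line_free_slice:
  assumes "line_free k (m + n) A"
  shows "v \<in> words {..<k} n \<Longrightarrow> line_free k m {u \<in> words {..<k} m. u @ v \<in> A}"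
    and "u \<in> words {..<k} m \<Longrightarrow> line_free k n {v \<in> words {..<k} n. u @ v \<in> A}"
proof -
  have id: "map Inr [0..<j] \<in> subspaces k j j" for j by (auto simp: subspaces_def)
  have fill_id: "fill (map Inr [0..<j]) y = y" if "y \<in> words {..<k} j" for j y
    using that by (auto simp: fill_def words_def intro: nth_equalityI)
  show "line_free k m {u \<in> words {..<k} m. u @ v \<in> A}" if v: "v \<in> words {..<k} n"
    using line_free_subspace[OF assms subspace_append_word(1)[OF id v]] by (simp add: fill_id cong: conj_cong)
  show "line_free k n {v \<in> words {..<k} n. u @ v \<in> A}" if u: "u \<in> words {..<k} m"
    using line_free_subspace[OF assms subspace_append_word(2)[OF id u]] by (simp add: fill_id cong: conj_cong)
qed

text \<open>The maximal density of a line-free set of length \<open>n\<close> is antitone in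
  \<open>n\<close>, because fibres of line-free sets are line-free. Its infimum \<open>d\<close> is
  therefore also its limit, and failure of the theorem at some density makes \<open>d\<close>
  positive.\<close>

lemma critical_density:
  assumes "\<not> density_HJ k" "0 < k"
  obtains d :: real where "0 < d" "d \<le> 1" "\<And>n. \<exists>A. line_free k n A \<and> d * real k ^ n \<le> card A"
    "\<And>\<gamma>. 0 < \<gamma> \<Longrightarrow> \<exists>n0. \<forall>n\<ge>n0. \<forall>A. line_free k n A \<longrightarrow> real (card A) \<le> (d + \<gamma>) * real k ^ n"
proof -
  define D where "D n = Max ((\<lambda>A. card A / real k ^ n) ` {A. line_free k n A})" for n
  obtain \<delta> where \<delta>: "0 < \<delta>" "\<And>n. \<exists>A. line_free k n A \<and> \<delta> * real k ^ n \<le> card A"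
    using assms(1) unfolding density_HJ_def line_free_def by metis
  have fin: "finite {A. line_free k n A}" for n
    by (rule finite_subset[of _ "Pow (words {..<k} n)"]) (auto simp: line_free_def)
  have D_ge: "card A \<le> D n * real k ^ n" if "line_free k n A" for n A
  proof -
    have "card A / real k ^ n \<le> D n" unfolding D_def using fin that by (intro Max_ge) auto
    then show ?thesis using assms(2) by (simp add: field_simps)
  qed
  have D_ex: "\<exists>A. line_free k n A \<and> D n * real k ^ n = card A" for n
  proof -
    have "D n \<in> (\<lambda>A. card A / real k ^ n) ` {A. line_free k n A}"
      unfolding D_def using fin \<delta>(2)[of n] by (intro Max_in) auto
    then show ?thesis using assms(2) by auto
  qed
  have D_lower: "\<delta> \<le> D n" for n
  proof -
    obtain A where "line_free k n A" "\<delta> * real k ^ n \<le> card A" using \<delta>(2) by blast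
    then have "\<delta> * real k ^ n \<le> D n * real k ^ n" using D_ge by force
    then show ?thesis using assms(2) by simp
  qed
  have D_mono: "D (m + n) \<le> D m" for m n
  proof -
    obtain A where A: "line_free k (m + n) A" "D (m + n) * real k ^ (m + n) = card A" using D_ex by blast
    have "A = {w \<in> words {..<k} (m + n). w \<in> A}" using A(1) by (auto simp: line_free_def)
    then have "real (card A) = real (card {w \<in> words {..<k} (m + n). w \<in> A})" by simp
    also have "\<dots> = (\<Sum>v\<in>words {..<k} n. card {u \<in> words {..<k} m. u @ v \<in> A})"
      by (rule card_words_append) simp
    also have "\<dots> \<le> (\<Sum>v\<in>words {..<k} n. D m * real k ^ m)"
      using line_free_slice(1)[OF A(1)] by (simp only: of_nat_sum) (intro sum_mono D_ge, auto)
    also have "\<dots> = D m * real k ^ (m + n)" by (simp add: power_add)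
    finally have "D (m + n) * real k ^ (m + n) \<le> D m * real k ^ (m + n)" using A(2) by linarith
    then show ?thesis using assms(2) by simp
  qed
  define d where "d = Inf (range D)"
  have bdd: "bdd_below (range D)" using D_lower by (auto simp: bdd_below_def)
  have dD: "d \<le> D n" for n unfolding d_def by (intro cInf_lower bdd) auto
  show ?thesis
  proof
    have "\<delta> \<le> d" unfolding d_def using D_lower by (intro cInf_greatest) auto
    then show "0 < d" using \<delta>(1) by simp
    obtain A where "line_free k 0 A" "D 0 = card A" using D_ex[of 0] by auto
    moreover from this have "card A \<le> 1" using card_mono[of "{[]}" A] by (auto simp: line_free_def)
    ultimately show "d \<le> 1" using dD[of 0] by simp
    show "\<exists>A. line_free k n A \<and> d * real k ^ n \<le> card A" for n
    proof -
      obtain A where "line_free k n A" "D n * real k ^ n = card A" using D_ex by blast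
      moreover have "d * real k ^ n \<le> D n * real k ^ n" using dD by (intro mult_right_mono) auto
      ultimately show ?thesis by auto
    qed
    fix \<gamma> :: real assume "0 < \<gamma>"
    then obtain n0 where n0: "D n0 < d + \<gamma>"
      using cInf_lessD[of "range D" "d + \<gamma>"] by (auto simp: d_def)
    have "card A \<le> (d + \<gamma>) * real k ^ n" if "n \<ge> n0" "line_free k n A" for n A
    proof -
      have "D n \<le> d + \<gamma>" using D_mono[of n0 "n - n0"] that(1) n0 by simp
      then have "D n * real k ^ n \<le> (d + \<gamma>) * real k ^ n" by (intro mult_right_mono) auto
      then show ?thesis using D_ge[OF that(2)] by simp
    qed
    then show "\<exists>n0. \<forall>n\<ge>n0. \<forall>A. line_free k n A \<longrightarrow> real (card A) \<le> (d + \<gamma>) * real k ^ n" by blast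
  qed
qed

text \<open>
  A line of the alphabet \<open>{..<k}\<close> is encoded by the word over \<open>{..<Suc k}\<close> in which the letter \<open>k\<close>
  marks the active coordinates. The word \<open>line_word\<close> is obtained from \<open>s\<close> and a word \<open>\<sigma>\<close> over
  \<open>{..<k + length s}\<close>, whose letters from \<open>k\<close> on are pointers into \<open>s\<close>; the prefix \<open>s\<close> makes sure
  that every letter of \<open>s\<close> occurs.
\<close>

definition decode :: "nat \<Rightarrow> nat list \<Rightarrow> nat \<Rightarrow> nat" where
  "decode k s a = (if a < k then a else s ! (a - k))"

definition line_word :: "nat \<Rightarrow> nat list \<Rightarrow> nat list \<Rightarrow> nat list" where
  "line_word k s \<sigma> = s @ map (decode k s) \<sigma>"

lemma decode_in:
  assumes "s \<in> words {..<r} l" "k \<le> r" "a < k + l"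
  shows "decode k s a < r"
  using assms words_nth[OF assms(1), of "a - k"] by (auto simp: decode_def)

lemma line_word_in:
  assumes "s \<in> words {..<r} l" "k \<le> r" "\<sigma> \<in> words {..<k + l} m"
  shows "line_word k s \<sigma> \<in> words {..<r} (l + m)"
proof -
  have "decode k s a < r" if "a \<in> set \<sigma>" for a
    using decode_in[OF assms(1,2)] assms(3) that by (auto simp: words_def)
  then show ?thesis using assms by (auto simp: words_def line_word_def)
qed

text \<open>The reason for pointers: a change in \<open>s\<close> propagates to every position that
  points to it. A line in the prefix thus becomes a line in the whole word, for every
  \<open>\<sigma>\<close>.\<close>

lemma replace_line_word:
  assumes "length s = l" "\<sigma> \<in> words {..<k + l} m"
  shows "replace k i (line_word k s \<sigma>) = line_word k (replace k i s) \<sigma>"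
proof -
  have "(if decode k s a = k then i else decode k s a) = decode k (replace k i s) a" if "a \<in> set \<sigma>" for a
  proof (cases "a < k")
    case False
    then have "a - k < length s" using that assms by (auto simp: words_def)
    then show ?thesis using False by (simp add: decode_def replace_def)
  qed (simp add: decode_def)
  then show ?thesis by (simp add: line_word_def) (simp add: replace_def)
qed

lemma fill_replace_eq_replace:
  "fill (map (\<lambda>a. if a = k then Inr 0 else Inl a) w) [i] = replace k i w"
  by (simp add: fill_def replace_def)

lemma subspace_of_word:
  assumes "w \<in> words {..<Suc k} n" "k \<in> set w"
  shows "map (\<lambda>a. if a = k then Inr 0 else Inl a) w \<in> subspaces k (Suc 0) n"
  using assms by (force simp: subspaces_def words_def)

text \<open>
  If \<open>C\<close> is the set of words whose \<open>k\<close>-replacements all lie in \<open>A\<close>, then a line-free \<open>A\<close> meets \<open>C\<close>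
  only in words without the letter \<open>k\<close>. Hence \<open>A\<close> is concentrated on the complement of \<open>C\<close>, which is
  a union of \<open>k\<close> disjoint intersections of insensitive sets.
\<close>

lemma line_free_correlation:
  fixes b e :: real
  assumes k: "0 < k" and A: "line_free (Suc k) n A"
    and bound: "insensitive_bound k k m n (e / k)"
    and m: "\<And>B. line_free (Suc k) m B \<Longrightarrow> card B \<le> b * real (Suc k) ^ m"
    and b: "0 \<le> b"
  shows "card A + b * card {y \<in> words {..<Suc k} n. \<forall>i<k. replace k i y \<in> A} \<le> (b + e) * real (Suc k) ^ n + real k ^ n"
proof -
  define W where "W = words {..<Suc k} n"
  have fW: "finite W" by (simp add: W_def)
  define C where "C = {y \<in> W. \<forall>i<k. replace k i y \<in> A}"
  \<comment> \<open>The balanced indicator. Its mean on each \<open>m\<close>-dimensional subspace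
    is at most 0, since \<open>A\<close> is line-free there too.\<close>
  define f :: "nat list \<Rightarrow> real" where "f w = of_bool (w \<in> A) - b" for w
  \<comment> \<open>Words outside \<open>C\<close> are sorted by the least \<open>j\<close> whose
    replacement leaves \<open>A\<close>. For fixed \<open>j\<close> the conditions on
    \<open>i\<close> concern one replacement each, hence are insensitive; those with
    \<open>j < i\<close> are void.\<close>
  define D where "D j i = {y. (i < j \<longrightarrow> replace k i y \<in> A) \<and> (i = j \<longrightarrow> replace k i y \<notin> A)}" for j i
  have D: "insensitive k i n (D j i)" if "i < k" for i j
    using that by (auto simp: insensitive_def D_def replace_idem)
  have f1: "\<forall>w\<in>words {..<Suc k} n. f w \<le> 1" using b by (auto simp: f_def of_bool_def)
  have fS: "subspace_sums_le (Suc k) m n f 0"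
    unfolding subspace_sums_le_def
  proof
    fix S assume S: "S \<in> subspaces (Suc k) m n"
    have "(\<Sum>y\<in>words {..<Suc k} m. f (fill S y)) = card {y \<in> words {..<Suc k} m. fill S y \<in> A} - b * real (Suc k) ^ m"
      unfolding f_def sum_subtractf card_words_eq_sum[OF finite_lessThan, symmetric] by simp
    then show "(\<Sum>y\<in>words {..<Suc k} m. f (fill S y)) \<le> 0 * real (Suc k) ^ m"
      using m[OF line_free_subspace[OF A S]] by simp
  qed
  have "(\<Sum>w\<in>W. of_bool (\<forall>i<k. w \<in> D j i) * f w) \<le> e / k * real (Suc k) ^ n" for j
    using bound[unfolded insensitive_bound_def, THEN spec, of "D j", THEN spec, of f, THEN spec, of 0] D f1 fS
    by (simp add: W_def)
  then have "(\<Sum>j<k. \<Sum>w\<in>W. of_bool (\<forall>i<k. w \<in> D j i) * f w) \<le> (\<Sum>j<k. e / k * real (Suc k) ^ n)"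
    by (intro sum_mono)
  also have "\<dots> = e * real (Suc k) ^ n" using k by simp
  also have "(\<Sum>j<k. \<Sum>w\<in>W. of_bool (\<forall>i<k. w \<in> D j i) * f w) = (\<Sum>w\<in>W. (\<Sum>j<k. of_bool (\<forall>i<k. w \<in> D j i)) * f w)"
    unfolding sum_distrib_right by (rule sum.swap)
  also have "\<dots> = (\<Sum>w\<in>W. (1 - of_bool (w \<in> C)) * f w)"
  proof (intro sum.cong refl)
    fix w assume w: "w \<in> W"
    have "(\<Sum>j<k. of_bool (\<forall>i<k. w \<in> D j i)) = (1 - of_bool (w \<in> C) :: real)"
    proof (cases "w \<in> C")
      case True
      then have "\<not> (\<forall>i<k. w \<in> D j i)" if "j < k" for j using that by (auto simp: C_def D_def)
      then have "(\<Sum>j<k. of_bool (\<forall>i<k. w \<in> D j i)) = (\<Sum>j<k. 0 :: real)"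
        by (intro sum.cong) auto
      then show ?thesis using True by simp
    next
      case False
      then have ex: "\<exists>i. i < k \<and> replace k i w \<notin> A" using w by (auto simp: C_def)
      define j0 where "j0 = (LEAST i. i < k \<and> replace k i w \<notin> A)"
      have j0: "j0 < k" "replace k j0 w \<notin> A" using LeastI_ex[OF ex] by (auto simp: j0_def)
      have less: "replace k i w \<in> A" if "i < j0" for i
        using not_less_Least[of i "\<lambda>i. i < k \<and> replace k i w \<notin> A"] that j0(1) by (auto simp: j0_def)
      have "(\<forall>i<k. w \<in> D j i) \<longleftrightarrow> j = j0" if "j < k" for j
      proof
        assume "\<forall>i<k. w \<in> D j i"
        then show "j = j0" using less j0 that by (auto simp: D_def) (metis linorder_neqE_nat)
      qed (use less j0 in \<open>auto simp: D_def\<close>)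
      then have "(\<Sum>j<k. of_bool (\<forall>i<k. w \<in> D j i)) = (\<Sum>j<k. if j = j0 then 1 else 0 :: real)"
        by (intro sum.cong) auto
      then show ?thesis using False j0 by simp
    qed
    then show "(\<Sum>j<k. of_bool (\<forall>i<k. w \<in> D j i)) * f w = (1 - of_bool (w \<in> C)) * f w" by simp
  qed
  also have "\<dots> = (\<Sum>w\<in>W. of_bool (w \<in> A) - of_bool (w \<in> A \<inter> C) - b + b * of_bool (w \<in> C))"
    by (intro sum.cong refl) (auto simp: f_def of_bool_def)
  also have "\<dots> = (\<Sum>w\<in>W. of_bool (w \<in> A)) - (\<Sum>w\<in>W. of_bool (w \<in> A \<inter> C)) - b * card W + b * (\<Sum>w\<in>W. of_bool (w \<in> C))"
    by (simp only: sum.distrib sum_subtractf sum_distrib_left) simp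
  also have "(\<Sum>w\<in>W. of_bool (w \<in> A)) = real (card A)"
  proof -
    have "{w \<in> W. w \<in> A} = A" using A by (auto simp: line_free_def W_def)
    then show ?thesis using card_words_eq_sum[of "{..<Suc k}" n "\<lambda>w. w \<in> A"] by (simp add: W_def)
  qed
  also have "(\<Sum>w\<in>W. of_bool (w \<in> C)) = real (card C)"
  proof -
    have "{w \<in> W. w \<in> C} = C" by (auto simp: C_def)
    then show ?thesis using card_words_eq_sum[of "{..<Suc k}" n "\<lambda>w. w \<in> C"] by (simp add: W_def)
  qed
  also have "(\<Sum>w\<in>W. of_bool (w \<in> A \<inter> C)) = real (card {w \<in> W. w \<in> A \<inter> C})"
    unfolding W_def by (rule card_words_eq_sum[symmetric]) simp
  finally have "card A - real (card {w \<in> W. w \<in> A \<inter> C}) - b * card W + b * card C \<le> e * real (Suc k) ^ n" .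
  \<comment> \<open>A word of \<open>A\<close> and \<open>C\<close> containing \<open>k\<close>
    would be a line in \<open>A\<close>: its \<open>k\<close>-replacement is the word
    itself.\<close>
  moreover have "card {w \<in> W. w \<in> A \<inter> C} \<le> card (words {..<k} n)"
  proof (rule card_mono)
    show "{w \<in> W. w \<in> A \<inter> C} \<subseteq> words {..<k} n"
    proof
      fix w assume w: "w \<in> {w \<in> W. w \<in> A \<inter> C}"
      have "k \<notin> set w"
      proof
        assume k: "k \<in> set w"
        let ?S = "map (\<lambda>a. if a = k then Inr 0 else Inl a) w"
        have "?S \<in> subspaces (Suc k) (Suc 0) n"
          using subspace_of_word[of w k n] k w subspaces_mono[of k "Suc k"] by (auto simp: W_def)
        then obtain i where "i < Suc k" "replace k i w \<notin> A"
          using A by (auto simp: line_free_def fill_replace_eq_replace)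
        moreover have "replace k k w = w" by (simp add: replace_def)
        ultimately show False using w by (auto simp: C_def less_Suc_eq)
      qed
      then show "w \<in> words {..<k} n"
        using w by (auto simp: W_def words_def less_Suc_eq subset_iff)
    qed
  qed simp
  then have "real (card {w \<in> W. w \<in> A \<inter> C}) \<le> real k ^ n"
    by (simp flip: of_nat_power)
  moreover have "b * card W = b * real (Suc k) ^ n" by (simp add: W_def)
  ultimately have "card A + b * card C \<le> (b + e) * real (Suc k) ^ n + real k ^ n"
    unfolding distrib_right by linarith
  then show ?thesis by (simp add: C_def W_def)
qed

section \<open>The density increment\<close>

text \<open>No fibre exceeds the critical density by more than \<open>\<gamma> / k ^ m\<close>, and
  there are \<open>k ^ m\<close> of them. So even if all others are as dense as possible, the fibre
  over \<open>t\<close> can fall short by at most \<open>\<gamma>\<close>. A bound for every prefix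
  is what permits restricting to special prefixes later.\<close>

lemma line_free_slice_dense:
  assumes A: "line_free k (m + n) A" "d * real k ^ (m + n) \<le> card A" and k: "0 < k" and "0 \<le> \<gamma>" "0 \<le> d"
    and le: "\<And>B. line_free k n B \<Longrightarrow> card B \<le> (d + \<gamma> / real k ^ m) * real k ^ n"
    and t: "t \<in> words {..<k} m"
  shows "(d - \<gamma>) * real k ^ n \<le> card {x \<in> words {..<k} n. t @ x \<in> A}"
proof -
  define c where "c u = real (card {x \<in> words {..<k} n. u @ x \<in> A})" for u
  have "{w \<in> words {..<k} (m + n). w \<in> A} = A" using A(1) by (auto simp: line_free_def)
  then have "real (card A) = (\<Sum>w\<in>words {..<k} (m + n). of_bool (w \<in> A))"
    using card_words_eq_sum[of "{..<k}" "m + n" "\<lambda>w. w \<in> A"] by simp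
  also have "\<dots> = (\<Sum>u\<in>words {..<k} m. c u)"
    by (simp only: sum_words_append c_def card_words_eq_sum[OF finite_lessThan])
  also have "\<dots> = c t + (\<Sum>u\<in>words {..<k} m - {t}. c u)"
    using t by (intro sum.remove) auto
  also have "\<dots> \<le> c t + (\<Sum>u\<in>words {..<k} m - {t}. (d + \<gamma> / real k ^ m) * real k ^ n)"
    using line_free_slice(2)[OF A(1)] le by (intro add_left_mono sum_mono) (auto simp: c_def)
  also have "(\<Sum>u\<in>words {..<k} m - {t}. (d + \<gamma> / real k ^ m) * real k ^ n) =
     (real k ^ m - 1) * ((d + \<gamma> / real k ^ m) * real k ^ n)"
    using t k by (simp add: card_Diff_singleton of_nat_diff Suc_le_eq)
  also have "\<dots> = (d * real k ^ m + \<gamma>) * real k ^ n - (d + \<gamma> / real k ^ m) * real k ^ n"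
    using k by (simp add: field_simps)
  finally have "d * real k ^ (m + n) \<le> c t + (d * real k ^ m + \<gamma>) * real k ^ n - (d + \<gamma> / real k ^ m) * real k ^ n"
    using A(2) by simp
  moreover have "0 \<le> \<gamma> / real k ^ m * real k ^ n" using assms by simp
  ultimately show ?thesis unfolding c_def by (simp add: power_add algebra_simps)
qed

text \<open>For fixed \<open>\<sigma>\<close> and a typical suffix \<open>x\<close>, the prefixes
  \<open>s\<close> over only \<open>k\<close> letters with \<open>line_word k s \<sigma> @ x\<close>
  in \<open>A\<close> are dense, and the hypothesis for \<open>k\<close> finds a line among them. Of
  the fibre density \<open>3 * d / 4\<close>, the threshold takes \<open>d / 4\<close>; the
  remaining \<open>d / 2\<close> is divided among the at most \<open>K ^ l\<close> possible
  lines.\<close>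

lemma popular_line_word:
  assumes l: "\<And>B. B \<subseteq> words {..<k} l \<Longrightarrow> d / 4 * real k ^ l \<le> card B \<Longrightarrow>
      \<exists>S\<in>subspaces k (Suc 0) l. \<forall>i<k. fill S [i] \<in> B"
    and k: "0 < k" and d: "0 < d"
    and A: "\<And>t. t \<in> words {..<Suc k} (l + m) \<Longrightarrow> 3 * d / 4 * real (Suc k) ^ n \<le> card {x \<in> words {..<Suc k} n. t @ x \<in> A}"
  shows "\<exists>s\<in>words {..<Suc k} l. k \<in> set s \<and> d / 2 / real (Suc k) ^ l * real (Suc k) ^ n * real (k + l) ^ m \<le>
    (\<Sum>\<sigma>\<in>words {..<k + l} m. card {x \<in> words {..<Suc k} n. \<forall>i<k. replace k i (line_word k s \<sigma>) @ x \<in> A})"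
proof -
  define K where "K = real (Suc k)"
  define W where "W n = words {..<Suc k} n" for n
  have fW [simp]: "finite (W n)" for n by (simp add: W_def)
  have cW: "real (card (W n)) = K ^ n" for n by (simp add: W_def K_def)
  have K: "K > 0" by (simp add: K_def)
  define P where "P s \<sigma> x \<longleftrightarrow> (\<forall>i<k. replace k i (line_word k s \<sigma>) @ x \<in> A)" for s \<sigma> x
  define Sk where "Sk = {s \<in> W l. k \<in> set s}"
  have fSk: "finite Sk" and "card Sk \<le> card (W l)" by (auto simp: Sk_def intro: card_mono)
  then have cSk: "real (card Sk) \<le> K ^ l" using cW[of l] by linarith
  have \<sigma>: "d / 2 * K ^ n \<le> (\<Sum>s\<in>Sk. real (card {x \<in> W n. P s \<sigma> x}))" if \<sigma>: "\<sigma> \<in> words {..<k + l} m" for \<sigma>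
  proof -
    define f where "f x = card {s \<in> words {..<k} l. line_word k s \<sigma> @ x \<in> A} / real k ^ l" for x
    have "card {s \<in> words {..<k} l. line_word k s \<sigma> @ x \<in> A} \<le> k ^ l" for x
      using card_mono[of "words {..<k} l" "{s \<in> words {..<k} l. line_word k s \<sigma> @ x \<in> A}"] by auto
    then have f1: "f x \<le> 1" for x
      using k by (simp add: f_def divide_le_eq flip: of_nat_power)
    have "(\<Sum>x\<in>W n. f x) * real k ^ l = (\<Sum>x\<in>W n. real (card {s \<in> words {..<k} l. line_word k s \<sigma> @ x \<in> A}))"
      using k by (simp add: f_def sum_divide_distrib[symmetric])
    also have "\<dots> = (\<Sum>s\<in>words {..<k} l. \<Sum>x\<in>W n. of_bool (line_word k s \<sigma> @ x \<in> A))"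
      unfolding card_words_eq_sum[OF finite_lessThan] by (rule sum.swap)
    also have "\<dots> = (\<Sum>s\<in>words {..<k} l. real (card {x \<in> W n. line_word k s \<sigma> @ x \<in> A}))"
      unfolding W_def card_words_eq_sum[OF finite_lessThan] ..
    also have "\<dots> \<ge> (\<Sum>s\<in>words {..<k} l. 3 * d / 4 * K ^ n)"
    proof (intro sum_mono)
      fix s assume "s \<in> words {..<k} l"
      then have "line_word k s \<sigma> \<in> words {..<Suc k} (l + m)"
        using line_word_in[OF _ _ \<sigma>, of s "Suc k"] words_mono[of "{..<k}" "{..<Suc k}" l] by auto
      from A[OF this] show "3 * d / 4 * K ^ n \<le> real (card {x \<in> W n. line_word k s \<sigma> @ x \<in> A})"
        by (simp add: W_def K_def)
    qed
    finally have "3 * d / 4 * K ^ n * real k ^ l \<le> (\<Sum>x\<in>W n. f x) * real k ^ l"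
      by (simp add: mult_ac)
    then have "(d / 4 + d / 2) * card (W n) \<le> (\<Sum>x\<in>W n. f x)"
      using k by (simp add: cW)
    then have X: "d / 2 * K ^ n \<le> card {x \<in> W n. d / 4 \<le> f x}"
      using card_ge_threshold[of "W n" f "d / 4" "d / 2"] f1 d by (simp add: cW)
    have "{x \<in> W n. d / 4 \<le> f x} \<subseteq> (\<Union>s\<in>Sk. {x \<in> W n. P s \<sigma> x})"
    proof
      fix x assume x: "x \<in> {x \<in> W n. d / 4 \<le> f x}"
      obtain S where S: "S \<in> subspaces k (Suc 0) l" "\<And>i. i < k \<Longrightarrow> fill S [i] \<in> words {..<k} l \<and> line_word k (fill S [i]) \<sigma> @ x \<in> A"
        using l[of "{s \<in> words {..<k} l. line_word k s \<sigma> @ x \<in> A}"] x k by (auto simp: f_def field_simps)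
      \<comment> \<open>Filling the line with the extra letter \<open>k\<close> records it as a
        word, whose replacements are the points of the line.\<close>
      have "Inr 0 \<in> set S" using S(1) by (auto simp: subspaces_def)
      then have k_in: "k \<in> set (fill S [k])" unfolding fill_def by force
      have fSk: "fill S [k] \<in> W l"
        unfolding W_def using S(1) by (rule fill_in_words) (auto simp: words_def)
      have "replace k i (line_word k (fill S [k]) \<sigma>) = line_word k (fill S [i]) \<sigma>" for i
        using replace_line_word[OF _ \<sigma>, of "fill S [k]" i] fSk replace_fill[OF S(1), of "[k]" i]
        by (simp add: W_def words_def replace_def)
      then have "P (fill S [k]) \<sigma> x" using S(2) by (simp add: P_def)
      then show "x \<in> (\<Union>s\<in>Sk. {x \<in> W n. P s \<sigma> x})"
        using x k_in fSk by (auto simp: Sk_def)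
    qed
    then have "card {x \<in> W n. d / 4 \<le> f x} \<le> card (\<Union>s\<in>Sk. {x \<in> W n. P s \<sigma> x})"
      using fSk by (intro card_mono) auto
    also have "\<dots> \<le> (\<Sum>s\<in>Sk. card {x \<in> W n. P s \<sigma> x})"
      by (rule card_UN_le[OF fSk])
    finally show ?thesis using X by (simp flip: of_nat_sum)
  qed
  define Q where "Q s = (\<Sum>\<sigma>\<in>words {..<k + l} m. real (card {x \<in> W n. P s \<sigma> x}))" for s
  have "d / 2 * K ^ n * real (k + l) ^ m = (\<Sum>\<sigma>\<in>words {..<k + l} m. d / 2 * K ^ n)"
    by simp
  also have "\<dots> \<le> (\<Sum>\<sigma>\<in>words {..<k + l} m. \<Sum>s\<in>Sk. real (card {x \<in> W n. P s \<sigma> x}))"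
    by (intro sum_mono \<sigma>)
  also have "\<dots> = (\<Sum>s\<in>Sk. Q s)"
    unfolding Q_def by (rule sum.swap)
  finally have sumQ: "d / 2 * K ^ n * real (k + l) ^ m \<le> (\<Sum>s\<in>Sk. Q s)" .
  have pos: "0 < d / 2 * K ^ n * real (k + l) ^ m" using d K k by simp
  have "\<exists>s\<in>Sk. d / 2 * K ^ n * real (k + l) ^ m / K ^ l \<le> Q s"
  proof (rule ccontr)
    assume neg: "\<not> ?thesis"
    have "Sk \<noteq> {}" using sumQ pos by auto
    then have "(\<Sum>s\<in>Sk. Q s) < (\<Sum>s\<in>Sk. d / 2 * K ^ n * real (k + l) ^ m / K ^ l)"
      using neg fSk by (intro sum_strict_mono) (auto simp: not_le)
    also have "\<dots> = real (card Sk) * (d / 2 * K ^ n * real (k + l) ^ m / K ^ l)" by simp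
    also have "\<dots> \<le> K ^ l * (d / 2 * K ^ n * real (k + l) ^ m / K ^ l)"
      using pos K by (intro mult_right_mono cSk) auto
    also have "\<dots> = d / 2 * K ^ n * real (k + l) ^ m" using K by simp
    finally show False using sumQ by simp
  qed
  then obtain s where "s \<in> Sk" "d / 2 * K ^ n * real (k + l) ^ m / K ^ l \<le> Q s" by blast
  then show ?thesis by (intro bexI[of _ s]) (auto simp: Sk_def W_def Q_def P_def K_def mult_ac)
qed

text \<open>Wildcard 0 occupies every position that carries the letter \<open>k\<close>, in the
  prefix or through a pointer; the wildcards of \<open>v\<close> are shifted by one. The original
  line word is recovered by giving \<open>k\<close> to wildcard 0.\<close>

definition line_subspace :: "nat \<Rightarrow> nat list \<Rightarrow> (nat + nat) list \<Rightarrow> (nat + nat) list" where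
  "line_subspace k s v = map (\<lambda>a. if a = k then Inr 0 else Inl a) s @
     map (case_sum (\<lambda>a. if decode k s a = k then Inr 0 else Inl (decode k s a)) (Inr \<circ> Suc)) v"

lemma line_subspace_in:
  assumes "s \<in> words {..<Suc k} l" "k \<in> set s" "v \<in> subspaces (k + l) M m"
  shows "line_subspace k s v \<in> subspaces k (Suc M) (l + m)"
proof -
  define g where "g = case_sum (\<lambda>a. if decode k s a = k then Inr 0 else Inl (decode k s a) :: nat + nat) (Inr \<circ> Suc)"
  have "g e \<in> Inl ` {..<k} \<union> Inr ` {..<Suc M}" if "e \<in> set v" for e
    using assms(3) that
  proof (cases rule: subspaces_entryE)
    case (1 a)
    then have "decode k s a < Suc k" using decode_in[OF assms(1), of k a] by simp
    then show ?thesis using 1 by (auto simp: g_def)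
  qed (auto simp: g_def)
  moreover have "(if a = k then Inr 0 else Inl a) \<in> Inl ` {..<k} \<union> Inr ` {..<Suc M}" if "a \<in> set s" for a
    using assms(1) that by (auto simp: words_def)
  moreover have "Inr i \<in> set (line_subspace k s v)" if "i < Suc M" for i
  proof (cases i)
    case 0
    then show ?thesis using assms(2) by (force simp: line_subspace_def)
  next
    case (Suc j)
    then have "Inr j \<in> set v" using assms(3) that by (auto simp: subspaces_def)
    then have "g (Inr j) \<in> g ` set v" by (rule imageI)
    then show ?thesis using Suc by (simp add: line_subspace_def g_def)
  qed
  moreover have "line_subspace k s v = map (\<lambda>a. if a = k then Inr 0 else Inl a) s @ map g v"
    by (simp add: line_subspace_def g_def)
  ultimately show ?thesis using assms(1,3) by (auto simp: subspaces_def words_def)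
qed

lemma fill_line_subspace:
  assumes "v \<in> subspaces (k + l) M m" "length c = M"
  shows "fill (line_subspace k s v) (k # map (decode k s) c) = line_word k s (fill v c)"
proof -
  have "case_sum id ((!) (k # map (decode k s) c))
      (case_sum (\<lambda>a. if decode k s a = k then Inr 0 else Inl (decode k s a)) (Inr \<circ> Suc) e) =
     decode k s (case_sum id ((!) c) e)" if "e \<in> set v" for e
    using assms(1) that by (cases rule: subspaces_entryE) (auto simp: assms(2))
  then show ?thesis
    by (auto simp: fill_def line_word_def line_subspace_def intro!: map_idI)
qed

text \<open>Take a line-free set of at least critical density and a subspace \<open>V\<close> on
  which a fixed proportion of the words encode lines with their first \<open>k\<close> points in the
  set. Such words push out density: by \<open>line_free_correlation\<close>, the trace of the set on
  some copy of \<open>V\<close> is too thin. But all fibres have density close to the critical one,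
  so the average trace is not thin.\<close>

theorem density_HJ_Suc:
  assumes HJ: "density_HJ k" and k: "0 < k"
  shows "density_HJ (Suc k)"
proof (rule ccontr)
  assume "\<not> density_HJ (Suc k)"
  then obtain d :: real where d: "0 < d" "d \<le> 1" and
    exA: "\<And>n. \<exists>A. line_free (Suc k) n A \<and> d * real (Suc k) ^ n \<le> card A" and
    le: "\<And>\<gamma>. 0 < \<gamma> \<Longrightarrow> \<exists>n0. \<forall>n\<ge>n0. \<forall>A. line_free (Suc k) n A \<longrightarrow> real (card A) \<le> (d + \<gamma>) * real (Suc k) ^ n"
    using critical_density[of "Suc k"] by blast
  define K where "K = real (Suc k)"
  have K: "K \<ge> 1" "K > 0" "real k < K" by (auto simp: K_def)
  define W where "W n = words {..<Suc k} n" for n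
  have fW [simp]: "finite (W n)" for n by (simp add: W_def)
  have cW: "real (card (W n)) = K ^ n" for n by (simp add: W_def K_def)
  obtain l where l: "\<And>B. B \<subseteq> words {..<k} l \<Longrightarrow> d / 4 * real k ^ l \<le> card B \<Longrightarrow>
      \<exists>S\<in>subspaces k (Suc 0) l. \<forall>i<k. fill S [i] \<in> B"
    using HJ d unfolding density_HJ_def by (metis divide_pos_pos zero_less_numeral)
  \<comment> \<open>Half of the density \<open>d / (2 * K ^ l)\<close> of line words; the other half
    is spent as the error of \<open>insertion\<close>.\<close>
  define \<theta> where "\<theta> = d / (4 * K ^ l)"
  have \<theta>: "0 < \<theta>" "\<theta> \<le> 1"
  proof -
    have "1 \<le> K ^ l" using K by simp
    then show "0 < \<theta>" "\<theta> \<le> 1" using d by (auto simp: \<theta>_def divide_le_eq)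
  qed
  \<comment> \<open>The gain from the encoded lines is at least
    \<open>d * (\<theta> / K) = 8 * \<gamma>\<close>, while the losses amount to
    \<open>4 * \<gamma>\<close>.\<close>
  define \<gamma> where "\<gamma> = d * (\<theta> / K) / 8"
  have \<gamma>: "0 < \<gamma>" "\<gamma> \<le> d / 8"
    using d \<theta> K by (auto simp: \<gamma>_def divide_le_eq mult_le_cancel_left1)
  obtain n0 where n0: "\<And>n A. n \<ge> n0 \<Longrightarrow> line_free (Suc k) n A \<Longrightarrow> real (card A) \<le> (d + \<gamma>) * K ^ n"
    using le[OF \<gamma>(1)] by (auto simp: K_def)
  obtain j where j: "(k / K) ^ j < \<gamma>"
    using real_arch_pow_inv[of \<gamma> "k / K"] \<gamma> K by auto
  \<comment> \<open>Above \<open>n0\<close> for the critical density, above \<open>j\<close> so that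
    words avoiding \<open>k\<close> are rare, and positive because wildcard 0 takes one of the
    \<open>n2\<close> dimensions.\<close>
  define m where "m = Suc (max n0 j)"
  have "0 < \<gamma> / k" using \<gamma> k by simp
  from insensitive_Inter_sum_le[OF HJ k order_refl this, of m]
  obtain n2 where n2: "n2 \<ge> m" and
    sum_le: "insensitive_bound k k m n2 (\<gamma> / k)"
    by (elim exE conjE)
  have kn2: "real k ^ n2 \<le> \<gamma> * K ^ n2"
  proof -
    have "(k / K) ^ n2 \<le> (k / K) ^ j"
      using n2 K by (intro power_decreasing) (auto simp: m_def)
    then have "(k / K) ^ n2 \<le> \<gamma>" using j by simp
    then show ?thesis using K by (simp add: power_divide field_simps)
  qed
  obtain M where M: "n2 = Suc M" using n2 by (cases n2) (auto simp: m_def)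
  obtain m' where m': "\<forall>R F. R \<subseteq> {..<k + l} \<longrightarrow> R \<noteq> {} \<longrightarrow> (\<forall>\<sigma>\<in>words {..<k + l} m'. 0 \<le> F \<sigma> \<and> F \<sigma> \<le> 1) \<longrightarrow>
    (\<exists>S\<in>subspaces (k + l) M m'. real (card R) ^ M * ((\<Sum>\<sigma>\<in>words {..<k + l} m'. F \<sigma>) / real (k + l) ^ m' - \<theta>) \<le> (\<Sum>c\<in>words R M. F (fill S c)))"
    using insertion[OF \<theta>(1), of "k + l" M] by (elim exE)
  define p where "p = l + m'"
  have "0 < \<gamma> / K ^ p" using \<gamma> K by simp
  then obtain n1 where n1: "\<And>B. line_free (Suc k) n1 B \<Longrightarrow> real (card B) \<le> (d + \<gamma> / K ^ p) * K ^ n1"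
    using le unfolding K_def by (metis order_refl)
  obtain A where A: "line_free (Suc k) (p + n1) A" "d * K ^ (p + n1) \<le> card A"
    using exA by (auto simp: K_def)
  have slice: "(d - \<gamma>) * K ^ n1 \<le> card {x \<in> W n1. t @ x \<in> A}" if "t \<in> W p" for t
    using line_free_slice_dense[OF A(1), of d \<gamma> t] A(2) n1 \<gamma> d that by (simp add: K_def W_def)
  have "3 * d / 4 * K ^ n1 \<le> card {x \<in> W n1. t @ x \<in> A}" if "t \<in> W p" for t
  proof -
    have "3 * d / 4 * K ^ n1 \<le> (d - \<gamma>) * K ^ n1"
      using \<gamma> d K by (intro mult_right_mono) auto
    then show ?thesis using slice[OF that] by linarith
  qed
  from popular_line_word[OF l k d(1), of m' n1 A] this
  obtain s where s: "s \<in> W l" "k \<in> set s" and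
    sum_s: "d / 2 / K ^ l * K ^ n1 * real (k + l) ^ m' \<le>
      (\<Sum>\<sigma>\<in>words {..<k + l} m'. real (card {x \<in> W n1. \<forall>i<k. replace k i (line_word k s \<sigma>) @ x \<in> A}))"
    by (auto simp: W_def K_def p_def)
  obtain q where q: "q < l" "s ! q = k"
    using s by (auto simp: W_def words_def in_set_conv_nth)
  \<comment> \<open>The pointer \<open>k + q\<close> decodes to the letter \<open>k\<close>, so
    decoding is a bijection from \<open>R\<close> onto the letters below
    \<open>Suc k\<close>.\<close>
  define R where "R = insert (k + q) {..<k}"
  have R: "R \<subseteq> {..<k + l}" "R \<noteq> {}" "card R = Suc k" using q by (auto simp: R_def)
  define F where "F \<sigma> = card {x \<in> W n1. \<forall>i<k. replace k i (line_word k s \<sigma>) @ x \<in> A} / K ^ n1" for \<sigma>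
  have "card {x \<in> W n1. P x} \<le> card (W n1)" for P by (intro card_mono) auto
  then have "real (card {x \<in> W n1. P x}) \<le> K ^ n1" for P using cW[of n1] by (metis of_nat_le_iff)
  then have F01: "0 \<le> F \<sigma> \<and> F \<sigma> \<le> 1" for \<sigma> using K by (simp add: F_def)
  obtain v where v: "v \<in> subspaces (k + l) M m'"
    "real (card R) ^ M * ((\<Sum>\<sigma>\<in>words {..<k + l} m'. F \<sigma>) / real (k + l) ^ m' - \<theta>) \<le> (\<Sum>c\<in>words R M. F (fill v c))"
    using m'[THEN spec[of _ R], THEN spec[of _ F]] R F01 by blast
  have "2 * \<theta> \<le> (\<Sum>\<sigma>\<in>words {..<k + l} m'. F \<sigma>) / real (k + l) ^ m'"
    using sum_s K k by (simp add: F_def sum_divide_distrib[symmetric] \<theta>_def field_simps)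
  then have "K ^ M * \<theta> \<le> K ^ M * ((\<Sum>\<sigma>\<in>words {..<k + l} m'. F \<sigma>) / real (k + l) ^ m' - \<theta>)"
    using K by (intro mult_left_mono) auto
  moreover have "real (card R) = K" using R(3) by (simp add: K_def)
  ultimately have F_sum: "K ^ M * \<theta> \<le> (\<Sum>c\<in>words R M. F (fill v c))"
    using v(2) by (metis order_trans)
  define V where "V = line_subspace k s v"
  have V: "V \<in> subspaces k n2 p"
    unfolding V_def M p_def using line_subspace_in[OF _ s(2) v(1)] s(1) by (simp add: W_def)
  have V': "V \<in> subspaces (Suc k) n2 p" using V subspaces_mono[of k "Suc k"] by auto
  define A' where "A' x = {y \<in> W n2. fill V y @ x \<in> A}" for x
  define C where "C x = {y \<in> W n2. \<forall>i<k. replace k i y \<in> A' x}" for x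
  have "(\<Sum>x\<in>W n1. real (card (A' x))) = (\<Sum>y\<in>W n2. real (card {x \<in> W n1. fill V y @ x \<in> A}))"
    unfolding A'_def W_def card_words_eq_sum[OF finite_lessThan] by (rule sum.swap)
  also have "\<dots> \<ge> (\<Sum>y\<in>W n2. (d - \<gamma>) * K ^ n1)"
    using fill_in_words[OF V'] by (intro sum_mono slice) (auto simp: W_def)
  finally have sumA: "K ^ n2 * ((d - \<gamma>) * K ^ n1) \<le> (\<Sum>x\<in>W n1. real (card (A' x)))"
    by (simp add: cW)
  have FC: "F (fill v c) * K ^ n1 = (\<Sum>x\<in>W n1. of_bool (k # map (decode k s) c \<in> C x))" if c: "c \<in> words R M" for c
  proof -
    have decR: "decode k s a < Suc k" if "a \<in> R" for a using that q by (auto simp: R_def decode_def)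
    then have y: "k # map (decode k s) c \<in> W n2"
      using c by (auto simp: words_def W_def M)
    have "replace k i (line_word k s (fill v c)) = fill V (replace k i (k # map (decode k s) c))" for i
      using fill_line_subspace[OF v(1), of c s] c replace_fill[OF V, of "k # map (decode k s) c" i]
      by (simp add: V_def words_def M)
    then have "{x \<in> W n1. \<forall>i<k. replace k i (line_word k s (fill v c)) @ x \<in> A} = {x \<in> W n1. k # map (decode k s) c \<in> C x}"
      using y replace_in_words_Suc[of "k # map (decode k s) c" k n2] by (auto simp: C_def A'_def W_def)
    then show ?thesis
      unfolding F_def using K card_words_eq_sum[of "{..<Suc k}" n1 "\<lambda>x. k # map (decode k s) c \<in> C x"]
      by (simp add: W_def)
  qed
  have "K ^ M * \<theta> * K ^ n1 \<le> (\<Sum>c\<in>words R M. F (fill v c)) * K ^ n1"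
    using F_sum K by (intro mult_right_mono) auto
  also have "\<dots> = (\<Sum>c\<in>words R M. \<Sum>x\<in>W n1. of_bool (k # map (decode k s) c \<in> C x))"
    unfolding sum_distrib_right by (intro sum.cong refl FC)
  also have "\<dots> = (\<Sum>y\<in>W M. \<Sum>x\<in>W n1. of_bool (k # y \<in> C x))"
  proof -
    define g where "g b = (if b = k then k + q else b)" for b
    have g: "g b \<in> R" "decode k s (g b) = b" if "b < Suc k" for b
      using that q by (auto simp: g_def R_def decode_def)
    have g': "decode k s a < Suc k" "g (decode k s a) = a" if "a \<in> R" for a
      using that q by (auto simp: g_def R_def decode_def)
    show ?thesis
      by (rule sum.reindex_bij_witness[of _ "map g" "map (decode k s)"])
         (use g g' in \<open>auto simp: words_def W_def subset_iff intro!: map_idI\<close>)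
  qed
  also have "\<dots> = (\<Sum>x\<in>W n1. \<Sum>y\<in>W M. of_bool (k # y \<in> C x))"
    by (rule sum.swap)
  also have "\<dots> \<le> (\<Sum>x\<in>W n1. real (card (C x)))"
  proof (intro sum_mono)
    fix x
    \<comment> \<open>The words found so far all begin with \<open>k\<close>, the value of wildcard
      0. Among all words of length \<open>n2\<close> this loses a factor \<open>K\<close>.\<close>
    have "(\<Sum>y\<in>W M. of_bool (k # y \<in> C x)) \<le> (\<Sum>a<Suc k. \<Sum>y\<in>W M. of_bool (a # y \<in> C x) :: real)"
      by (rule member_le_sum) (auto intro: sum_nonneg)
    also have "\<dots> = card {y \<in> W n2. y \<in> C x}"
      unfolding W_def card_words_eq_sum[OF finite_lessThan] M sum_words_Suc ..
    also have "{y \<in> W n2. y \<in> C x} = C x" by (auto simp: C_def)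
    finally show "(\<Sum>y\<in>W M. of_bool (k # y \<in> C x)) \<le> real (card (C x))" .
  qed
  finally have "K ^ M * \<theta> * K ^ n1 \<le> (\<Sum>x\<in>W n1. real (card (C x)))" .
  then have sumC: "K ^ n2 * (\<theta> / K * K ^ n1) \<le> (\<Sum>x\<in>W n1. real (card (C x)))"
    using K by (simp add: M mult_ac)
  define c0 where "c0 = (d - \<gamma>) + (d + \<gamma>) * (\<theta> / K)"
  have "(\<Sum>x\<in>W n1. c0 * K ^ n2) = K ^ n2 * ((d - \<gamma>) * K ^ n1) + (d + \<gamma>) * (K ^ n2 * (\<theta> / K * K ^ n1))"
    by (simp add: cW c0_def algebra_simps)
  also have "\<dots> \<le> (\<Sum>x\<in>W n1. card (A' x) + (d + \<gamma>) * card (C x))"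
    unfolding sum.distrib sum_distrib_left[symmetric] using d \<gamma>
    by (intro add_mono sumA mult_left_mono sumC) auto
  finally have "\<exists>x\<in>W n1. c0 * K ^ n2 \<le> card (A' x) + (d + \<gamma>) * card (C x)"
  proof (rule contrapos_pp)
    assume neg: "\<not> (\<exists>x\<in>W n1. c0 * K ^ n2 \<le> card (A' x) + (d + \<gamma>) * card (C x))"
    have "W n1 \<noteq> {}" using cW[of n1] K by (metis card.empty of_nat_0 power_not_zero less_numeral_extra(3))
    then have "(\<Sum>x\<in>W n1. card (A' x) + (d + \<gamma>) * card (C x)) < (\<Sum>x\<in>W n1. c0 * K ^ n2)"
      using neg by (intro sum_strict_mono) (auto simp: not_le)
    then show "\<not> (\<Sum>x\<in>W n1. c0 * K ^ n2) \<le> (\<Sum>x\<in>W n1. card (A' x) + (d + \<gamma>) * card (C x))" by simp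
  qed
  then obtain x where x: "x \<in> W n1" "c0 * K ^ n2 \<le> card (A' x) + (d + \<gamma>) * card (C x)" by blast
  have "line_free (Suc k) n2 (A' x)"
  proof -
    have "V @ map Inl x \<in> subspaces (Suc k) n2 (p + n1)"
      using subspace_append_word(1)[OF V', of x n1] x(1) by (simp add: W_def)
    from line_free_subspace[OF A(1) this] show ?thesis by (simp add: A'_def W_def)
  qed
  from line_free_correlation[OF k this sum_le, of "d + \<gamma>"]
  have "card (A' x) + (d + \<gamma>) * card (C x) \<le> (d + \<gamma> + \<gamma>) * K ^ n2 + real k ^ n2"
    using n0[of m] d \<gamma> by (simp add: C_def W_def K_def m_def)
  then have "c0 * K ^ n2 \<le> (d + 3 * \<gamma>) * K ^ n2"
    using x(2) kn2 by (simp add: algebra_simps)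
  then have "c0 \<le> d + 3 * \<gamma>" using K by simp
  moreover have "d * (\<theta> / K) = 8 * \<gamma>" by (simp add: \<gamma>_def)
  moreover have "0 \<le> \<gamma> * (\<theta> / K)" using \<gamma> \<theta> K by simp
  ultimately show False using \<gamma>(1) unfolding c0_def distrib_right by linarith
qed

theorem density_Hales_Jewett: "0 < k \<Longrightarrow> density_HJ k"
proof (induction k)
  case (Suc k)
  show ?case
  proof (cases "k = 0")
    case True
    \<comment> \<open>Over a one-letter alphabet the single word of length 1 is a line.\<close>
    have "[Inr 0] \<in> subspaces (Suc 0) (Suc 0) 1" by (auto simp: subspaces_def)
    moreover have "fill [Inr 0] [0] \<in> A" if "A \<subseteq> words {..<Suc 0} 1" "\<delta> \<le> card A" "0 < \<delta>" for A and \<delta> :: real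
    proof -
      have "A \<noteq> {}" using that by auto
      moreover have "w = [0]" if "w \<in> words {..<Suc 0} 1" for w
        using that by (auto simp: words_def length_Suc_conv)
      ultimately show ?thesis using that(1) by (auto simp: fill_def)
    qed
    ultimately show ?thesis unfolding density_HJ_def True by (intro allI impI exI[of _ 1]) auto
  next
    case False
    then show ?thesis using Suc density_HJ_Suc by simp
  qed
qed simp

section \<open>Markov operators and recurrence\<close>

definition bounded_measurable :: "'m measure \<Rightarrow> ('m \<Rightarrow> real) \<Rightarrow> bool" where
  "bounded_measurable \<mu> f \<longleftrightarrow> f \<in> borel_measurable \<mu> \<and> (\<exists>B. \<forall>x\<in>space \<mu>. \<bar>f x\<bar> \<le> B)"

text \<open>Positivity, linearity and the constant 1 are required pointwise and for arbitrary
  functions, so that integrability and null sets enter only through the last clause, the invariance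
  of \<mu>.\<close>

definition markovian :: "'m measure \<Rightarrow> (('m \<Rightarrow> real) \<Rightarrow> 'm \<Rightarrow> real) \<Rightarrow> bool" where
  "markovian \<mu> P \<longleftrightarrow>
    (\<forall>f g a b. P (\<lambda>x. a * f x + b * g x) = (\<lambda>x. a * P f x + b * P g x)) \<and>
    (\<forall>f g. (\<forall>x\<in>space \<mu>. f x \<le> g x) \<longrightarrow> (\<forall>x\<in>space \<mu>. P f x \<le> P g x)) \<and>
    (\<forall>x\<in>space \<mu>. P (\<lambda>_. 1) x = 1) \<and>
    (\<forall>f\<in>borel_measurable \<mu>. P f \<in> borel_measurable \<mu>) \<and>
    (\<forall>f. bounded_measurable \<mu> f \<longrightarrow> (\<integral>x. P f x \<partial>\<mu>) = (\<integral>x. f x \<partial>\<mu>))"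

lemma markovianD:
  assumes "markovian \<mu> P"
  shows markovian_lincomb: "P (\<lambda>x. a * f x + b * g x) = (\<lambda>x. a * P f x + b * P g x)"
    and markovian_mono: "(\<And>y. y \<in> space \<mu> \<Longrightarrow> f y \<le> g y) \<Longrightarrow> x \<in> space \<mu> \<Longrightarrow> P f x \<le> P g x"
    and markovian_one: "x \<in> space \<mu> \<Longrightarrow> P (\<lambda>_. 1) x = 1"
    and markovian_measurable: "f \<in> borel_measurable \<mu> \<Longrightarrow> P f \<in> borel_measurable \<mu>"
    and markovian_integral: "bounded_measurable \<mu> f \<Longrightarrow> (\<integral>x. P f x \<partial>\<mu>) = (\<integral>x. f x \<partial>\<mu>)"
  using assms unfolding markovian_def by blast+

lemma markovian_scale: "markovian \<mu> P \<Longrightarrow> P (\<lambda>x. a * f x) = (\<lambda>x. a * P f x)"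
  using markovian_lincomb[of \<mu> P a f 0 f] by simp

lemma markovian_add: "markovian \<mu> P \<Longrightarrow> P (\<lambda>x. f x + g x) = (\<lambda>x. P f x + P g x)"
  using markovian_lincomb[of \<mu> P 1 f 1 g] by simp

lemma markovian_zero: "markovian \<mu> P \<Longrightarrow> P (\<lambda>_. 0) = (\<lambda>_. 0)"
  using markovian_scale[of \<mu> P 0 "\<lambda>_. 0"] by simp

lemma markovian_const: "markovian \<mu> P \<Longrightarrow> x \<in> space \<mu> \<Longrightarrow> P (\<lambda>_. c) x = c"
  using markovian_scale[of \<mu> P c "\<lambda>_. 1"] markovian_one[of \<mu> P x] by (simp add: fun_eq_iff)

lemma markovian_sum:
  assumes "markovian \<mu> P" "finite I"
  shows "P (\<lambda>x. \<Sum>i\<in>I. f i x) = (\<lambda>x. \<Sum>i\<in>I. P (f i) x)"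
  using assms(2) by (induction I rule: finite_induct)
    (simp_all add: markovian_zero[OF assms(1)] markovian_add[OF assms(1)])

lemma markovian_nonneg:
  "markovian \<mu> P \<Longrightarrow> (\<And>y. y \<in> space \<mu> \<Longrightarrow> 0 \<le> f y) \<Longrightarrow> x \<in> space \<mu> \<Longrightarrow> 0 \<le> P f x"
  using markovian_mono[of \<mu> P "\<lambda>_. 0" f x] by (simp add: markovian_zero)

lemma markovian_le_const:
  "markovian \<mu> P \<Longrightarrow> (\<And>y. y \<in> space \<mu> \<Longrightarrow> f y \<le> c) \<Longrightarrow> x \<in> space \<mu> \<Longrightarrow> P f x \<le> c"
  using markovian_mono[of \<mu> P f "\<lambda>_. c" x] by (simp add: markovian_const)

lemma bounded_measurableI:
  "f \<in> borel_measurable \<mu> \<Longrightarrow> (\<And>x. x \<in> space \<mu> \<Longrightarrow> \<bar>f x\<bar> \<le> B) \<Longrightarrow> bounded_measurable \<mu> f"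
  unfolding bounded_measurable_def by blast

lemma markovian_bounded_measurable:
  assumes P: "markovian \<mu> P" and f: "bounded_measurable \<mu> f"
  shows "bounded_measurable \<mu> (P f)"
proof -
  obtain B where B: "\<And>x. x \<in> space \<mu> \<Longrightarrow> \<bar>f x\<bar> \<le> B" using f by (auto simp: bounded_measurable_def)
  have "\<bar>P f x\<bar> \<le> B" if "x \<in> space \<mu>" for x
  proof -
    have "P f x \<le> B" using B by (intro markovian_le_const[OF P _ that]) (auto simp: abs_le_iff)
    moreover have "P (\<lambda>x. - 1 * f x) x \<le> B" using B by (intro markovian_le_const[OF P _ that]) (force simp: abs_le_iff)
    ultimately show ?thesis unfolding markovian_scale[OF P] by simp
  qed
  then show ?thesis
    using f markovian_measurable[OF P] by (intro bounded_measurableI) (auto simp: bounded_measurable_def)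
qed

lemma markovian_id: "markovian \<mu> (\<lambda>f. f)"
  by (simp add: markovian_def)

lemma markovian_comp:
  assumes P: "markovian \<mu> P" and Q: "markovian \<mu> Q"
  shows "markovian \<mu> (\<lambda>f. P (Q f))"
  unfolding markovian_def
proof (intro conjI allI ballI impI)
  show "P (Q (\<lambda>x. a * f x + b * g x)) = (\<lambda>x. a * P (Q f) x + b * P (Q g) x)" for f g a b
    by (simp only: markovian_lincomb[OF P] markovian_lincomb[OF Q])
  show "P (Q f) x \<le> P (Q g) x" if "\<forall>x\<in>space \<mu>. f x \<le> g x" "x \<in> space \<mu>" for f g x
    using that by (intro markovian_mono[OF P] markovian_mono[OF Q]) auto
  show "P (Q (\<lambda>_. 1)) x = 1" if "x \<in> space \<mu>" for x
    using markovian_mono[OF P, of "Q (\<lambda>_. 1)" "\<lambda>_. 1" x] markovian_mono[OF P, of "\<lambda>_. 1" "Q (\<lambda>_. 1)" x]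
      markovian_one[OF P] markovian_one[OF Q] that by force
  show "P (Q f) \<in> borel_measurable \<mu>" if "f \<in> borel_measurable \<mu>" for f
    using that by (intro markovian_measurable[OF P] markovian_measurable[OF Q])
  show "(\<integral>x. P (Q f) x \<partial>\<mu>) = (\<integral>x. f x \<partial>\<mu>)" if "bounded_measurable \<mu> f" for f
    using markovian_integral[OF P markovian_bounded_measurable[OF Q that]] markovian_integral[OF Q that] by simp
qed

lemma markovian_funpow: "markovian \<mu> P \<Longrightarrow> markovian \<mu> (P ^^ n)"
proof (induction n)
  case 0
  then show ?case using markovian_id by (simp add: id_def)
next
  case (Suc n)
  then show ?case using markovian_comp[of \<mu> P "P ^^ n"] by (simp add: comp_def)
qed

section \<open>Variance of a Markov operator\<close>

text \<open>The variance of \<open>h\<close> at the random end point of a step from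
  \<open>x\<close>; see \<open>op_var_eq\<close>.\<close>

definition op_var :: "(('m \<Rightarrow> real) \<Rightarrow> 'm \<Rightarrow> real) \<Rightarrow> ('m \<Rightarrow> real) \<Rightarrow> 'm \<Rightarrow> real" where
  "op_var P h x = P (\<lambda>y. (h y)\<^sup>2) x - (P h x)\<^sup>2"

lemma op_var_eq:
  assumes P: "markovian \<mu> P" and x: "x \<in> space \<mu>"
  shows "op_var P h x = P (\<lambda>y. (h y - P h x)\<^sup>2) x"
proof -
  define c where "c = P h x"
  have "P (\<lambda>y. (h y - c)\<^sup>2) = P (\<lambda>y. 1 * (h y)\<^sup>2 + 1 * (- 2 * c * h y + c\<^sup>2 * 1))"
    by (simp add: power2_diff algebra_simps)
  also have "\<dots> = (\<lambda>x. 1 * P (\<lambda>y. (h y)\<^sup>2) x + 1 * (- 2 * c * P h x + c\<^sup>2 * P (\<lambda>_. 1) x))"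
    by (simp only: markovian_lincomb[OF P])
  finally have "P (\<lambda>y. (h y - c)\<^sup>2) x = P (\<lambda>y. (h y)\<^sup>2) x - 2 * c * P h x + c\<^sup>2"
    using markovian_one[OF P x] by simp
  then show ?thesis by (simp add: op_var_def c_def power2_eq_square)
qed

lemma op_var_nonneg: "markovian \<mu> P \<Longrightarrow> x \<in> space \<mu> \<Longrightarrow> 0 \<le> op_var P h x"
  by (simp add: op_var_eq markovian_nonneg)

lemma op_chebyshev:
  assumes P: "markovian \<mu> P" and x: "x \<in> space \<mu>" and t: "0 < t" and h: "2 * t \<le> P h x"
  shows "P (\<lambda>y. of_bool (h y \<le> t)) x \<le> op_var P h x / t\<^sup>2"
proof -
  define c where "c = P h x"
  have "t\<^sup>2 * P (\<lambda>y. of_bool (h y \<le> t)) x = P (\<lambda>y. t\<^sup>2 * of_bool (h y \<le> t)) x"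
    by (simp only: markovian_scale[OF P])
  also have "\<dots> \<le> P (\<lambda>y. (h y - c)\<^sup>2) x"
  proof (rule markovian_mono[OF P _ x])
    fix y
    have "t\<^sup>2 \<le> (c - h y)\<^sup>2" if "h y \<le> t"
      using that t h by (intro power_mono) (auto simp: c_def)
    then show "t\<^sup>2 * of_bool (h y \<le> t) \<le> (h y - c)\<^sup>2" by (auto simp: of_bool_def power2_commute)
  qed
  also have "\<dots> = op_var P h x" by (simp add: op_var_eq[OF P x] c_def)
  finally show ?thesis using t by (simp add: field_simps)
qed

lemma bounded_measurable_intros:
  shows bounded_measurable_add: "bounded_measurable \<mu> f \<Longrightarrow> bounded_measurable \<mu> g \<Longrightarrow> bounded_measurable \<mu> (\<lambda>x. f x + g x)"
    and bounded_measurable_mult: "bounded_measurable \<mu> f \<Longrightarrow> bounded_measurable \<mu> g \<Longrightarrow> bounded_measurable \<mu> (\<lambda>x. f x * g x)"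
    and bounded_measurable_const: "bounded_measurable \<mu> (\<lambda>_. c)"
proof -
  show "bounded_measurable \<mu> (\<lambda>x. f x + g x)" if fg: "bounded_measurable \<mu> f" "bounded_measurable \<mu> g"
  proof -
    obtain B C where "\<And>x. x \<in> space \<mu> \<Longrightarrow> \<bar>f x\<bar> \<le> B" "\<And>x. x \<in> space \<mu> \<Longrightarrow> \<bar>g x\<bar> \<le> C"
      using fg by (auto simp: bounded_measurable_def)
    then have "\<bar>f x + g x\<bar> \<le> B + C" if "x \<in> space \<mu>" for x using that by (smt (verit))
    then show ?thesis using fg by (intro bounded_measurableI) (auto simp: bounded_measurable_def)
  qed
  show "bounded_measurable \<mu> (\<lambda>x. f x * g x)" if fg: "bounded_measurable \<mu> f" "bounded_measurable \<mu> g"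
  proof -
    obtain B C where "\<And>x. x \<in> space \<mu> \<Longrightarrow> \<bar>f x\<bar> \<le> B" "\<And>x. x \<in> space \<mu> \<Longrightarrow> \<bar>g x\<bar> \<le> C"
      using fg by (auto simp: bounded_measurable_def)
    then have "\<bar>f x * g x\<bar> \<le> B * C" if "x \<in> space \<mu>" for x
      using that unfolding abs_mult by (intro mult_mono) (auto intro: order_trans[OF abs_ge_zero])
    then show ?thesis using fg by (intro bounded_measurableI) (auto simp: bounded_measurable_def)
  qed
  show "bounded_measurable \<mu> (\<lambda>_. c)" by (intro bounded_measurableI[of _ _ "\<bar>c\<bar>"]) auto
qed

lemma bounded_measurable_power2: "bounded_measurable \<mu> f \<Longrightarrow> bounded_measurable \<mu> (\<lambda>x. (f x)\<^sup>2)"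
  unfolding power2_eq_square by (rule bounded_measurable_mult)

lemma bounded_measurable_op_var:
  assumes "markovian \<mu> P" "bounded_measurable \<mu> h"
  shows "bounded_measurable \<mu> (op_var P h)"
proof -
  have "bounded_measurable \<mu> (\<lambda>x. P (\<lambda>y. (h y)\<^sup>2) x + (- 1) * (P h x)\<^sup>2)"
    by (rule bounded_measurable_add[OF _ bounded_measurable_mult[OF bounded_measurable_const]])
      (rule markovian_bounded_measurable[OF assms(1)] bounded_measurable_power2 assms(2))+
  then show ?thesis by (simp add: op_var_def[abs_def])
qed

context prob_space
begin

lemma integrable_bounded_measurable: "bounded_measurable M f \<Longrightarrow> integrable M f"
  by (auto simp: bounded_measurable_def intro!: integrable_const_bound AE_I2)

text \<open>By invariance, the mean variance is exactly the loss of squared norm. Almost constant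
  norms thus force small variances.\<close>

lemma integral_op_var:
  assumes P: "markovian M P" and h: "bounded_measurable M h"
  shows "(\<integral>x. op_var P h x \<partial>M) = (\<integral>x. (h x)\<^sup>2 \<partial>M) - (\<integral>x. (P h x)\<^sup>2 \<partial>M)"
proof -
  have h2: "bounded_measurable M (\<lambda>x. (h x)\<^sup>2)" by (rule bounded_measurable_power2[OF h])
  have "integrable M (P (\<lambda>y. (h y)\<^sup>2))" "integrable M (\<lambda>x. (P h x)\<^sup>2)"
    using markovian_bounded_measurable[OF P h2] bounded_measurable_power2[OF markovian_bounded_measurable[OF P h]]
    by (auto intro: integrable_bounded_measurable)
  then show ?thesis
    unfolding op_var_def by (simp add: markovian_integral[OF P h2])
qed

lemma integral_power2_markovian_le:
  assumes P: "markovian M P" and h: "bounded_measurable M h"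
  shows "(\<integral>x. (P h x)\<^sup>2 \<partial>M) \<le> (\<integral>x. (h x)\<^sup>2 \<partial>M)"
proof -
  have "0 \<le> (\<integral>x. op_var P h x \<partial>M)" by (intro Bochner_Integration.integral_nonneg op_var_nonneg[OF P]) auto
  then show ?thesis by (simp add: integral_op_var[OF P h])
qed

end

section \<open>A commuting pair of operators\<close>

locale commuting_markovian = prob_space \<mu> for \<mu> :: "'m measure" +
  fixes P1 P2 :: "('m \<Rightarrow> real) \<Rightarrow> 'm \<Rightarrow> real" and A :: "'m set"
  assumes P1: "markovian \<mu> P1" and P2: "markovian \<mu> P2" and commute: "P1 (P2 f) = P2 (P1 f)"
    and A: "A \<in> sets \<mu>" "measure \<mu> A > 0"
begin

definition Pz :: "nat \<Rightarrow> nat \<Rightarrow> ('m \<Rightarrow> real) \<Rightarrow> 'm \<Rightarrow> real" where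
  "Pz a b f = (P1 ^^ a) ((P2 ^^ b) f)"

lemma markovian_Pz: "markovian \<mu> (Pz a b)"
  using markovian_comp[OF markovian_funpow[OF P1] markovian_funpow[OF P2]] by (simp add: Pz_def[abs_def])

lemma P1_P2_pow: "P1 ((P2 ^^ b) f) = (P2 ^^ b) (P1 f)"
  by (induction b arbitrary: f) (simp_all add: commute)

lemma P1_pow_P2_pow: "(P1 ^^ a) ((P2 ^^ b) f) = (P2 ^^ b) ((P1 ^^ a) f)"
  by (induction a arbitrary: f) (simp_all add: P1_P2_pow)

lemma Pz_Pz: "Pz a b (Pz c d f) = Pz (a + c) (b + d) f"
  unfolding Pz_def by (simp add: funpow_add P1_pow_P2_pow)

definition dens :: "nat \<Rightarrow> nat \<Rightarrow> 'm \<Rightarrow> real" where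
  "dens a b = Pz a b (indicator A)"

lemma Pz_dens: "Pz a b (dens c d) = dens (a + c) (b + d)"
  by (simp add: dens_def Pz_Pz)

lemma dens_0: "dens 0 0 = indicator A"
  by (simp add: dens_def Pz_def)

lemma bounded_measurable_indicator: "S \<in> sets \<mu> \<Longrightarrow> bounded_measurable \<mu> (indicator S :: 'm \<Rightarrow> real)"
  by (intro bounded_measurableI[of _ _ 1]) auto

lemma bounded_measurable_dens: "bounded_measurable \<mu> (dens a b)"
  unfolding dens_def by (intro markovian_bounded_measurable[OF markovian_Pz] bounded_measurable_indicator A)

lemma dens_measurable [measurable]: "dens a b \<in> borel_measurable \<mu>"
  using bounded_measurable_dens by (auto simp: bounded_measurable_def)

lemma dens_le_1: "x \<in> space \<mu> \<Longrightarrow> dens a b x \<le> 1"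
  unfolding dens_def by (auto intro!: markovian_le_const[OF markovian_Pz])

lemma integral_dens: "(\<integral>x. dens a b x \<partial>\<mu>) = measure \<mu> A"
  unfolding dens_def using A
  by (simp add: markovian_integral[OF markovian_Pz bounded_measurable_indicator])

definition energy :: "nat \<Rightarrow> nat \<Rightarrow> real" where
  "energy a b = (\<integral>x. (dens a b x)\<^sup>2 \<partial>\<mu>)"

lemma energy_nonneg: "0 \<le> energy a b"
  by (simp add: energy_def)

lemma energy_antimono: "energy (a + c) (b + d) \<le> energy a b"
  unfolding energy_def add.commute[of a] add.commute[of b] Pz_dens[symmetric]
  by (rule integral_power2_markovian_le[OF markovian_Pz bounded_measurable_dens])

lemma energy_antimono': "a \<le> a' \<Longrightarrow> b \<le> b' \<Longrightarrow> energy a' b' \<le> energy a b"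
  using energy_antimono[of a "a' - a" b "b' - b"] by simp

text \<open>The indices may be one less than \<open>n\<close>, because the first step of a tree
  branch, with its prescribed direction, is split off and leaves exponents such as
  \<open>n * u1 - 1\<close>.\<close>

definition stable :: "real \<Rightarrow> nat \<Rightarrow> bool" where
  "stable \<epsilon> n \<longleftrightarrow> (\<forall>a b c d. n \<le> Suc a \<longrightarrow> n \<le> Suc b \<longrightarrow> energy a b - energy (a + c) (b + d) \<le> \<epsilon>)"

lemma integral_op_var_dens_le:
  assumes "stable \<epsilon> n" "n \<le> Suc c" "n \<le> Suc d"
  shows "(\<integral>x. op_var (Pz a b) (dens c d) x \<partial>\<mu>) \<le> \<epsilon>"
  using assms(1)[unfolded stable_def, rule_format, OF assms(2,3), of a b]
  unfolding integral_op_var[OF markovian_Pz bounded_measurable_dens] Pz_dens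
  by (simp add: energy_def[symmetric] add.commute)

lemma stable_mono: "stable \<epsilon> n \<Longrightarrow> \<epsilon> \<le> \<epsilon>' \<Longrightarrow> stable \<epsilon>' n"
  unfolding stable_def by (meson order_trans)

lemma eventually_stable:
  assumes "0 < \<epsilon>"
  shows "\<exists>s. \<forall>n>s. stable \<epsilon> n"
proof -
  have bdd: "bdd_below (range (\<lambda>(a, b). energy a b))"
    using energy_nonneg by (intro bdd_belowI[of _ 0]) auto
  define I where "I = Inf (range (\<lambda>(a, b). energy a b))"
  have I: "I \<le> energy a b" for a b
    unfolding I_def by (rule cInf_lower[OF _ bdd]) auto
  obtain a b where ab: "energy a b < I + \<epsilon>"
    using cInf_lessD[of "range (\<lambda>(a, b). energy a b)" "I + \<epsilon>"] assms by (auto simp: I_def)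
  have "stable \<epsilon> n" if "n > max a b" for n
    unfolding stable_def
  proof (intro allI impI)
    fix a' b' c d assume "n \<le> Suc a'" "n \<le> Suc b'"
    then have "energy a' b' \<le> energy a b" using that by (intro energy_antimono') auto
    then show "energy a' b' - energy (a' + c) (b' + d) \<le> \<epsilon>" using ab I[of "a' + c" "b' + d"] by linarith
  qed
  then show ?thesis by blast
qed

end

section \<open>Multiple recurrence\<close>

definition active_count :: "(nat + nat) list \<Rightarrow> nat" where
  "active_count S = length (filter (\<lambda>e. \<not> isl e) S)"

lemma active_count_pos: "S \<in> subspaces k (Suc 0) n \<Longrightarrow> 0 < active_count S"
proof -
  assume "S \<in> subspaces k (Suc 0) n"
  then have "Inr 0 \<in> set S" by (auto simp: subspaces_def)
  then have "Inr 0 \<in> set (filter (\<lambda>e. \<not> isl e) S)" by simp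
  then show ?thesis unfolding active_count_def by (rule length_pos_if_in_set)
qed

text \<open>Along a line the letter sums form the pattern \<open>g\<close> scaled by the number of
  active coordinates and shifted by the fixed letters.\<close>

lemma sum_list_fill_line:
  fixes g :: "nat \<Rightarrow> nat"
  assumes "S \<in> subspaces k (Suc 0) n"
  shows "(\<Sum>a\<leftarrow>fill S [i]. g a) = (\<Sum>e\<leftarrow>S. case_sum g (\<lambda>_. 0) e) + active_count S * g i"
proof -
  have "set S \<subseteq> range Inl \<union> {Inr 0}" using assms by (auto elim!: subspaces_entryE)
  then show ?thesis
    by (induction S) (auto simp: fill_def active_count_def)
qed

context commuting_markovian
begin

lemma integrable_of_bool: "{x \<in> space \<mu>. Q x} \<in> sets \<mu> \<Longrightarrow> integrable \<mu> (\<lambda>x. of_bool (Q x) :: real)"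
  and integral_of_bool: "{x \<in> space \<mu>. Q x} \<in> sets \<mu> \<Longrightarrow> (\<integral>x. of_bool (Q x) \<partial>\<mu>) = measure \<mu> {x \<in> space \<mu>. Q x}"
proof -
  assume Q: "{x \<in> space \<mu>. Q x} \<in> sets \<mu>"
  have eq: "(of_bool (Q x) :: real) = indicator {x \<in> space \<mu>. Q x} x" if "x \<in> space \<mu>" for x
    using that by (auto simp: indicator_def)
  have "integrable \<mu> (indicator {x \<in> space \<mu>. Q x} :: 'm \<Rightarrow> real)"
    using Q by (simp add: integrable_bounded_measurable bounded_measurable_indicator)
  then show "integrable \<mu> (\<lambda>x. of_bool (Q x) :: real)"
    using Bochner_Integration.integrable_cong[of \<mu> \<mu> "\<lambda>x. of_bool (Q x) :: real" "indicator {x \<in> space \<mu>. Q x}"] eq by auto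
  have "(\<integral>x. of_bool (Q x) \<partial>\<mu>) = (\<integral>x. indicator {x \<in> space \<mu>. Q x} x \<partial>\<mu>)"
    using eq by (intro Bochner_Integration.integral_cong) auto
  also have "\<dots> = measure \<mu> {x \<in> space \<mu>. Q x}"
    using Q sets.sets_into_space[OF Q] by (simp add: Int_absorb2)
  finally show "(\<integral>x. of_bool (Q x) \<partial>\<mu>) = measure \<mu> {x \<in> space \<mu>. Q x}" .
qed

text \<open>Each density function has mean \<open>measure \<mu> A\<close>, so a point typically sees
  a dense set of words at which it is large, and this set contains a line. There are finitely many
  lines, so one of them works on a set of measure at least \<open>c\<close>. That \<open>c\<close>
  does not depend on the exponents is needed later, when they are chosen in terms of the
  tolerance.\<close>

lemma recurrence_line:
  assumes k: "0 < k"
  shows "\<exists>c>0. \<forall>g1 g2 s. \<exists>S n. S \<in> subspaces k (Suc 0) n \<and>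
    c \<le> measure \<mu> {x \<in> space \<mu>. \<forall>i<k. measure \<mu> A / 2 < dens (s + (\<Sum>a\<leftarrow>fill S [i]. g1 a)) (s + (\<Sum>a\<leftarrow>fill S [i]. g2 a)) x}"
proof -
  define d where "d = measure \<mu> A"
  have d: "0 < d" using A by (simp add: d_def)
  obtain n where n: "\<And>B. B \<subseteq> words {..<k} n \<Longrightarrow> d / 4 * real k ^ n \<le> real (card B) \<Longrightarrow>
     \<exists>S\<in>subspaces k (Suc 0) n. \<forall>i<k. fill S [i] \<in> B"
    using density_Hales_Jewett[OF k] d unfolding density_HJ_def by (metis divide_pos_pos zero_less_numeral)
  define L where "L = subspaces k (Suc 0) n"
  have fL: "finite L" by (simp add: L_def)
  define c where "c = d / 4 / Suc (card L)"
  have c: "0 < c" using d by (simp add: c_def)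
  have "\<exists>S\<in>L. c \<le> measure \<mu> {x \<in> space \<mu>. \<forall>i<k. d / 2 < dens (s + (\<Sum>a\<leftarrow>fill S [i]. g1 a)) (s + (\<Sum>a\<leftarrow>fill S [i]. g2 a)) x}" for g1 g2 s
  proof -
    define H where "H w = dens (s + (\<Sum>a\<leftarrow>w. g1 a)) (s + (\<Sum>a\<leftarrow>w. g2 a))" for w
    define W where "W = words {..<k} n"
    have W: "finite W" "real (card W) = real k ^ n" by (auto simp: W_def)
    have [measurable]: "H w \<in> borel_measurable \<mu>" for w by (simp add: H_def)
    define E where "E S = {x \<in> space \<mu>. \<forall>i<k. d / 2 < H (fill S [i]) x}" for S
    have E: "E S \<in> sets \<mu>" for S unfolding E_def by measurable
    \<comment> \<open>Points with a dense set of good words lie in some \<open>E S\<close>; for the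
      others the sum is at most the last term.\<close>
    have hit: "(\<Sum>w\<in>W. of_bool (d / 2 < H w x)) \<le> real k ^ n * (\<Sum>S\<in>L. of_bool (x \<in> E S)) + d / 4 * real k ^ n"
      if x: "x \<in> space \<mu>" for x
    proof (cases "d / 4 * real k ^ n \<le> real (card {w \<in> W. d / 2 < H w x})")
      case True
      then obtain S where S: "S \<in> L" "\<And>i. i < k \<Longrightarrow> d / 2 < H (fill S [i]) x"
        using n[of "{w \<in> W. d / 2 < H w x}"] by (auto simp: L_def W_def)
      have "1 = (of_bool (x \<in> E S) :: real)" using S x by (simp add: E_def)
      also have "\<dots> \<le> (\<Sum>S\<in>L. of_bool (x \<in> E S))"
        using S(1) fL by (intro member_le_sum) auto
      finally have "real k ^ n * 1 \<le> real k ^ n * (\<Sum>S\<in>L. of_bool (x \<in> E S))"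
        by (intro mult_left_mono) auto
      moreover have "(\<Sum>w\<in>W. of_bool (d / 2 < H w x)) \<le> real k ^ n"
        using W(2) sum_mono[of W "\<lambda>w. of_bool (d / 2 < H w x)" "\<lambda>_. 1 :: real"] by simp
      moreover have "0 \<le> d / 4 * real k ^ n" using d by simp
      ultimately show ?thesis by linarith
    next
      case False
      then have "(\<Sum>w\<in>W. of_bool (d / 2 < H w x)) \<le> d / 4 * real k ^ n"
        using card_words_eq_sum[of "{..<k}" n "\<lambda>w. d / 2 < H w x"] by (simp add: W_def)
      moreover have "0 \<le> real k ^ n * (\<Sum>S\<in>L. of_bool (x \<in> E S) :: real)"
        by (intro mult_nonneg_nonneg sum_nonneg) auto
      ultimately show ?thesis by linarith
    qed
    have "d / 2 * real k ^ n = (\<Sum>w\<in>W. d - d / 2)"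
      using W by simp
    also have "\<dots> \<le> (\<Sum>w\<in>W. measure \<mu> {x \<in> space \<mu>. d / 2 < H w x})"
    proof (intro sum_mono)
      fix w
      have "(\<integral>x. H w x \<partial>\<mu>) \<le> (\<integral>x. of_bool (d / 2 < H w x) + d / 2 \<partial>\<mu>)"
      proof (rule integral_mono)
        show "integrable \<mu> (H w)" unfolding H_def by (intro integrable_bounded_measurable bounded_measurable_dens)
        show "integrable \<mu> (\<lambda>x. of_bool (d / 2 < H w x) + d / 2)"
          by (intro Bochner_Integration.integrable_add integrable_of_bool) auto
        show "H w x \<le> of_bool (d / 2 < H w x) + d / 2" if "x \<in> space \<mu>" for x
          using dens_le_1[OF that] d by (auto simp: H_def of_bool_def intro: add_increasing2)
      qed
      also have "\<dots> = measure \<mu> {x \<in> space \<mu>. d / 2 < H w x} + d / 2"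
        by (subst Bochner_Integration.integral_add) (auto intro!: integrable_of_bool simp: integral_of_bool prob_space)
      also have "(\<integral>x. H w x \<partial>\<mu>) = d" by (simp add: H_def integral_dens d_def)
      finally show "d - d / 2 \<le> measure \<mu> {x \<in> space \<mu>. d / 2 < H w x}" by simp
    qed
    also have "\<dots> = (\<integral>x. (\<Sum>w\<in>W. of_bool (d / 2 < H w x)) \<partial>\<mu>)"
      by (subst Bochner_Integration.integral_sum) (auto intro!: integrable_of_bool simp: integral_of_bool)
    also have "\<dots> \<le> (\<integral>x. real k ^ n * (\<Sum>S\<in>L. of_bool (x \<in> E S)) + d / 4 * real k ^ n \<partial>\<mu>)"
    proof (rule integral_mono)
      show "integrable \<mu> (\<lambda>x. \<Sum>w\<in>W. of_bool (d / 2 < H w x) :: real)"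
        by (intro Bochner_Integration.integrable_sum integrable_of_bool) auto
      show "integrable \<mu> (\<lambda>x. real k ^ n * (\<Sum>S\<in>L. of_bool (x \<in> E S)) + d / 4 * real k ^ n)"
        using E by (intro Bochner_Integration.integrable_add integrable_mult_right Bochner_Integration.integrable_sum integrable_of_bool) auto
    qed (rule hit)
    also have "\<dots> = real k ^ n * (\<Sum>S\<in>L. measure \<mu> (E S)) + d / 4 * real k ^ n"
    proof -
      have ES: "{x \<in> space \<mu>. x \<in> E S} = E S" for S by (auto simp: E_def)
      have i: "integrable \<mu> (\<lambda>x. of_bool (x \<in> E S) :: real)" for S
        using E by (intro integrable_of_bool) (simp add: ES)
      have "(\<integral>x. real k ^ n * (\<Sum>S\<in>L. of_bool (x \<in> E S)) + d / 4 * real k ^ n \<partial>\<mu>) =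
          (\<integral>x. real k ^ n * (\<Sum>S\<in>L. of_bool (x \<in> E S)) \<partial>\<mu>) + (\<integral>x. d / 4 * real k ^ n \<partial>\<mu>)"
        by (intro Bochner_Integration.integral_add integrable_mult_right Bochner_Integration.integrable_sum i) auto
      also have "(\<integral>x. real k ^ n * (\<Sum>S\<in>L. of_bool (x \<in> E S)) \<partial>\<mu>) = real k ^ n * (\<integral>x. (\<Sum>S\<in>L. of_bool (x \<in> E S)) \<partial>\<mu>)"
        by simp
      also have "(\<integral>x. (\<Sum>S\<in>L. of_bool (x \<in> E S)) \<partial>\<mu>) = (\<Sum>S\<in>L. measure \<mu> (E S))"
        using E by (subst Bochner_Integration.integral_sum) (auto simp: i integral_of_bool ES)
      finally show ?thesis by (simp add: prob_space)
    qed
    finally have "real k ^ n * (d / 4) \<le> real k ^ n * (\<Sum>S\<in>L. measure \<mu> (E S))"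
      by (simp add: algebra_simps)
    then have sum: "d / 4 \<le> (\<Sum>S\<in>L. measure \<mu> (E S))" using k by simp
    have "\<exists>S\<in>L. c \<le> measure \<mu> (E S)"
    proof (rule ccontr)
      assume "\<not> ?thesis"
      then have "(\<Sum>S\<in>L. measure \<mu> (E S)) \<le> (\<Sum>S\<in>L. c)" by (intro sum_mono) force
      also have "\<dots> < Suc (card L) * c" using c by simp
      also have "\<dots> = d / 4" unfolding c_def by (simp del: of_nat_Suc)
      finally show False using sum by simp
    qed
    then show ?thesis by (simp add: E_def H_def)
  qed
  then show ?thesis using c unfolding L_def d_def by blast
qed

text \<open>A line gives large values at exponents \<open>z + n * G i\<close>, that is, large means
  under \<open>Q\<close> of the functions \<open>h i\<close>. As their variance under
  \<open>Q\<close> is small, a random point reached by \<open>Q\<close> lies in \<open>A\<close> and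
  has all \<open>h i\<close> large at once with probability bounded below. Invariance of \<mu> under
  \<open>Q\<close> then removes \<open>z\<close>. The index \<open>i0\<close> is responsible for
  membership in \<open>A\<close>.\<close>

lemma recurrence:
  fixes G :: "nat \<Rightarrow> nat \<times> nat"
  assumes G: "\<And>i. i < k \<Longrightarrow> G i = (0, 0) \<or> 0 < fst (G i) \<and> 0 < snd (G i)" and i0: "i0 < k" "G i0 = (0, 0)"
  shows "\<exists>c>0. \<forall>\<epsilon>>0. \<exists>n>0. stable \<epsilon> n \<and> c \<le> measure \<mu> {x \<in> space \<mu>. x \<in> A \<and>
    (\<forall>i<k. G i \<noteq> (0, 0) \<longrightarrow> measure \<mu> A / 4 < dens (n * fst (G i)) (n * snd (G i)) x)}"
proof -
  define d where "d = measure \<mu> A"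
  have d: "0 < d" using A by (simp add: d_def)
  have k: "0 < k" using i0 by simp
  obtain c where c: "0 < c" "\<And>g1 g2 s. \<exists>S n. S \<in> subspaces k (Suc 0) n \<and>
    c \<le> measure \<mu> {x \<in> space \<mu>. \<forall>i<k. d / 2 < dens (s + (\<Sum>a\<leftarrow>fill S [i]. g1 a)) (s + (\<Sum>a\<leftarrow>fill S [i]. g2 a)) x}"
    using recurrence_line[OF k] unfolding d_def by blast
  have "\<exists>n>0. stable \<epsilon> n \<and> d / 4 * c \<le> measure \<mu> {x \<in> space \<mu>. x \<in> A \<and>
    (\<forall>i<k. G i \<noteq> (0, 0) \<longrightarrow> d / 4 < dens (n * fst (G i)) (n * snd (G i)) x)}" if \<epsilon>: "0 < \<epsilon>" for \<epsilon>
  proof -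
    \<comment> \<open>Chosen so that the total Chebyshev loss, at most
      \<open>k * e * 16 / d\<^sup>2\<close>, takes no more than half of the main term
      \<open>d / 2 * c\<close>.\<close>
    define e where "e = min \<epsilon> (d ^ 3 * c / (64 * k))"
    have e: "0 < e" "e \<le> \<epsilon>" "k * e * 16 / d\<^sup>2 \<le> d / 4 * c"
    proof -
      show "0 < e" "e \<le> \<epsilon>" using \<epsilon> d c k by (auto simp: e_def)
      have "e \<le> d ^ 3 * c / (64 * k)" by (simp add: e_def)
      then have "k * e * 16 / d\<^sup>2 \<le> k * (d ^ 3 * c / (64 * k)) * 16 / d\<^sup>2"
        by (intro divide_right_mono mult_right_mono mult_left_mono) auto
      also have "\<dots> = d / 4 * c" using d k by (simp add: field_simps power2_eq_square power3_eq_cube)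
      finally show "k * e * 16 / d\<^sup>2 \<le> d / 4 * c" .
    qed
    obtain s where s: "\<And>n. n > s \<Longrightarrow> stable e n" using eventually_stable[OF e(1)] by blast
    define g1 where "g1 a = Suc s * fst (G a)" for a
    define g2 where "g2 a = Suc s * snd (G a)" for a
    obtain S N where S: "S \<in> subspaces k (Suc 0) N" and
      cE: "c \<le> measure \<mu> {x \<in> space \<mu>. \<forall>i<k. d / 2 < dens (s + (\<Sum>a\<leftarrow>fill S [i]. g1 a)) (s + (\<Sum>a\<leftarrow>fill S [i]. g2 a)) x}"
      using c(2) by blast
    \<comment> \<open>The active coordinates scale the pattern, and the factor \<open>Suc s\<close>
      in \<open>g1\<close> and \<open>g2\<close> pushes \<open>n\<close> beyond the threshold for
      stability.\<close>
    define n where "n = active_count S * Suc s"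
    have "1 * Suc s \<le> n" using active_count_pos[OF S] unfolding n_def by (intro mult_le_mono1) simp
    then have n: "s < n" "0 < n" by simp_all
    define z1 where "z1 = s + (\<Sum>e\<leftarrow>S. case_sum g1 (\<lambda>_. 0) e)"
    define z2 where "z2 = s + (\<Sum>e\<leftarrow>S. case_sum g2 (\<lambda>_. 0) e)"
    define Q where "Q = Pz z1 z2"
    have Q: "markovian \<mu> Q" by (simp add: Q_def markovian_Pz)
    define h where "h i = dens (n * fst (G i)) (n * snd (G i))" for i
    have h: "bounded_measurable \<mu> (h i)" and [measurable]: "h i \<in> borel_measurable \<mu>" for i
      by (simp_all add: h_def bounded_measurable_dens)
    have Qh: "dens (s + (\<Sum>a\<leftarrow>fill S [i]. g1 a)) (s + (\<Sum>a\<leftarrow>fill S [i]. g2 a)) = Q (h i)" for i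
    proof -
      have "s + (\<Sum>a\<leftarrow>fill S [i]. g1 a) = z1 + n * fst (G i)" "s + (\<Sum>a\<leftarrow>fill S [i]. g2 a) = z2 + n * snd (G i)"
        unfolding sum_list_fill_line[OF S] z1_def z2_def n_def g1_def[of i] g2_def[of i] by (simp_all only: mult.assoc add.assoc)
      then show ?thesis by (simp only: Q_def h_def Pz_dens)
    qed
    define E where "E = {x \<in> space \<mu>. \<forall>i<k. d / 2 < Q (h i) x}"
    have Qh_meas [measurable]: "Q (h i) \<in> borel_measurable \<mu>" for i by (rule markovian_measurable[OF Q]) simp
    have E: "E \<in> sets \<mu>" "c \<le> measure \<mu> E"
      using cE unfolding E_def Qh by auto
    define J where "J = {i. i < k \<and> G i \<noteq> (0, 0)}"
    have J: "finite J" "card J \<le> k" 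
      using card_mono[of "{..<k}" J] by (auto simp: J_def)
    define R where "R = {x \<in> space \<mu>. x \<in> A \<and> (\<forall>i<k. G i \<noteq> (0, 0) \<longrightarrow> d / 4 < h i x)}"
    have R: "R \<in> sets \<mu>" unfolding R_def using A(1) by measurable
    have h_i0: "h i0 = indicator A" by (simp add: h_def i0 dens_0)
    have point: "of_bool (x \<in> E) * (d / 2) - (\<Sum>i\<in>J. op_var Q (h i) x * (16 / d\<^sup>2)) \<le> Q (indicator R) x"
      if x: "x \<in> space \<mu>" for x
    proof (cases "x \<in> E")
      case True
      have "Q (h i0) x \<le> Q (\<lambda>y. indicator R y + (\<Sum>i\<in>J. of_bool (h i y \<le> d / 4))) x"
      proof (rule markovian_mono[OF Q _ x])
        fix y assume y: "y \<in> space \<mu>"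
        show "h i0 y \<le> indicator R y + (\<Sum>i\<in>J. of_bool (h i y \<le> d / 4))"
        proof (cases "y \<in> A \<and> y \<notin> R")
          case True
          then obtain i where i: "i \<in> J" "h i y \<le> d / 4" using y by (auto simp: R_def J_def not_less)
          have "1 = (of_bool (h i y \<le> d / 4) :: real)" using i by simp
          also have "\<dots> \<le> (\<Sum>i\<in>J. of_bool (h i y \<le> d / 4))"
            using i J by (intro member_le_sum) auto
          finally show ?thesis using True by (simp add: h_i0)
        next
          case False
          have "0 \<le> (\<Sum>i\<in>J. of_bool (h i y \<le> d / 4) :: real)" by (intro sum_nonneg) auto
          then show ?thesis using False by (auto simp: h_i0 indicator_def)
        qed
      qed
      also have "\<dots> = Q (indicator R) x + (\<Sum>i\<in>J. Q (\<lambda>y. of_bool (h i y \<le> d / 4)) x)"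
        by (simp only: markovian_add[OF Q] markovian_sum[OF Q J(1)])
      also have "(\<Sum>i\<in>J. Q (\<lambda>y. of_bool (h i y \<le> d / 4)) x) \<le> (\<Sum>i\<in>J. op_var Q (h i) x * (16 / d\<^sup>2))"
      proof (intro sum_mono)
        fix i assume "i \<in> J"
        then have "2 * (d / 4) \<le> Q (h i) x" using True by (auto simp: E_def J_def less_imp_le)
        from op_chebyshev[OF Q x _ this] show "Q (\<lambda>y. of_bool (h i y \<le> d / 4)) x \<le> op_var Q (h i) x * (16 / d\<^sup>2)"
          using d by (simp add: power_divide mult.commute)
      qed
      finally have "Q (h i0) x \<le> Q (indicator R) x + (\<Sum>i\<in>J. op_var Q (h i) x * (16 / d\<^sup>2))" by simp
      moreover have "d / 2 < Q (h i0) x" using True i0 by (auto simp: E_def)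
      ultimately show ?thesis using True by simp
    next
      case False
      have "0 \<le> (\<Sum>i\<in>J. op_var Q (h i) x * (16 / d\<^sup>2))"
        using op_var_nonneg[OF Q x] by (intro sum_nonneg) auto
      moreover have "0 \<le> Q (indicator R) x" by (intro markovian_nonneg[OF Q _ x]) auto
      ultimately show ?thesis using False by simp
    qed
    have iv: "integrable \<mu> (\<lambda>x. op_var Q (h i) x * (16 / d\<^sup>2))" for i
      by (intro integrable_mult_left integrable_bounded_measurable bounded_measurable_op_var Q h)
    have EE: "{x \<in> space \<mu>. x \<in> E} = E" by (auto simp: E_def)
    have iE: "integrable \<mu> (\<lambda>x. of_bool (x \<in> E) * (d / 2))"
      using E by (intro integrable_mult_left integrable_of_bool) (simp add: EE)
    have var: "(\<integral>x. op_var Q (h i) x \<partial>\<mu>) \<le> e" if "i \<in> J" for i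
    proof -
      have "0 < fst (G i)" "0 < snd (G i)" using G that by (auto simp: J_def)
      then have "n \<le> Suc (n * fst (G i))" "n \<le> Suc (n * snd (G i))" by (simp_all add: le_SucI)
      then show ?thesis unfolding Q_def h_def by (rule integral_op_var_dens_le[OF s[OF n(1)]])
    qed
    have "d / 4 * c = d / 2 * c - d / 4 * c" by simp
    also have "\<dots> \<le> d / 2 * measure \<mu> E - k * e * 16 / d\<^sup>2"
      using E(2) e(3) d by (intro diff_mono mult_left_mono) auto
    also have "\<dots> \<le> d / 2 * measure \<mu> E - (\<Sum>i\<in>J. (\<integral>x. op_var Q (h i) x \<partial>\<mu>) * (16 / d\<^sup>2))"
    proof -
      have "(\<Sum>i\<in>J. (\<integral>x. op_var Q (h i) x \<partial>\<mu>) * (16 / d\<^sup>2)) \<le> (\<Sum>i\<in>J. e * (16 / d\<^sup>2))"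
        using var by (intro sum_mono mult_right_mono) auto
      also have "\<dots> = card J * (e * (16 / d\<^sup>2))" by simp
      also have "\<dots> \<le> k * (e * (16 / d\<^sup>2))" using J(2) e(1) by (intro mult_right_mono) auto
      finally show ?thesis by (simp add: mult_ac)
    qed
    also have "\<dots> = (\<integral>x. of_bool (x \<in> E) * (d / 2) - (\<Sum>i\<in>J. op_var Q (h i) x * (16 / d\<^sup>2)) \<partial>\<mu>)"
    proof -
      have "(\<integral>x. (\<Sum>i\<in>J. op_var Q (h i) x * (16 / d\<^sup>2)) \<partial>\<mu>) = (\<Sum>i\<in>J. (\<integral>x. op_var Q (h i) x \<partial>\<mu>) * (16 / d\<^sup>2))"
        by (subst Bochner_Integration.integral_sum[OF iv]) simp
      moreover have "(\<integral>x. of_bool (x \<in> E) * (d / 2) \<partial>\<mu>) = d / 2 * measure \<mu> E"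
        using integral_of_bool[of "\<lambda>x. x \<in> E"] E by (simp add: EE)
      ultimately show ?thesis
        by (simp only: Bochner_Integration.integral_diff[OF iE Bochner_Integration.integrable_sum[OF iv]])
    qed
    also have "\<dots> \<le> (\<integral>x. Q (indicator R) x \<partial>\<mu>)"
    proof (rule integral_mono)
      show "integrable \<mu> (\<lambda>x. of_bool (x \<in> E) * (d / 2) - (\<Sum>i\<in>J. op_var Q (h i) x * (16 / d\<^sup>2)))"
        by (intro Bochner_Integration.integrable_diff iE Bochner_Integration.integrable_sum iv)
      show "integrable \<mu> (Q (indicator R))"
        using R by (intro integrable_bounded_measurable markovian_bounded_measurable[OF Q] bounded_measurable_indicator)
    qed (rule point)
    also have "\<dots> = measure \<mu> R"
      using R markovian_integral[OF Q bounded_measurable_indicator[OF R]] by simp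
    finally have "d / 4 * c \<le> measure \<mu> R" .
    then show ?thesis
      using n s[OF n(1)] stable_mono[OF _ e(2)] by (intro exI[of _ n]) (auto simp: R_def h_def)
  qed
  then show ?thesis using d c(1) unfolding d_def by (intro exI[of _ "d / 4 * c"]) (auto simp: d_def)
qed

end

section \<open>Trees\<close>

text \<open>The value 0 outside the space makes the commutation of two averages an equality of
  functions, although the maps commute only on the space.\<close>

definition average :: "'m measure \<Rightarrow> ('l::finite \<Rightarrow> 'm \<Rightarrow> 'm) \<Rightarrow> ('l \<Rightarrow> real) \<Rightarrow> ('m \<Rightarrow> real) \<Rightarrow> 'm \<Rightarrow> real" where
  "average \<mu> T q f x = (if x \<in> space \<mu> then \<Sum>l\<in>UNIV. q l * f (T l x) else 0)"

lemma average_ge_term: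
  assumes q: "\<And>l. 0 < q l" and T: "\<And>l. T l x \<in> space \<mu>" and x: "x \<in> space \<mu>"
    and f: "\<And>y. y \<in> space \<mu> \<Longrightarrow> 0 \<le> f y"
  shows "f (T l x) \<le> average \<mu> T q f x / q l"
proof -
  have "q l * f (T l x) \<le> (\<Sum>l\<in>UNIV. q l * f (T l x))"
    using q f T by (intro member_le_sum) (auto intro!: mult_nonneg_nonneg less_imp_le[OF q])
  then show ?thesis using q[of l] x by (simp add: average_def field_simps)
qed

text \<open>In the application \<open>D\<close> is the set of roots of trees of order \<open>j\<close> and \<open>E\<close> the exceptional set.\<close>

lemma bad_direction_bound:
  fixes f :: "'m \<Rightarrow> real" and h :: "'i \<Rightarrow> 'm \<Rightarrow> real"
  assumes P: "markovian \<mu> (average \<mu> T q)" and Q: "markovian \<mu> Q"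
    and q: "\<And>l. 0 < q l" and T: "\<And>l. T l x \<in> space \<mu>" and x: "x \<in> space \<mu>"
    and s: "0 < s" and J: "finite J"
    and cover: "\<And>y. y \<in> space \<mu> \<Longrightarrow> f y \<le> indicator D y + indicator E y + (\<Sum>i\<in>J. of_bool (h i y \<le> s))"
    and Pf: "2 * s \<le> average \<mu> T q (Q f) x"
    and Ph: "\<And>i. i \<in> J \<Longrightarrow> 2 * s \<le> average \<mu> T q (Q (h i)) x"
    and bad: "Q (indicator D) (T l x) \<le> 0"
  shows "q l * s \<le> average \<mu> T q (Q (indicator E)) x
    + (\<Sum>i\<in>J. op_var (\<lambda>g. average \<mu> T q (Q g)) (h i) x / s\<^sup>2) + op_var (average \<mu> T q) (Q f) x / s"
proof -
  let ?P = "average \<mu> T q"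
  have PQ: "markovian \<mu> (\<lambda>g. ?P (Q g))" by (rule markovian_comp[OF P Q])
  have E0: "0 \<le> ?P (Q (indicator E)) x"
    by (intro markovian_nonneg[OF PQ _ x]) auto
  have V0: "0 \<le> (\<Sum>i\<in>J. op_var (\<lambda>g. ?P (Q g)) (h i) x / s\<^sup>2)"
    using op_var_nonneg[OF PQ x] by (intro sum_nonneg) auto
  have W0: "0 \<le> op_var ?P (Q f) x / s" using op_var_nonneg[OF P x] s by simp
  show ?thesis
  \<comment> \<open>Either \<open>Q f\<close> after the step \<open>l\<close> is far below its mean,
    which costs variance in this first step; or it is not, and then its mass beyond
    \<open>T l x\<close>, missing \<open>D\<close>, must fall on \<open>E\<close> or on points where
    some \<open>h i\<close> is small.\<close>
  proof (cases "Q f (T l x) < s")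
    case True
    have "q l * s\<^sup>2 \<le> q l * (?P (Q f) x - Q f (T l x))\<^sup>2"
      using True Pf s q[of l] by (intro mult_left_mono power_mono) auto
    also have "\<dots> = q l * (Q f (T l x) - ?P (Q f) x)\<^sup>2" by (simp add: power2_commute)
    also have "\<dots> \<le> ?P (\<lambda>y. (Q f y - ?P (Q f) x)\<^sup>2) x"
      using average_ge_term[of q T x \<mu> "\<lambda>y. (Q f y - ?P (Q f) x)\<^sup>2" l] q T x by (simp add: field_simps)
    also have "\<dots> = op_var ?P (Q f) x" by (simp add: op_var_eq[OF P x])
    finally have "q l * s \<le> op_var ?P (Q f) x / s"
      using s by (simp add: field_simps power2_eq_square)
    then show ?thesis using E0 V0 by linarith
  next
    case False
    define g where "g y = indicator E y + (\<Sum>i\<in>J. of_bool (h i y \<le> s) :: real)" for y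
    have "Q f (T l x) \<le> Q (\<lambda>y. indicator D y + g y) (T l x)"
      using cover by (intro markovian_mono[OF Q _ T]) (simp add: g_def add.assoc)
    also have "\<dots> \<le> Q g (T l x)" using bad by (simp add: markovian_add[OF Q])
    also have "\<dots> \<le> ?P (Q g) x / q l"
      by (intro average_ge_term q T x markovian_nonneg[OF Q]) (auto simp: g_def intro!: add_nonneg_nonneg sum_nonneg)
    finally have "s \<le> ?P (Q g) x / q l" using False by simp
    then have "q l * s \<le> ?P (Q g) x" using q[of l] by (simp add: field_simps)
    also have "\<dots> = ?P (Q (indicator E)) x + (\<Sum>i\<in>J. ?P (Q (\<lambda>y. of_bool (h i y \<le> s))) x)"
      unfolding g_def by (simp only: markovian_add[OF PQ] markovian_sum[OF PQ J])
    also have "(\<Sum>i\<in>J. ?P (Q (\<lambda>y. of_bool (h i y \<le> s))) x) \<le> (\<Sum>i\<in>J. op_var (\<lambda>g. ?P (Q g)) (h i) x / s\<^sup>2)"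
      by (intro sum_mono op_chebyshev[OF PQ x s] Ph)
    finally show ?thesis using W0 by linarith
  qed
qed

section \<open>The set of roots\<close>

locale markov_pair = prob_space \<mu> for \<mu> :: "'m measure" +
  fixes T1 T2 :: "'l::finite \<Rightarrow> 'm \<Rightarrow> 'm" and q1 q2 :: "'l \<Rightarrow> real" and A :: "'m set"
  assumes q1: "\<And>l. 0 < q1 l" and q2: "\<And>l. 0 < q2 l"
    and T1: "\<And>l. T1 l \<in> measurable \<mu> \<mu>" and T2: "\<And>l. T2 l \<in> measurable \<mu> \<mu>"
    and T_commute: "\<And>l l' x. x \<in> space \<mu> \<Longrightarrow> T1 l (T2 l' x) = T2 l' (T1 l x)"
    and markovian1: "markovian \<mu> (average \<mu> T1 q1)" and markovian2: "markovian \<mu> (average \<mu> T2 q2)"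
    and A: "A \<in> sets \<mu>" "measure \<mu> A > 0"
begin

abbreviation "P1 \<equiv> average \<mu> T1 q1"
abbreviation "P2 \<equiv> average \<mu> T2 q2"

lemma T1_in: "x \<in> space \<mu> \<Longrightarrow> T1 l x \<in> space \<mu>" and T2_in: "x \<in> space \<mu> \<Longrightarrow> T2 l x \<in> space \<mu>"
  using T1[THEN measurable_space] T2[THEN measurable_space] by auto

sublocale commuting_markovian \<mu> P1 P2 A
proof
  show "P1 (P2 f) = P2 (P1 f)" for f
  proof
    fix x
    show "P1 (P2 f) x = P2 (P1 f) x"
    proof (cases "x \<in> space \<mu>")
      case True
      then have "P1 (P2 f) x = (\<Sum>l\<in>UNIV. \<Sum>l'\<in>UNIV. q1 l * (q2 l' * f (T2 l' (T1 l x))))"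
        by (simp add: average_def T1_in sum_distrib_left)
      also have "\<dots> = (\<Sum>l'\<in>UNIV. \<Sum>l\<in>UNIV. q1 l * (q2 l' * f (T2 l' (T1 l x))))"
        by (rule sum.swap)
      also have "\<dots> = P2 (P1 f) x"
        using True by (simp add: average_def T2_in sum_distrib_left T_commute mult_ac)
      finally show ?thesis .
    qed (simp add: average_def)
  qed
qed (use markovian1 markovian2 A in auto)

end

locale tree_steps = markov_pair \<mu> T1 T2 q1 q2 A
  for \<mu> :: "'m measure" and T1 T2 :: "'l::finite \<Rightarrow> 'm \<Rightarrow> 'm" and q1 q2 :: "'l \<Rightarrow> real" and A :: "'m set" +
  fixes u1 u2 v1 v2 :: nat
  assumes pos: "0 < u1" "0 < u2" "0 < v1" "0 < v2"
begin

text \<open>A positive power at \<open>T l x\<close> expresses that some path with initial direction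
  \<open>l\<close> ends in a root of order \<open>j\<close>. One exponent is reduced by one for the
  step already made.\<close>

primrec roots :: "nat \<Rightarrow> nat \<Rightarrow> 'm set" where
  "roots n 0 = A"
| "roots n (Suc j) = {x \<in> space \<mu>. x \<in> A \<and> (\<forall>l.
     0 < Pz (n * u1 - 1) (n * u2) (indicator (roots n j)) (T1 l x) \<and>
     0 < Pz (n * v1) (n * v2 - 1) (indicator (roots n j)) (T2 l x))}"

lemma roots_sets: "roots n j \<in> sets \<mu>"
proof (induction j)
  case (Suc j)
  have [measurable]: "Pz a b (indicator (roots n j)) \<in> borel_measurable \<mu>" for a b
    using Suc by (intro markovian_measurable[OF markovian_Pz]) simp
  note [measurable] = T1 T2 A(1)
  show ?case unfolding roots.simps by measurable
qed (simp add: A)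

lemma roots_subset: "roots n j \<subseteq> A"
  by (cases j) auto

text \<open>The condition inherited down the tree: order \<open>Suc j\<close> at a point controls
  the mean values, after one branch, of all functions in the condition of order \<open>j\<close>.
  The box makes the index set visibly finite for measurability.\<close>

definition heavy :: "nat \<Rightarrow> nat \<Rightarrow> real \<Rightarrow> 'm set" where
  "heavy n j s = {x \<in> space \<mu>. x \<in> A \<and> (\<forall>(a, b)\<in>{..j} \<times> {..j}. 0 < a + b \<and> a + b \<le> j \<longrightarrow>
     s < dens (n * (a * u1 + b * v1)) (n * (a * u2 + b * v2)) x)}"

lemma heavy_sets: "heavy n j s \<in> sets \<mu>"
proof -
  have "finite ({..j} \<times> {..j})" by simp
  note [measurable] = A(1) and sets.sets_Collect_finite_All[OF _ this, measurable]
  show ?thesis unfolding heavy_def by measurable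
qed

definition offsets :: "nat \<Rightarrow> (nat \<times> nat) set" where
  "offsets j = {(a, b) \<in> {..j} \<times> {..j}. 0 < a + b \<and> a + b \<le> j}"

lemma finite_offsets: "finite (offsets j)"
  by (rule finite_subset[of _ "{..j} \<times> {..j}"]) (auto simp: offsets_def)

lemma heavyD:
  "x \<in> heavy n j s \<Longrightarrow> 0 < a + b \<Longrightarrow> a + b \<le> j \<Longrightarrow> s < dens (n * (a * u1 + b * v1)) (n * (a * u2 + b * v2)) x"
  by (auto simp: heavy_def)

lemma not_heavy:
  assumes "x \<in> space \<mu>" "x \<in> A" "x \<notin> heavy n j s"
  shows "\<exists>(a, b)\<in>offsets j. dens (n * (a * u1 + b * v1)) (n * (a * u2 + b * v2)) x \<le> s"
  using assms by (force simp: heavy_def offsets_def not_less)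

text \<open>This integrates \<open>bad_direction_bound\<close>. Invariance turns the term of the
  exceptional set into its measure, and stability bounds the integrated variances. The pair
  \<open>(a0, b0)\<close> is \<open>(1, 0)\<close> for an X-branch and \<open>(0, 1)\<close> for a
  Y-branch.\<close>

lemma bad_set_measure:
  assumes P: "average \<mu> T q = Pz c' d'" and q: "\<And>l. 0 < q l" and T: "\<And>l. T l \<in> measurable \<mu> \<mu>"
    and ab: "a0 + b0 = 1" and cd: "c' + c = n * (a0 * u1 + b0 * v1)" "d' + d = n * (a0 * u2 + b0 * v2)"
    and n: "n \<le> Suc c" "n \<le> Suc d" and st: "stable \<epsilon> n" and s: "0 < s"
  shows "q l * s * measure \<mu> {x \<in> space \<mu>. x \<in> heavy n (Suc j) (2 * s) \<and> Pz c d (indicator (roots n j)) (T l x) \<le> 0}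
    \<le> measure \<mu> (heavy n j s - roots n j) + card (offsets j) * (\<epsilon> / s\<^sup>2) + \<epsilon> / s"
proof -
  define E where "E = heavy n j s - roots n j"
  have E: "E \<in> sets \<mu>" using heavy_sets roots_sets by (auto simp: E_def)
  define h where "h = (\<lambda>(a, b). dens (n * (a * u1 + b * v1)) (n * (a * u2 + b * v2)))"
  have h: "bounded_measurable \<mu> (h i)" for i by (cases i) (simp add: h_def bounded_measurable_dens)
  define B where "B = {x \<in> space \<mu>. x \<in> heavy n (Suc j) (2 * s) \<and> Pz c d (indicator (roots n j)) (T l x) \<le> 0}"
  have [measurable]: "Pz c d (indicator (roots n j)) \<in> borel_measurable \<mu>"
    using roots_sets by (intro markovian_measurable[OF markovian_Pz]) simp
  note [measurable] = T heavy_sets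
  have B: "B \<in> sets \<mu>" unfolding B_def by measurable
  have Pav: "markovian \<mu> (average \<mu> T q)" unfolding P by (rule markovian_Pz)
  have PQ: "average \<mu> T q (Pz c d g) = Pz (c' + c) (d' + d) g" for g by (simp add: P Pz_Pz)
  define F where "F x = Pz (c' + c) (d' + d) (indicator E) x
    + (\<Sum>i\<in>offsets j. op_var (Pz (c' + c) (d' + d)) (h i) x / s\<^sup>2) + op_var (Pz c' d') (dens c d) x / s" for x
  have i1: "integrable \<mu> (Pz (c' + c) (d' + d) (indicator E))"
    using E by (intro integrable_bounded_measurable markovian_bounded_measurable[OF markovian_Pz] bounded_measurable_indicator)
  have i2: "integrable \<mu> (\<lambda>x. op_var (Pz (c' + c) (d' + d)) (h i) x / s\<^sup>2)" for i
    by (intro integrable_divide integrable_bounded_measurable bounded_measurable_op_var markovian_Pz h)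
  have i3: "integrable \<mu> (\<lambda>x. op_var (Pz c' d') (dens c d) x / s)"
    by (intro integrable_divide integrable_bounded_measurable bounded_measurable_op_var markovian_Pz bounded_measurable_dens)
  have i12: "integrable \<mu> (\<lambda>x. Pz (c' + c) (d' + d) (indicator E) x + (\<Sum>i\<in>offsets j. op_var (Pz (c' + c) (d' + d)) (h i) x / s\<^sup>2))"
    by (intro Bochner_Integration.integrable_add Bochner_Integration.integrable_sum i1 i2)
  have iF: "integrable \<mu> F"
    unfolding F_def by (intro Bochner_Integration.integrable_add i12 i3)
  have F0: "0 \<le> F x" if "x \<in> space \<mu>" for x
    unfolding F_def using s op_var_nonneg[OF markovian_Pz that]
    by (intro add_nonneg_nonneg sum_nonneg divide_nonneg_pos markovian_nonneg[OF markovian_Pz _ that]) auto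
  have FB: "q l * s \<le> F x" if x: "x \<in> B" for x
  proof -
    have xs: "x \<in> space \<mu>" and xh: "x \<in> heavy n (Suc j) (2 * s)"
      and xb: "Pz c d (indicator (roots n j)) (T l x) \<le> 0" using x by (auto simp: B_def)
    have "q l * s \<le> average \<mu> T q (Pz c d (indicator E)) x
      + (\<Sum>i\<in>offsets j. op_var (\<lambda>g. average \<mu> T q (Pz c d g)) (h i) x / s\<^sup>2)
      + op_var (average \<mu> T q) (Pz c d (indicator A)) x / s"
    proof (rule bad_direction_bound[OF Pav markovian_Pz q _ xs s finite_offsets _ _ _ xb])
      show "T l' x \<in> space \<mu>" for l' using measurable_space[OF T xs] .
      fix y assume y: "y \<in> space \<mu>"
      show "indicator A y \<le> indicator (roots n j) y + indicator E y + (\<Sum>i\<in>offsets j. of_bool (h i y \<le> s) :: real)"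
      proof (cases "y \<in> A \<and> y \<notin> heavy n j s")
        case True
        then obtain i where i: "i \<in> offsets j" "h i y \<le> s" using not_heavy[OF y, of n j s] by (auto simp: h_def)
        have "1 = (of_bool (h i y \<le> s) :: real)" using i by simp
        also have "\<dots> \<le> (\<Sum>i\<in>offsets j. of_bool (h i y \<le> s))"
          using i finite_offsets by (intro member_le_sum) auto
        finally show ?thesis using True by (simp add: add_increasing)
      next
        case False
        have "0 \<le> (\<Sum>i\<in>offsets j. of_bool (h i y \<le> s) :: real)" by (intro sum_nonneg) auto
        then show ?thesis using False by (auto simp: E_def indicator_def)
      qed
    next
      have "2 * s < dens (n * (a0 * u1 + b0 * v1)) (n * (a0 * u2 + b0 * v2)) x"
        by (rule heavyD[OF xh]) (use ab in auto)
      then show "2 * s \<le> average \<mu> T q (Pz c d (indicator A)) x"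
        by (simp add: PQ cd dens_def)
    next
      fix i assume "i \<in> offsets j"
      then obtain a b where i: "i = (a, b)" "0 < a + b" "a + b \<le> j" by (auto simp: offsets_def)
      \<comment> \<open>A branch followed by the offset \<open>(a, b)\<close> is the offset
        \<open>(a0 + a, b0 + b)\<close>, still within order \<open>Suc j\<close>.\<close>
      have "2 * s < dens (n * ((a0 + a) * u1 + (b0 + b) * v1)) (n * ((a0 + a) * u2 + (b0 + b) * v2)) x"
        by (rule heavyD[OF xh]) (use ab i in auto)
      moreover have "c' + c + n * (a * u1 + b * v1) = n * ((a0 + a) * u1 + (b0 + b) * v1)"
        "d' + d + n * (a * u2 + b * v2) = n * ((a0 + a) * u2 + (b0 + b) * v2)"
        unfolding cd by (simp_all add: algebra_simps)
      ultimately have "2 * s \<le> Pz (c' + c) (d' + d) (h i) x"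
        by (simp only: h_def i case_prod_conv Pz_dens less_imp_le)
      then show "2 * s \<le> average \<mu> T q (Pz c d (h i)) x" by (simp only: PQ)
    qed
    then show ?thesis unfolding F_def PQ by (simp add: P dens_def)
  qed
  have "q l * s * measure \<mu> B = (\<integral>x. q l * s * indicator B x \<partial>\<mu>)" using B by simp
  also have "\<dots> \<le> (\<integral>x. F x \<partial>\<mu>)"
  proof (rule integral_mono)
    show "integrable \<mu> (\<lambda>x. q l * s * indicator B x)"
      using B by (intro integrable_mult_right integrable_bounded_measurable bounded_measurable_indicator)
    show "q l * s * indicator B x \<le> F x" if "x \<in> space \<mu>" for x
      using FB[of x] F0[OF that] by (cases "x \<in> B") auto
  qed (rule iF)
  also have "\<dots> = (\<integral>x. Pz (c' + c) (d' + d) (indicator E) x \<partial>\<mu>)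
      + (\<Sum>i\<in>offsets j. (\<integral>x. op_var (Pz (c' + c) (d' + d)) (h i) x \<partial>\<mu>) / s\<^sup>2)
      + (\<integral>x. op_var (Pz c' d') (dens c d) x \<partial>\<mu>) / s"
    unfolding F_def
    by (simp only: Bochner_Integration.integral_add[OF i12 i3] Bochner_Integration.integral_add[OF i1 Bochner_Integration.integrable_sum[OF i2]]
      Bochner_Integration.integral_sum[OF i2] integral_divide_zero)
  also have "(\<integral>x. Pz (c' + c) (d' + d) (indicator E) x \<partial>\<mu>) = measure \<mu> E"
    using markovian_integral[OF markovian_Pz bounded_measurable_indicator[OF E]] E by simp
  also have "(\<Sum>i\<in>offsets j. (\<integral>x. op_var (Pz (c' + c) (d' + d)) (h i) x \<partial>\<mu>) / s\<^sup>2) \<le> (\<Sum>i\<in>offsets j. \<epsilon> / s\<^sup>2)"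
  proof (intro sum_mono divide_right_mono)
    fix i assume "i \<in> offsets j"
    then obtain a b where i: "i = (a, b)" "0 < a + b" by (auto simp: offsets_def)
    have pos': "0 < a * u1 + b * v1" "0 < a * u2 + b * v2" using i pos by auto
    have le: "n \<le> Suc (n * k)" if "0 < k" for k using that by (cases k) auto
    have "n \<le> Suc (n * (a * u1 + b * v1))" "n \<le> Suc (n * (a * u2 + b * v2))"
      by (rule le[OF pos'(1)], rule le[OF pos'(2)])
    then show "(\<integral>x. op_var (Pz (c' + c) (d' + d)) (h i) x \<partial>\<mu>) \<le> \<epsilon>"
      unfolding h_def i by (simp add: integral_op_var_dens_le[OF st])
  qed simp
  also have "(\<integral>x. op_var (Pz c' d') (dens c d) x \<partial>\<mu>) / s \<le> \<epsilon> / s"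
    using s by (intro divide_right_mono integral_op_var_dens_le[OF st n]) auto
  finally show ?thesis by (simp add: B_def E_def)
qed

lemma P1_eq_Pz: "P1 = Pz 1 0" and P2_eq_Pz: "P2 = Pz 0 1"
  by (auto simp: Pz_def fun_eq_iff)

text \<open>A heavy point that is not a root has a bad direction. The threshold is halved at each
  level, as Chebyshev compares a mean of \<open>2 * t\<close> with a value of \<open>t\<close>. The
  tolerance does not depend on \<open>n\<close>.\<close>

lemma heavy_minus_roots:
  "0 < s \<Longrightarrow> 0 < \<eta> \<Longrightarrow> \<exists>\<epsilon>>0. \<forall>n>0. stable \<epsilon> n \<longrightarrow> measure \<mu> (heavy n j s - roots n j) \<le> \<eta>"
proof (induction j arbitrary: s \<eta>)
  case 0
  have "heavy n 0 s - roots n 0 = {}" for n by (auto simp: heavy_def)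
  then have "measure \<mu> (heavy n 0 s - roots n 0) \<le> \<eta>" for n using 0 by (metis measure_empty less_imp_le)
  then show ?case by (intro exI[of _ 1]) (simp del: roots.simps)
next
  case (Suc j)
  define t where "t = s / 2"
  have t: "0 < t" "s = 2 * t" using Suc.prems by (auto simp: t_def)
  define m where "m = Min (range q1 \<union> range q2)"
  have "m \<in> range q1 \<union> range q2" unfolding m_def by (intro Min_in) auto
  then have m: "0 < m" using q1 q2 by auto
  have mq: "m \<le> q1 l" "m \<le> q2 l" for l unfolding m_def by (auto intro: Min_le)
  \<comment> \<open>There are two bad sets for each direction, each allowed
    \<open>\<eta> / (2 * CARD('l))\<close>. The bound \<open>2 * c\<close> splits equally between
    the exceptional set of order \<open>j\<close> and the variance terms.\<close>
  define c where "c = m * t * \<eta> / (4 * CARD('l))"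
  have card0: "0 < real CARD('l)" by simp
  have c: "0 < c" using m t Suc.prems by (simp add: c_def)
  obtain e1 where e1: "0 < e1" "\<And>n. 0 < n \<Longrightarrow> stable e1 n \<Longrightarrow> measure \<mu> (heavy n j t - roots n j) \<le> c"
    using Suc.IH[OF t(1) c] by blast
  define w where "w = card (offsets j) / t\<^sup>2 + 1 / t"
  have w: "0 < w" using t by (auto simp: w_def intro: add_nonneg_pos)
  define e where "e = min e1 (c / w)"
  have e: "0 < e" "e \<le> e1" "e * w \<le> c"
  proof -
    show "0 < e" "e \<le> e1" using e1 c w by (auto simp: e_def)
    have "e * w \<le> c / w * w" using w by (intro mult_right_mono) (auto simp: e_def)
    then show "e * w \<le> c" using w by simp
  qed
  have "measure \<mu> (heavy n (Suc j) s - roots n (Suc j)) \<le> \<eta>" if n: "0 < n" and st: "stable e n" for n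
  proof -
    define BX where "BX l = {x \<in> space \<mu>. x \<in> heavy n (Suc j) (2 * t) \<and> Pz (n * u1 - 1) (n * u2) (indicator (roots n j)) (T1 l x) \<le> 0}" for l
    define BY where "BY l = {x \<in> space \<mu>. x \<in> heavy n (Suc j) (2 * t) \<and> Pz (n * v1) (n * v2 - 1) (indicator (roots n j)) (T2 l x) \<le> 0}" for l
    have [measurable]: "Pz a b (indicator (roots n j)) \<in> borel_measurable \<mu>" for a b
      using roots_sets by (intro markovian_measurable[OF markovian_Pz]) simp
    note [measurable] = T1 T2 heavy_sets
    have BXY: "BX l \<in> sets \<mu>" "BY l \<in> sets \<mu>" for l
      unfolding BX_def BY_def by measurable
    have nu: "Suc (n * u1 - 1) = n * u1" "Suc (n * v2 - 1) = n * v2" using n pos by auto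
    have le: "n \<le> Suc (n * u1 - 1)" "n \<le> Suc (n * u2)" "n \<le> Suc (n * v1)" "n \<le> Suc (n * v2 - 1)"
      unfolding nu using pos by (auto intro: le_SucI)
    have bound: "measure \<mu> (heavy n j t - roots n j) + card (offsets j) * (e / t\<^sup>2) + e / t \<le> 2 * c"
    proof -
      have "measure \<mu> (heavy n j t - roots n j) \<le> c" using e1(2)[OF n] stable_mono[OF st e(2)] .
      moreover have "card (offsets j) * (e / t\<^sup>2) + e / t = e * w" by (simp add: w_def algebra_simps)
      ultimately show ?thesis using e(3) by linarith
    qed
    have two_c: "2 * c = m * t * (\<eta> / (2 * CARD('l)))" by (simp add: c_def)
    have X: "measure \<mu> (BX l) \<le> \<eta> / (2 * CARD('l))" for l
    proof -
      have "q1 l * t * measure \<mu> (BX l) \<le> measure \<mu> (heavy n j t - roots n j) + card (offsets j) * (e / t\<^sup>2) + e / t"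
        unfolding BX_def
        by (rule bad_set_measure[OF P1_eq_Pz q1 T1 _ _ _ le(1,2) st t(1), of 1 0]) (use nu in auto)
      also have "\<dots> \<le> m * t * (\<eta> / (2 * CARD('l)))" using bound two_c by simp
      also have "\<dots> \<le> q1 l * t * (\<eta> / (2 * CARD('l)))"
        using mq t Suc.prems by (intro mult_right_mono) auto
      finally show ?thesis by (rule mult_left_le_imp_le) (use q1[of l] t in auto)
    qed
    have Y: "measure \<mu> (BY l) \<le> \<eta> / (2 * CARD('l))" for l
    proof -
      have "q2 l * t * measure \<mu> (BY l) \<le> measure \<mu> (heavy n j t - roots n j) + card (offsets j) * (e / t\<^sup>2) + e / t"
        unfolding BY_def
        by (rule bad_set_measure[OF P2_eq_Pz q2 T2 _ _ _ le(3,4) st t(1), of 0 1]) (use nu in auto)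
      also have "\<dots> \<le> m * t * (\<eta> / (2 * CARD('l)))" using bound two_c by simp
      also have "\<dots> \<le> q2 l * t * (\<eta> / (2 * CARD('l)))"
        using mq t Suc.prems by (intro mult_right_mono) auto
      finally show ?thesis by (rule mult_left_le_imp_le) (use q2[of l] t in auto)
    qed
    have "measure \<mu> (heavy n (Suc j) s - roots n (Suc j)) \<le> measure \<mu> ((\<Union>l\<in>UNIV. BX l) \<union> (\<Union>l\<in>UNIV. BY l))"
    proof (rule finite_measure_mono)
      show "heavy n (Suc j) s - roots n (Suc j) \<subseteq> (\<Union>l\<in>UNIV. BX l) \<union> (\<Union>l\<in>UNIV. BY l)"
      proof
        fix x assume x: "x \<in> heavy n (Suc j) s - roots n (Suc j)"
        then have "x \<in> space \<mu>" "x \<in> A" by (auto simp: heavy_def)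
        then show "x \<in> (\<Union>l\<in>UNIV. BX l) \<union> (\<Union>l\<in>UNIV. BY l)"
          using x unfolding t(2) by (auto simp: BX_def BY_def not_less)
      qed
    qed (use BXY in auto)
    also have "\<dots> \<le> measure \<mu> (\<Union>l\<in>UNIV. BX l) + measure \<mu> (\<Union>l\<in>UNIV. BY l)"
      using BXY by (intro measure_Un_le) auto
    also have "\<dots> \<le> (\<Sum>l\<in>UNIV. measure \<mu> (BX l)) + (\<Sum>l\<in>UNIV. measure \<mu> (BY l))"
      using BXY by (intro add_mono finite_measure_subadditive_finite) auto
    also have "\<dots> \<le> (\<Sum>l\<in>(UNIV::'l set). \<eta> / (2 * CARD('l))) + (\<Sum>l\<in>(UNIV::'l set). \<eta> / (2 * CARD('l)))"
      by (intro add_mono sum_mono X Y)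
    also have "\<dots> = \<eta>" by simp
    finally show ?thesis .
  qed
  then show ?case using e(1) by blast
qed

text \<open>The recurrence set consists of heavy points and has measure at least \<open>c\<close>.
  Since \<open>c\<close> is known before the tolerance, the latter can be taken so small that the
  non-roots among the heavy points have measure at most \<open>c / 2\<close>.\<close>

lemma roots_positive:
  "\<exists>n>0. 0 < measure \<mu> (roots n r)"
proof -
  define d where "d = measure \<mu> A"
  have d: "0 < d" using A by (simp add: d_def)
  \<comment> \<open>Quotient and remainder modulo \<open>Suc r\<close> enumerate all pairs with
    entries up to \<open>r\<close>; index 0 gives the zero vector.\<close>
  define G where "G i = (let a = i div Suc r; b = i mod Suc r in (a * u1 + b * v1, a * u2 + b * v2))" for i
  have G: "G i = (0, 0) \<or> 0 < fst (G i) \<and> 0 < snd (G i)" for i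
    using pos by (auto simp: G_def Let_def)
  have G_ab: "\<exists>i<Suc r * Suc r. G i = (a * u1 + b * v1, a * u2 + b * v2)" if "a \<le> r" "b \<le> r" for a b
  proof (intro exI[of _ "a * Suc r + b"] conjI)
    have "a * Suc r + b < a * Suc r + Suc r" using that by simp
    also have "\<dots> = Suc a * Suc r" by simp
    also have "\<dots> \<le> Suc r * Suc r" using that by (intro mult_le_mono1) simp
    finally show "a * Suc r + b < Suc r * Suc r" .
    have "(a * Suc r + b) div Suc r = a" "(a * Suc r + b) mod Suc r = b"
      using that by (simp_all add: div_mult_self3 del: mult_Suc_right)
    then show "G (a * Suc r + b) = (a * u1 + b * v1, a * u2 + b * v2)"
      unfolding G_def Let_def by (simp only:)
  qed
  obtain c where c: "0 < c" "\<And>\<epsilon>. 0 < \<epsilon> \<Longrightarrow> \<exists>n>0. stable \<epsilon> n \<and> c \<le> measure \<mu> {x \<in> space \<mu>. x \<in> A \<and>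
    (\<forall>i<Suc r * Suc r. G i \<noteq> (0, 0) \<longrightarrow> d / 4 < dens (n * fst (G i)) (n * snd (G i)) x)}"
    using recurrence[of "Suc r * Suc r" G 0] G unfolding d_def by (auto simp: G_def)
  obtain \<epsilon> where \<epsilon>: "0 < \<epsilon>" "\<And>n. 0 < n \<Longrightarrow> stable \<epsilon> n \<Longrightarrow> measure \<mu> (heavy n r (d / 4) - roots n r) \<le> c / 2"
    using heavy_minus_roots[of "d / 4" "c / 2" r] d c by auto
  obtain n where n: "0 < n" "stable \<epsilon> n" and cn: "c \<le> measure \<mu> {x \<in> space \<mu>. x \<in> A \<and>
    (\<forall>i<Suc r * Suc r. G i \<noteq> (0, 0) \<longrightarrow> d / 4 < dens (n * fst (G i)) (n * snd (G i)) x)}" (is "_ \<le> measure \<mu> ?R")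
    using c(2)[OF \<epsilon>(1)] by blast
  have "?R \<subseteq> heavy n r (d / 4)"
  proof
    fix x assume x: "x \<in> ?R"
    have "d / 4 < dens (n * (a * u1 + b * v1)) (n * (a * u2 + b * v2)) x" if ab: "0 < a + b" "a + b \<le> r" for a b
    proof -
      obtain i where i: "i < Suc r * Suc r" "G i = (a * u1 + b * v1, a * u2 + b * v2)"
        using G_ab[of a b] ab by auto
      moreover have "G i \<noteq> (0, 0)" using ab pos by (auto simp: i)
      ultimately show ?thesis using x by auto
    qed
    then show "x \<in> heavy n r (d / 4)" using x by (auto simp: heavy_def)
  qed
  then have "c \<le> measure \<mu> (heavy n r (d / 4))"
    using cn finite_measure_mono[OF _ heavy_sets] by (meson order_trans)
  also have "\<dots> \<le> measure \<mu> ((heavy n r (d / 4) - roots n r) \<union> roots n r)"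
    using heavy_sets roots_sets by (intro finite_measure_mono) auto
  also have "\<dots> \<le> measure \<mu> (heavy n r (d / 4) - roots n r) + measure \<mu> (roots n r)"
    using heavy_sets roots_sets by (intro measure_Un_le) auto
  also have "\<dots> \<le> c / 2 + measure \<mu> (roots n r)" using \<epsilon>(2)[OF n] by simp
  finally show ?thesis using c(1) n(1) by (intro exI[of _ n]) auto
qed

end

section \<open>From continuous to measurable test functions\<close>

lemma closed_measure_eq:
  fixes M :: "'m::metric_space set"
  assumes \<mu>: "prob_space \<mu>" "space \<mu> = M" "sets \<mu> = sets (restrict_space borel M)"
    and \<nu>: "prob_space \<nu>" "sets \<nu> = sets \<mu>"
    and eq: "\<And>f::'m \<Rightarrow> real. continuous_on M f \<Longrightarrow> bounded_measurable \<mu> f \<Longrightarrow> (\<integral>x. f x \<partial>\<mu>) = (\<integral>x. f x \<partial>\<nu>)"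
    and C: "closed C"
  shows "measure \<mu> (M \<inter> C) = measure \<nu> (M \<inter> C)"
\<comment> \<open>The distance to the empty set is 0 by convention, so the approximation by
  \<open>f n\<close> would fail for it.\<close>
proof (cases "C = {}")
  case False
  have sp: "space \<nu> = M" using sets_eq_imp_space_eq[OF \<nu>(2)] \<mu>(2) by simp
  define f where "f n x = max 0 (1 - real n * infdist x C)" for n x
  have cont: "continuous_on M (f n)" for n
    unfolding f_def by (intro continuous_intros)
  have meas: "f n \<in> borel_measurable \<mu>" for n
    using borel_measurable_continuous_on_restrict[OF cont, of n] measurable_cong_sets[OF \<mu>(3) refl] by blast
  have abs: "\<bar>f n x\<bar> \<le> 1" for n x using infdist_nonneg[of x C] by (auto simp: f_def)
  have lim: "(\<lambda>n. f n x) \<longlonglongrightarrow> indicator C x" for x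
  proof (cases "x \<in> C")
    case True
    then show ?thesis by (simp add: f_def)
  next
    case no: False
    then have pos: "0 < infdist x C"
      using C False in_closed_iff_infdist_zero[of C x] infdist_nonneg[of x C] by fastforce
    obtain N :: nat where N: "1 / infdist x C < N" using reals_Archimedean2 by blast
    have "f n x = 0" if "n \<ge> N" for n
    proof -
      have "1 / infdist x C \<le> n" using N that by (meson less_imp_le less_le_trans of_nat_le_iff)
      then show ?thesis using pos by (simp add: f_def field_simps)
    qed
    then have "\<forall>\<^sub>F n in sequentially. f n x = indicator C x"
      using no by (auto simp: eventually_sequentially)
    then show ?thesis by (rule tendsto_eventually)
  qed
  have conv: "(\<lambda>n. \<integral>x. f n x \<partial>\<rho>) \<longlonglongrightarrow> measure \<rho> (M \<inter> C)"
    if \<rho>: "prob_space \<rho>" "space \<rho> = M" "sets \<rho> = sets \<mu>" for \<rho>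
  proof -
    interpret prob_space \<rho> by fact
    have MC: "M \<inter> C \<in> sets \<rho>"
      using C \<rho>(3) \<mu>(3) by (auto simp: sets_restrict_space)
    have "(\<lambda>n. \<integral>x. f n x \<partial>\<rho>) \<longlonglongrightarrow> (\<integral>x. indicator (M \<inter> C) x \<partial>\<rho>)"
    proof (rule integral_dominated_convergence[where w = "\<lambda>_. 1"])
      show "f n \<in> borel_measurable \<rho>" for n
        using meas measurable_cong_sets[OF \<rho>(3) refl] by blast
      show "AE x in \<rho>. (\<lambda>n. f n x) \<longlonglongrightarrow> indicator (M \<inter> C) x"
      proof (rule AE_I2)
        fix x assume "x \<in> space \<rho>"
        then have "indicator (M \<inter> C) x = (indicator C x :: real)" using \<rho>(2) by (simp add: indicator_def)
        then show "(\<lambda>n. f n x) \<longlonglongrightarrow> indicator (M \<inter> C) x" using lim[of x] by simp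
      qed
    qed (use MC abs in auto)
    also have "(\<integral>x. indicator (M \<inter> C) x \<partial>\<rho>) = measure \<rho> (M \<inter> C)" using MC by simp
    finally show ?thesis .
  qed
  have "bounded_measurable \<mu> (f n)" for n using meas abs by (rule bounded_measurableI)
  then have "(\<integral>x. f n x \<partial>\<mu>) = (\<integral>x. f n x \<partial>\<nu>)" for n using eq cont by blast
  then show ?thesis
    using LIMSEQ_unique[OF conv[OF \<mu>(1,2) refl]] conv[OF \<nu>(1) sp \<nu>(2)] by simp
qed simp

text \<open>Traces of closed sets form an intersection-stable generator, and their indicators are
  limits of continuous functions.\<close>

lemma measure_eq_if_continuous_integrals_eq:
  fixes M :: "'m::metric_space set"
  assumes M: "closed M" and \<mu>: "prob_space \<mu>" "space \<mu> = M" "sets \<mu> = sets (restrict_space borel M)"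
    and \<nu>: "prob_space \<nu>" "sets \<nu> = sets \<mu>"
    and eq: "\<And>f::'m \<Rightarrow> real. continuous_on M f \<Longrightarrow> bounded_measurable \<mu> f \<Longrightarrow> (\<integral>x. f x \<partial>\<mu>) = (\<integral>x. f x \<partial>\<nu>)"
  shows "\<mu> = \<nu>"
proof -
  interpret \<mu>: prob_space \<mu> by fact
  interpret \<nu>: prob_space \<nu> by fact
  let ?E = "(\<inter>) M ` {C. closed C}"
  have "sets \<mu> = (\<inter>) M ` sigma_sets UNIV {C. closed C}"
    unfolding \<mu>(3) sets_restrict_space by (simp add: borel_eq_closed)
  also have "\<dots> = sigma_sets M ?E"
    using M by (intro sigma_sets_Int) auto
  finally have gen: "sets \<mu> = sigma_sets M ?E" .
  show ?thesis
  proof (rule measure_eqI_generator_eq[where \<Omega> = M and E = ?E and A = "\<lambda>_. M"])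
    show "Int_stable ?E"
    proof (rule Int_stableI_image)
      fix C D :: "'m set" assume "C \<in> {C. closed C}" "D \<in> {C. closed C}"
      then show "\<exists>B\<in>{C. closed C}. M \<inter> C \<inter> (M \<inter> D) = M \<inter> B"
        by (intro bexI[of _ "C \<inter> D"]) auto
    qed
    show "emeasure \<mu> X = emeasure \<nu> X" if "X \<in> ?E" for X
      using that closed_measure_eq[OF \<mu> \<nu> eq] by (auto simp: \<mu>.emeasure_eq_measure \<nu>.emeasure_eq_measure)
    show "range (\<lambda>_::nat. M) \<subseteq> ?E" by (auto intro!: image_eqI[of _ _ UNIV])
  qed (use gen \<nu>(2) in auto)
qed

lemma prob_space_point_measure:
  fixes q :: "'l::finite \<Rightarrow> real"
  assumes "\<And>l. 0 \<le> q l" "(\<Sum>l\<in>UNIV. q l) = 1"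
  shows "prob_space (point_measure UNIV q)"
proof (rule prob_spaceI)
  show "emeasure (point_measure UNIV q) (space (point_measure UNIV q)) = 1"
    using assms by (simp add: space_point_measure emeasure_point_measure_finite sum_ennreal)
qed

text \<open>Stationarity is known for continuous functions only, while the proof applies it to
  indicators. It says that the law \<nu> of the random image of a \<mu>-distributed point has the
  same continuous integrals as \<mu>; hence the two measures coincide.\<close>

lemma markovian_average:
  fixes M :: "'m::metric_space set" and q :: "'l::finite \<Rightarrow> real"
  assumes M: "closed M" and \<mu>: "prob_space \<mu>" "space \<mu> = M" "sets \<mu> = sets (restrict_space borel M)"
    and T: "\<And>l. T l \<in> measurable \<mu> \<mu>" and q: "\<And>l. 0 \<le> q l" "(\<Sum>l\<in>UNIV. q l) = 1"
    and eq: "\<And>f. continuous_on M f \<Longrightarrow> (\<integral>x. (\<Sum>l\<in>UNIV. q l * f (T l x)) \<partial>\<mu>) = (\<integral>x. f x \<partial>\<mu>)"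
  shows "markovian \<mu> (average \<mu> T q)"
proof -
  interpret prob_space \<mu> by fact
  define Q where "Q = point_measure (UNIV :: 'l set) q"
  interpret Q: prob_space Q unfolding Q_def by (rule prob_space_point_measure[OF q])
  interpret pair_prob_space \<mu> Q ..
  define g where "g = (\<lambda>(x, l). T l x)"
  have g: "g \<in> measurable (\<mu> \<Otimes>\<^sub>M Q) \<mu>"
  proof -
    have "(\<lambda>z. T (snd z) (fst z)) \<in> measurable (\<mu> \<Otimes>\<^sub>M Q) \<mu>"
    proof (rule measurable_compose_countable'[where f = "\<lambda>l z. T l (fst z)" and g = snd and I = UNIV])
      show "(\<lambda>z. T l (fst z)) \<in> measurable (\<mu> \<Otimes>\<^sub>M Q) \<mu>" for l
        using measurable_compose[OF measurable_fst T] .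
      have "sets Q = sets (count_space UNIV)" by (simp add: Q_def sets_point_measure)
      then show "snd \<in> measurable (\<mu> \<Otimes>\<^sub>M Q) (count_space UNIV)"
        using measurable_snd[of \<mu> Q] measurable_cong_sets[OF refl] by blast
    qed simp
    then show ?thesis by (simp add: g_def case_prod_beta')
  qed
  define \<nu> where "\<nu> = distr (\<mu> \<Otimes>\<^sub>M Q) \<mu> g"
  have \<nu>_int: "(\<integral>x. f x \<partial>\<nu>) = (\<integral>x. (\<Sum>l\<in>UNIV. q l * f (T l x)) \<partial>\<mu>)" if f: "bounded_measurable \<mu> f" for f
  proof -
    obtain B where B: "\<And>x. x \<in> space \<mu> \<Longrightarrow> \<bar>f x\<bar> \<le> B" using f by (auto simp: bounded_measurable_def)
    have fm: "f \<in> borel_measurable \<mu>" using f by (simp add: bounded_measurable_def)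
    have int: "integrable (\<mu> \<Otimes>\<^sub>M Q) (\<lambda>z. f (g z))"
    proof (rule P.integrable_const_bound[of _ B])
      show "AE z in \<mu> \<Otimes>\<^sub>M Q. norm (f (g z)) \<le> B"
        using measurable_space[OF g] B by (intro AE_I2) auto
    qed (rule measurable_compose[OF g fm])
    have "(\<integral>x. f x \<partial>\<nu>) = (\<integral>z. f (g z) \<partial>(\<mu> \<Otimes>\<^sub>M Q))"
      unfolding \<nu>_def by (rule integral_distr[OF g fm])
    also have "\<dots> = (\<integral>x. (\<integral>l. f (g (x, l)) \<partial>Q) \<partial>\<mu>)"
      by (rule integral_fst'[OF int, symmetric])
    also have "\<dots> = (\<integral>x. (\<Sum>l\<in>UNIV. q l * f (T l x)) \<partial>\<mu>)"
      unfolding Q_def using q by (simp add: lebesgue_integral_point_measure_finite g_def)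
    finally show ?thesis .
  qed
  have "\<mu> = \<nu>"
  proof (rule measure_eq_if_continuous_integrals_eq[OF M \<mu>])
    show "prob_space \<nu>" unfolding \<nu>_def by (rule P.prob_space_distr[OF g])
    show "sets \<nu> = sets \<mu>" by (simp add: \<nu>_def)
  qed (use \<nu>_int eq in auto)
  then have inv: "(\<integral>x. (\<Sum>l\<in>UNIV. q l * f (T l x)) \<partial>\<mu>) = (\<integral>x. f x \<partial>\<mu>)" if "bounded_measurable \<mu> f" for f
    using \<nu>_int[OF that] by simp
  show ?thesis
    unfolding markovian_def
  proof (intro conjI allI ballI impI)
    show "average \<mu> T q (\<lambda>x. a * f x + b * g x) = (\<lambda>x. a * average \<mu> T q f x + b * average \<mu> T q g x)" for f g a b
      by (auto simp: average_def fun_eq_iff sum.distrib sum_distrib_left algebra_simps)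
    show "average \<mu> T q f x \<le> average \<mu> T q g x" if "\<forall>x\<in>space \<mu>. f x \<le> g x" "x \<in> space \<mu>" for f g x
      using that measurable_space[OF T] q by (auto simp: average_def intro!: sum_mono mult_left_mono)
    show "average \<mu> T q (\<lambda>_. 1) x = 1" if "x \<in> space \<mu>" for x
      using that q by (simp add: average_def)
    show "average \<mu> T q f \<in> borel_measurable \<mu>" if [measurable]: "f \<in> borel_measurable \<mu>" for f
    proof -
      note [measurable] = T
      have "(\<lambda>x. \<Sum>l\<in>UNIV. q l * f (T l x)) \<in> borel_measurable \<mu>" by measurable
      then show ?thesis
        by (rule measurable_cong[THEN iffD1, rotated]) (simp add: average_def)
    qed
    show "(\<integral>x. average \<mu> T q f x \<partial>\<mu>) = (\<integral>x. f x \<partial>\<mu>)" if "bounded_measurable \<mu> f" for f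
    proof -
      have "(\<integral>x. average \<mu> T q f x \<partial>\<mu>) = (\<integral>x. (\<Sum>l\<in>UNIV. q l * f (T l x)) \<partial>\<mu>)"
        by (intro Bochner_Integration.integral_cong) (auto simp: average_def)
      then show ?thesis using inv[OF that] by simp
    qed
  qed
qed

section \<open>Paths and trees\<close>

lemma markov_path_Cons:
  assumes "markov_path M T p n xs (T l x) y" "x \<in> M" "0 < p l x"
  shows "markov_path M T p (Suc n) (case_nat x xs) x y" "initial_direction T p (Suc n) (case_nat x xs) l"
  using assms by (auto simp: markov_path_def initial_direction_def All_less_Suc2 split: nat.splits)

text \<open>A positive average has a positive term, so a direction can be chosen at each step
  without losing positivity.\<close>

lemma path_of_average_pos:
  assumes T: "\<And>l. T l \<in> space \<mu> \<rightarrow> space \<mu>" and p: "\<And>l x. x \<in> space \<mu> \<Longrightarrow> 0 < p l x" and q: "\<And>l. 0 < q l"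
    and x: "x \<in> space \<mu>" and pos: "0 < (average \<mu> T q ^^ n) h x"
  shows "\<exists>xs y. markov_path (space \<mu>) T p n xs x y \<and> 0 < h y"
  using x pos
proof (induction n arbitrary: x)
  case 0
  then show ?case by (intro exI[of _ "\<lambda>_. x"] exI[of _ x]) (simp add: markov_path_def)
next
  case (Suc n)
  have "\<exists>l. 0 < (average \<mu> T q ^^ n) h (T l x)"
  proof (rule ccontr)
    assume "\<not> ?thesis"
    then have "(\<Sum>l\<in>UNIV. q l * (average \<mu> T q ^^ n) h (T l x)) \<le> 0"
      using q by (intro sum_nonpos mult_nonneg_nonpos) (auto simp: not_less less_imp_le)
    then show False using Suc.prems average_def[of \<mu> T q "(average \<mu> T q ^^ n) h" x] by simp
  qed
  then obtain l where l: "0 < (average \<mu> T q ^^ n) h (T l x)" by blast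
  have "T l x \<in> space \<mu>" using T Suc.prems by auto
  then obtain xs y where "markov_path (space \<mu>) T p n xs (T l x) y" "0 < h y"
    using Suc.IH l by blast
  then show ?case using markov_path_Cons(1) Suc.prems(1) p by metis
qed

text \<open>Words grow on the right, but the tree is split at the first letter, which selects the
  subtree. Extending a nonempty word therefore stays inside one subtree, and only the empty word
  involves the new root.\<close>

definition graft :: "'m \<Rightarrow> ('l letter \<Rightarrow> 'l letter list \<Rightarrow> 'm) \<Rightarrow> 'l letter list \<Rightarrow> 'm" where
  "graft a \<phi> w = (case w of [] \<Rightarrow> a | c # w' \<Rightarrow> \<phi> c w')"

lemma product_tree_graft:
  fixes \<phi> :: "'l letter \<Rightarrow> 'l letter list \<Rightarrow> 'm"
  assumes a: "a \<in> A"
    and child: "\<And>c. product_tree M T1 p1 T2 p2 u v j A (\<phi> c)"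
    and X: "\<And>l. \<exists>x xs ys. markov_path M T1 p1 (fst u) xs a x \<and> initial_direction T1 p1 (fst u) xs l \<and>
                   markov_path M T2 p2 (snd u) ys x (\<phi> (LX l) [])"
    and Y: "\<And>l. \<exists>x xs ys. markov_path M T2 p2 (snd v) xs a x \<and> initial_direction T2 p2 (snd v) xs l \<and>
                   markov_path M T1 p1 (fst v) ys x (\<phi> (LY l) [])"
  shows "product_tree M T1 p1 T2 p2 u v (Suc j) A (graft a \<phi>)"
  unfolding product_tree_def
proof (intro conjI allI impI)
  show "graft a \<phi> \<in> word_ball (Suc j) \<rightarrow> A"
  proof
    fix w :: "'l letter list" assume "w \<in> word_ball (Suc j)"
    then show "graft a \<phi> w \<in> A"
      using a child by (cases w) (force simp: graft_def product_tree_def word_ball_def)+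
  qed
  fix w :: "'l letter list" and l assume w: "length w < Suc j"
  show "\<exists>x xs ys. markov_path M T1 p1 (fst u) xs (graft a \<phi> w) x \<and> initial_direction T1 p1 (fst u) xs l \<and>
      markov_path M T2 p2 (snd u) ys x (graft a \<phi> (w @ [LX l]))"
    using X w child by (cases w) (auto simp: graft_def product_tree_def)
  show "\<exists>x xs ys. markov_path M T2 p2 (snd v) xs (graft a \<phi> w) x \<and> initial_direction T2 p2 (snd v) xs l \<and>
      markov_path M T1 p1 (fst v) ys x (graft a \<phi> (w @ [LY l]))"
    using Y w child by (cases w) (auto simp: graft_def product_tree_def)
qed

context tree_steps
begin

lemma product_tree_of_roots:
  assumes p1: "\<And>l x. x \<in> space \<mu> \<Longrightarrow> 0 < p1 l x" and p2: "\<And>l x. x \<in> space \<mu> \<Longrightarrow> 0 < p2 l x" and n: "0 < n"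
  shows "x \<in> roots n j \<Longrightarrow>
    \<exists>\<phi>. product_tree (space \<mu>) T1 p1 T2 p2 (n * u1, n * u2) (n * v1, n * v2) j A \<phi> \<and> tree_root \<phi> = x"
proof (induction j arbitrary: x)
  case 0
  then show ?case
    by (intro exI[of _ "\<lambda>_. x"]) (auto simp: product_tree_def tree_root_def word_ball_def)
next
  case (Suc j)
  have T1': "T1 l \<in> space \<mu> \<rightarrow> space \<mu>" and T2': "T2 l \<in> space \<mu> \<rightarrow> space \<mu>" for l
    using T1_in T2_in by auto
  have x: "x \<in> space \<mu>" "x \<in> A" using Suc.prems by auto
  have nu: "Suc (n * u1 - 1) = n * u1" "Suc (n * v2 - 1) = n * v2" using n pos by auto
  have X: "\<exists>z\<in>roots n j. \<exists>y xs ys. markov_path (space \<mu>) T1 p1 (n * u1) xs x y \<and>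
      initial_direction T1 p1 (n * u1) xs l \<and> markov_path (space \<mu>) T2 p2 (n * u2) ys y z" for l
  proof -
    have "0 < (P1 ^^ (n * u1 - 1)) ((P2 ^^ (n * u2)) (indicator (roots n j))) (T1 l x)"
      using Suc.prems by (simp add: Pz_def)
    from path_of_average_pos[where p = p1, OF T1' p1 q1 T1_in[OF x(1)] this]
    obtain xs y where xs: "markov_path (space \<mu>) T1 p1 (n * u1 - 1) xs (T1 l x) y"
      and y: "0 < (P2 ^^ (n * u2)) (indicator (roots n j)) y" by auto
    have "y \<in> space \<mu>" using xs by (auto simp: markov_path_def)
    from path_of_average_pos[where p = p2, OF T2' p2 q2 this y]
    obtain ys z where ys: "markov_path (space \<mu>) T2 p2 (n * u2) ys y z" and z: "0 < (indicator (roots n j) z :: real)" by auto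
    have "z \<in> roots n j" using z by (simp add: indicator_def split: if_splits)
    then show ?thesis
      using markov_path_Cons[where p = p1, OF xs x(1) p1[OF x(1)], unfolded nu] ys by blast
  qed
  have Y: "\<exists>z\<in>roots n j. \<exists>y xs ys. markov_path (space \<mu>) T2 p2 (n * v2) xs x y \<and>
      initial_direction T2 p2 (n * v2) xs l \<and> markov_path (space \<mu>) T1 p1 (n * v1) ys y z" for l
  proof -
    \<comment> \<open>In a Y-branch the path in the second system comes before the one in the first,
      opposite to the order in \<open>Pz\<close>; this is where commutation enters.\<close>
    have "0 < (P2 ^^ (n * v2 - 1)) ((P1 ^^ (n * v1)) (indicator (roots n j))) (T2 l x)"
      using Suc.prems by (simp add: Pz_def P1_pow_P2_pow)
    from path_of_average_pos[where p = p2, OF T2' p2 q2 T2_in[OF x(1)] this]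
    obtain xs y where xs: "markov_path (space \<mu>) T2 p2 (n * v2 - 1) xs (T2 l x) y"
      and y: "0 < (P1 ^^ (n * v1)) (indicator (roots n j)) y" by auto
    have "y \<in> space \<mu>" using xs by (auto simp: markov_path_def)
    from path_of_average_pos[where p = p1, OF T1' p1 q1 this y]
    obtain ys z where ys: "markov_path (space \<mu>) T1 p1 (n * v1) ys y z" and z: "0 < (indicator (roots n j) z :: real)" by auto
    have "z \<in> roots n j" using z by (simp add: indicator_def split: if_splits)
    then show ?thesis
      using markov_path_Cons[where p = p2, OF xs x(1) p2[OF x(1)], unfolded nu] ys by blast
  qed
  define step where "step c z \<longleftrightarrow> (case c of
      LX l \<Rightarrow> \<exists>y xs ys. markov_path (space \<mu>) T1 p1 (n * u1) xs x y \<and>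
        initial_direction T1 p1 (n * u1) xs l \<and> markov_path (space \<mu>) T2 p2 (n * u2) ys y z
    | LY l \<Rightarrow> \<exists>y xs ys. markov_path (space \<mu>) T2 p2 (n * v2) xs x y \<and>
        initial_direction T2 p2 (n * v2) xs l \<and> markov_path (space \<mu>) T1 p1 (n * v1) ys y z)" for c z
  have "\<forall>c. \<exists>z. z \<in> roots n j \<and> step c z"
  proof
    fix c
    show "\<exists>z. z \<in> roots n j \<and> step c z"
    proof (cases c)
      case (LX l)
      then show ?thesis using X[of l] unfolding step_def LX letter.case by blast
    next
      case (LY l)
      then show ?thesis using Y[of l] unfolding step_def LY letter.case by blast
    qed
  qed
  then obtain z where z: "\<And>c. z c \<in> roots n j" "\<And>c. step c (z c)" by metis
  from Suc.IH[OF z(1)] obtain \<phi> where \<phi>: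
    "\<And>c. product_tree (space \<mu>) T1 p1 T2 p2 (n * u1, n * u2) (n * v1, n * v2) j A (\<phi> c)" "\<And>c. tree_root (\<phi> c) = z c"
    by metis
  have "product_tree (space \<mu>) T1 p1 T2 p2 (n * u1, n * u2) (n * v1, n * v2) (Suc j) A (graft x \<phi>)"
    using z(2) \<phi>(2) x(2) unfolding tree_root_def
    by (intro product_tree_graft \<phi>(1)) (force simp: step_def split: letter.splits)+
  moreover have "tree_root (graft x \<phi>) = x" by (simp add: tree_root_def graft_def)
  ultimately show ?case by blast
qed

end

text \<open>Constancy yields the weights \<open>q\<close> and nondegeneracy their positivity, so
  every step of the maps is admissible in a path. Stationarity supplies the invariance.\<close>

lemma markov_system_average:
  fixes M :: "'m::metric_space set" and T :: "'l::finite \<Rightarrow> 'm \<Rightarrow> 'm"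
  assumes sys: "markov_system M T p" and nd: "nondegenerate M p" and cp: "constant_probabilities M p"
    and \<mu>: "borel_probability_on M \<mu>" and st: "stationary M T p \<mu>"
  obtains q where "\<And>l. 0 < q l" "\<And>l x. x \<in> space \<mu> \<Longrightarrow> p l x = q l"
    "\<And>l. T l \<in> measurable \<mu> \<mu>" "markovian \<mu> (average \<mu> T q)"
proof -
  have \<mu>': "prob_space \<mu>" "space \<mu> = M" "sets \<mu> = sets (restrict_space borel M)"
    using \<mu> by (auto simp: borel_probability_on_def)
  interpret prob_space \<mu> by (rule \<mu>'(1))
  obtain x0 where x0: "x0 \<in> M" using not_empty \<mu>'(2) by auto
  obtain q where q: "\<And>l x. x \<in> M \<Longrightarrow> p l x = q l" using cp unfolding constant_probabilities_def by metis
  have q_pos: "0 < q l" for l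
  proof -
    have "q l \<noteq> 0" using nd q by (auto simp: nondegenerate_def)
    moreover have "0 \<le> p l x0" using sys x0 by (auto simp: markov_system_def Pi_iff)
    ultimately show ?thesis using q[OF x0] by (simp add: less_le)
  qed
  have q_sum: "(\<Sum>l\<in>UNIV. q l) = 1" using sys x0 q by (auto simp: markov_system_def)
  have T: "T l \<in> measurable \<mu> \<mu>" for l
  proof -
    have c: "continuous_on M (T l)" "T l \<in> M \<rightarrow> M" using sys by (auto simp: markov_system_def)
    have "T l \<in> measurable (restrict_space borel M) (restrict_space borel M)"
      using c by (intro measurable_restrict_space2 borel_measurable_continuous_on_restrict) (auto simp: space_restrict_space)
    then show ?thesis using measurable_cong_sets[OF \<mu>'(3) \<mu>'(3)] by blast
  qed
  have eq: "(\<integral>x. (\<Sum>l\<in>UNIV. q l * f (T l x)) \<partial>\<mu>) = (\<integral>x. f x \<partial>\<mu>)" if "continuous_on M f" for f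
  proof -
    have "(\<integral>x. (\<Sum>l\<in>UNIV. q l * f (T l x)) \<partial>\<mu>) = (\<integral>x. markov_operator T p f x \<partial>\<mu>)"
      using q \<mu>'(2) by (intro Bochner_Integration.integral_cong) (auto simp: markov_operator_def)
    then show ?thesis using st that by (simp add: stationary_def)
  qed
  have "closed M" using sys by (auto simp: markov_system_def compact_imp_closed)
  from markovian_average[OF this \<mu>' T less_imp_le[OF q_pos] q_sum eq] show ?thesis
    using that q_pos q T \<mu>'(2) by blast
qed

theorem theorem5p3:
  fixes M :: "'m::metric_space set"
    and T1 T2 :: "'l::finite \<Rightarrow> 'm \<Rightarrow> 'm"
    and p1 p2 :: "'l \<Rightarrow> 'm \<Rightarrow> real"
    and \<mu> :: "'m measure"
    and A :: "'m set"
  assumes "markov_system M T1 p1" and "markov_system M T2 p2"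
    and "nondegenerate M p1" and "nondegenerate M p2"
    and "commuting_systems M T1 T2"
    and "constant_probabilities M p1" and "constant_probabilities M p2"
    and "disjoint_images M T1" and "disjoint_images M T2"
    and "borel_probability_on M \<mu>"
    and "stationary M T1 p1 \<mu>" and "stationary M T2 p2 \<mu>"
    and "A \<in> sets \<mu>" and "measure \<mu> A > 0"
  shows "\<forall>r::nat. \<forall>u1 u2 v1 v2 :: nat. r > 0 \<and> u1 > 0 \<and> u2 > 0 \<and> v1 > 0 \<and> v2 > 0 \<longrightarrow>
    (\<exists>n>0.
      (\<exists>\<phi>. product_tree M T1 p1 T2 p2 (n * u1, n * u2) (n * v1, n * v2) r A \<phi>) \<and>
      (\<exists>A'\<subseteq>A. A' \<in> sets \<mu> \<and> measure \<mu> A' > 0 \<and>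
        (\<forall>a\<in>A'. \<exists>\<phi>. product_tree M T1 p1 T2 p2 (n * u1, n * u2) (n * v1, n * v2) r A \<phi> \<and>
                      tree_root \<phi> = a)))"
proof (intro allI impI)
  fix r u1 u2 v1 v2 :: nat
  assume pos: "r > 0 \<and> u1 > 0 \<and> u2 > 0 \<and> v1 > 0 \<and> v2 > 0"
  have sp: "space \<mu> = M" using assms(10) by (simp add: borel_probability_on_def)
  interpret prob_space \<mu> using assms(10) by (simp add: borel_probability_on_def)
  obtain q1 where *: "\<And>l. 0 < q1 l" "\<And>l x. x \<in> space \<mu> \<Longrightarrow> p1 l x = q1 l"
    "\<And>l. T1 l \<in> measurable \<mu> \<mu>" "markovian \<mu> (average \<mu> T1 q1)"
    using markov_system_average[OF assms(1,3,6,10,11)] by blast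
  obtain q2 where **: "\<And>l. 0 < q2 l" "\<And>l x. x \<in> space \<mu> \<Longrightarrow> p2 l x = q2 l"
    "\<And>l. T2 l \<in> measurable \<mu> \<mu>" "markovian \<mu> (average \<mu> T2 q2)"
    using markov_system_average[OF assms(2,4,7,10,12)] by blast
  interpret tree_steps \<mu> T1 T2 q1 q2 A u1 u2 v1 v2
    using * ** assms(5,13,14) pos by unfold_locales (auto simp: commuting_systems_def sp)
  obtain n where n: "0 < n" "0 < measure \<mu> (roots n r)" using roots_positive by blast
  have tree: "\<exists>\<phi>. product_tree M T1 p1 T2 p2 (n * u1, n * u2) (n * v1, n * v2) r A \<phi> \<and> tree_root \<phi> = a"
    if "a \<in> roots n r" for a
    using product_tree_of_roots[OF _ _ n(1) that, of p1 p2] *(1,2) **(1,2) by (simp add: sp)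
  have "roots n r \<noteq> {}" using n(2) by auto
  then show "\<exists>n>0.
      (\<exists>\<phi>. product_tree M T1 p1 T2 p2 (n * u1, n * u2) (n * v1, n * v2) r A \<phi>) \<and>
      (\<exists>A'\<subseteq>A. A' \<in> sets \<mu> \<and> measure \<mu> A' > 0 \<and>
        (\<forall>a\<in>A'. \<exists>\<phi>. product_tree M T1 p1 T2 p2 (n * u1, n * u2) (n * v1, n * v2) r A \<phi> \<and>
                      tree_root \<phi> = a))"
    using tree n roots_sets roots_subset
    by (intro exI[of _ n] conjI exI[of _ "roots n r"]) blast+
qed

end
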